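(* Assume $\mathbb{P}$ is generated by a PLSEM and is faithful to the DAG of that PLSEM. Then: (a) Let $D\in\mathscr{D}(\mathbb{P})$, let $i\to j$ be a covered edge in $D$, and let $D'$ be the DAG obtained from $D$ by reversing only $i\to j$. Then $D'\in\mathscr{D}(\mathbb{P})$ if and only if $i\to j$ is linear in $D$. Moreover, if $i\to j$ is covered and nonlinear in $D$, then $i\to j$ (with this orientation) in every DAG in $\mathscr{D}(\mathbb{P})$. (b) For any $D,D'\in\mathscr{D}(\mathbb{P})$ there is a sequence $D=D_1,D_2,\dots,D_m=D'$ where each $D_{r+1}$ is obtained from $D_r$ by reversing one edge that is covered and linear in $D_r$, and no edge (pair of nodes) is reversed more than once.
   Context: A PLSEM with DAG $D$ on $\{1,\dots,p\}$ is a system $X_j=\mu_j+\sum_{i\in\mathrm{pa}_D(j)} f_{j,i}(X_i)+\varepsilon_j$, $j=1,\dots,p$, where $\mu_j\in\mathbb{R}$, $f_{j,i}\in C^2(\mathbb{R})$, $f_{j,i}\not\equiv 0$, $\mathbb{E}[f_{j,i}(X_i)]=0$, and $\varepsilon_1,\dots,\varepsilon_p$ are mutually independent with $\varepsilon_j\sim\mathcal{N}(0,\sigma_j^2)$, $\sigma_j^2>0$; the distribution of the solution $X$ is said to be generated by the PLSEM. $\mathbb{P}$ is faithful to $D$ if the conditional independences in $\mathbb{P}$ are exactly those implied by d-separation in $D$. $\mathscr{D}(\mathbb{P})=\{D:\ \mathbb{P}\text{ faithful to }D\text{ and some PLSEM with DAG }D\text{ generates }\mathbb{P}\}$. For $D\in\mathscr{D}(\mathbb{P})$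 the PLSEM with DAG $D$ generating $\mathbb{P}$ is unique; an edge $i\to j$ of $D$ is called linear in $D$ if $f_{j,i}''\equiv 0$ in this PLSEM, and nonlinear otherwise. An edge $i\to j$ is covered in $D$ if $\mathrm{pa}_D(i)=\mathrm{pa}_D(j)\setminus\{i\}$. *)

theory Defs
  imports "HOL-Probability.Probability"
begin

definition nodes :: "nat \<Rightarrow> nat set" where
  "nodes p = {1..p}"

definition is_dag :: "nat \<Rightarrow> (nat \<times> nat) set \<Rightarrow> bool" where
  "is_dag p D \<longleftrightarrow> D \<subseteq> nodes p \<times> nodes p \<and> acyclic D"

definition pa :: "(nat \<times> nat) set \<Rightarrow> nat \<Rightarrow> nat set" where
  "pa D j = {i. (i, j) \<in> D}"

definition C2 :: "(real \<Rightarrow> real) \<Rightarrow> bool" where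
  "C2 g \<longleftrightarrow> (\<exists>g' g''. (\<forall>x. (g has_real_derivative g' x) (at x))
                    \<and> (\<forall>x. (g' has_real_derivative g'' x) (at x))
                    \<and> continuous_on UNIV g'')"

definition sem_sol :: "nat \<Rightarrow> (nat \<times> nat) set \<Rightarrow> (nat \<Rightarrow> real) \<Rightarrow> (nat \<Rightarrow> nat \<Rightarrow> real \<Rightarrow> real)
                       \<Rightarrow> (nat \<Rightarrow> real) \<Rightarrow> (nat \<Rightarrow> real)" where
  "sem_sol p D \<mu> f e = (THE x. x \<in> extensional (nodes p) \<and>
      (\<forall>j\<in>nodes p. x j = \<mu> j + (\<Sum>i\<in>pa D j. f j i (x i)) + e j))"

text \<open>Joint law of mutually independent noises eps_j ~ N(0, sigma_j^2) (sigma_j is the standard deviation).\<close>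
definition noise_law :: "nat \<Rightarrow> (nat \<Rightarrow> real) \<Rightarrow> (nat \<Rightarrow> real) measure" where
  "noise_law p \<sigma> = (\<Pi>\<^sub>M j\<in>nodes p. density lborel (normal_density 0 (\<sigma> j)))"

definition state_space :: "nat \<Rightarrow> (nat \<Rightarrow> real) measure" where
  "state_space p = (\<Pi>\<^sub>M j\<in>nodes p. (borel :: real measure))"

definition plsem_generates ::
  "nat \<Rightarrow> (nat \<times> nat) set \<Rightarrow> (nat \<Rightarrow> real) \<Rightarrow> (nat \<Rightarrow> nat \<Rightarrow> real \<Rightarrow> real) \<Rightarrow> (nat \<Rightarrow> real)
    \<Rightarrow> (nat \<Rightarrow> real) measure \<Rightarrow> bool" where
  "plsem_generates p D \<mu> f \<sigma> P \<longleftrightarrow>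
     is_dag p D \<and>
     (\<forall>j\<in>nodes p. \<sigma> j > 0) \<and>
     P = distr (noise_law p \<sigma>) (state_space p) (sem_sol p D \<mu> f) \<and>
     (\<forall>(i, j)\<in>D. C2 (f j i) \<and> f j i \<noteq> (\<lambda>_. 0) \<and>
        integrable P (\<lambda>x. f j i (x i)) \<and> (\<integral>x. f j i (x i) \<partial>P) = 0)"

definition generated_by_plsem :: "nat \<Rightarrow> (nat \<times> nat) set \<Rightarrow> (nat \<Rightarrow> real) measure \<Rightarrow> bool" where
  "generated_by_plsem p D P \<longleftrightarrow> (\<exists>\<mu> f \<sigma>. plsem_generates p D \<mu> f \<sigma> P)"

definition coord_alg :: "(nat \<Rightarrow> real) measure \<Rightarrow> nat set \<Rightarrow> (nat \<Rightarrow> real) measure" where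
  "coord_alg P C = vimage_algebra (space P) (\<lambda>x. restrict x C) (\<Pi>\<^sub>M j\<in>C. (borel :: real measure))"

definition coord_event :: "(nat \<Rightarrow> real) measure \<Rightarrow> nat set \<Rightarrow> (nat \<Rightarrow> real) set \<Rightarrow> (nat \<Rightarrow> real) set" where
  "coord_event P A a = (\<lambda>x. restrict x A) -` a \<inter> space P"

definition cond_indep :: "(nat \<Rightarrow> real) measure \<Rightarrow> nat set \<Rightarrow> nat set \<Rightarrow> nat set \<Rightarrow> bool" where
  "cond_indep P A B C \<longleftrightarrow>
    (\<forall>a\<in>sets (\<Pi>\<^sub>M j\<in>A. (borel :: real measure)). \<forall>b\<in>sets (\<Pi>\<^sub>M j\<in>B. (borel :: real measure)).
       AE x in P. real_cond_exp P (coord_alg P C)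
                     (indicator (coord_event P A a \<inter> coord_event P B b)) x
                = real_cond_exp P (coord_alg P C) (indicator (coord_event P A a)) x
                  * real_cond_exp P (coord_alg P C) (indicator (coord_event P B b)) x)"

definition adjacent :: "(nat \<times> nat) set \<Rightarrow> nat \<Rightarrow> nat \<Rightarrow> bool" where
  "adjacent D u v \<longleftrightarrow> (u, v) \<in> D \<or> (v, u) \<in> D"

definition is_path :: "(nat \<times> nat) set \<Rightarrow> nat list \<Rightarrow> bool" where
  "is_path D vs \<longleftrightarrow> vs \<noteq> [] \<and> distinct vs \<and>
     (\<forall>k. Suc k < length vs \<longrightarrow> adjacent D (vs ! k) (vs ! Suc k))"

definition descendants :: "(nat \<times> nat) set \<Rightarrow> nat \<Rightarrow> nat set" where
  "descendants D v = {d. (v, d) \<in> D\<^sup>*}"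

definition blocked :: "(nat \<times> nat) set \<Rightarrow> nat set \<Rightarrow> nat list \<Rightarrow> bool" where
  "blocked D C vs \<longleftrightarrow> (\<exists>k. 0 < k \<and> Suc k < length vs \<and>
     (if (vs ! (k - 1), vs ! k) \<in> D \<and> (vs ! Suc k, vs ! k) \<in> D
      then descendants D (vs ! k) \<inter> C = {}
      else vs ! k \<in> C))"

definition d_separated :: "(nat \<times> nat) set \<Rightarrow> nat set \<Rightarrow> nat set \<Rightarrow> nat set \<Rightarrow> bool" where
  "d_separated D A B C \<longleftrightarrow>
     (\<forall>vs. is_path D vs \<and> hd vs \<in> A \<and> last vs \<in> B \<longrightarrow> blocked D C vs)"

definition faithful :: "nat \<Rightarrow> (nat \<Rightarrow> real) measure \<Rightarrow> (nat \<times> nat) set \<Rightarrow> bool" where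
  "faithful p P D \<longleftrightarrow>
     (\<forall>A B C. A \<subseteq> nodes p \<and> B \<subseteq> nodes p \<and> C \<subseteq> nodes p \<and>
        A \<inter> B = {} \<and> A \<inter> C = {} \<and> B \<inter> C = {} \<longrightarrow>
        (cond_indep P A B C \<longleftrightarrow> d_separated D A B C))"

definition scrD :: "nat \<Rightarrow> (nat \<Rightarrow> real) measure \<Rightarrow> (nat \<times> nat) set set" where
  "scrD p P = {D. is_dag p D \<and> faithful p P D \<and> generated_by_plsem p D P}"

text \<open>Edge i -> j is linear in D (the generating PLSEM with DAG D is unique for D in scrD).\<close>
definition linear_edge :: "nat \<Rightarrow> (nat \<Rightarrow> real) measure \<Rightarrow> (nat \<times> nat) set \<Rightarrow> nat \<Rightarrow> nat \<Rightarrow> bool" where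
  "linear_edge p P D i j \<longleftrightarrow>
     (\<exists>\<mu> f \<sigma>. plsem_generates p D \<mu> f \<sigma> P \<and> (\<forall>x. deriv (deriv (f j i)) x = 0))"

definition covered :: "(nat \<times> nat) set \<Rightarrow> nat \<Rightarrow> nat \<Rightarrow> bool" where
  "covered D i j \<longleftrightarrow> (i, j) \<in> D \<and> pa D i = pa D j - {i}"

definition reverse_edge :: "(nat \<times> nat) set \<Rightarrow> nat \<Rightarrow> nat \<Rightarrow> (nat \<times> nat) set" where
  "reverse_edge D i j = (D - {(i, j)}) \<union> {(j, i)}"

end

theory Submission
  imports Defs
begin

text \<open>
  Up to constants, minus twice the log density of a PLSEM is the sum of squared residuals
  weighted by the inverse error variances. If \<open>k\<close> is the last node of one generating PLSEM, the
  second difference of this sum in the \<open>k\<close>-th coordinate depends on the step only, which forces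
  every out-edge of \<open>k\<close> in any other generating PLSEM to be linear. By Bayes' rule \<open>k\<close> can then be
  moved to the end there too, and minimising over the \<open>k\<close>-th coordinate removes it from both.
  A nonlinear covered edge \<open>i \<rightarrow> j\<close>, placed at adjacent positions of the order, survives
  these reductions because only linear functions are added to it; so \<open>j\<close> never precedes \<open>i\<close>.

  Conversely Bayes' rule for two adjacent nodes reverses a linear covered edge. The new edge
  functions cannot vanish: a vanishing one would produce a conditional independence
  (of a node and a former parent given its other parents) that contradicts faithfulness. Part (b)
  follows from Chickering's observation that two distinct Markov equivalent DAGs always differ in an
  edge that is covered in the first one.
\<close>

section \<open>Covered edge reversals and d-separation\<close>

text \<open>Moving a node through an order produces models that need not be faithful, centred or
  free of vanishing edge functions. The reduction is therefore done on the sums \<open>quad\<close>,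
  where any earlier node may enter the equation of a later one; DAGs, laws and faithfulness appear
  only at its two ends. Finite second differences and minimisation over one coordinate ask for no
  more than differentiability, which every exchange of neighbours preserves. The densities are
  positive and continuous, so equal laws give sums that agree at every point up to one constant.

  Neighbouring positions of \<open>i\<close> and \<open>j\<close> matter: a node \<open>k\<close>
  before both depends linearly on \<open>i\<close> once it has passed it, so passing
  \<open>j\<close> adds only a linear term to \<open>f j i\<close>. A node between them could depend
  on \<open>i\<close> nonlinearly, and moving it could cancel the nonlinearity of
  \<open>f j i\<close>.

  On the graph side the obstacle is a collider at \<open>i\<close> that was open only through
  \<open>j\<close>: the reversal takes away these descendants of \<open>i\<close>, and the path has
  to be led through \<open>j\<close> instead.\<close>

fun tri :: "('a \<Rightarrow> 'a \<Rightarrow> 'a \<Rightarrow> bool) \<Rightarrow> 'a list \<Rightarrow> bool" where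
  "tri R (x # v # y # zs) \<longleftrightarrow> R x v y \<and> tri R (v # y # zs)"
| "tri R _ \<longleftrightarrow> True"

text \<open>The two pieces overlap in two nodes, so every triple of consecutive nodes lies in one of
  them. To replace part of a path it then suffices to check the triples around the cut.\<close>

lemma tri_append: "tri R (xs @ u # v # ys) \<longleftrightarrow> tri R (xs @ [u, v]) \<and> tri R (u # v # ys)"
proof (induction xs)
  case (Cons a xs)
  then show ?case by (cases xs rule: list.exhaust; cases "tl xs") auto
qed simp

lemma tri_rev: 
  assumes "\<And>x v y. R x v y \<Longrightarrow> R y v x"
  shows "tri R xs \<Longrightarrow> tri R (rev xs)"
proof (induction xs rule: induct_list012)
  case (3 x y zs)
  show ?case
  proof (cases zs)
    case (Cons z ws)
    then have "tri R (rev (y # zs))" "R x y z" using 3 by auto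
    then show ?thesis using assms tri_append[of R "rev ws" z y "[x]"] Cons by simp
  qed simp
qed simp_all

lemma tri_iff: "tri R vs \<longleftrightarrow> (\<forall>as x v y bs. vs = as @ x # v # y # bs \<longrightarrow> R x v y)"
proof (induction R vs rule: tri.induct)
  case (1 R x v y zs)
  show ?case
  proof
    assume *: "tri R (x # v # y # zs)"
    show "\<forall>as x' v' y' bs. x # v # y # zs = as @ x' # v' # y' # bs \<longrightarrow> R x' v' y'"
    proof (intro allI impI)
      fix as x' v' y' bs assume "x # v # y # zs = as @ x' # v' # y' # bs"
      moreover from * have "R x v y" "\<forall>as x' v' y' bs. v # y # zs = as @ x' # v' # y' # bs \<longrightarrow> R x' v' y'"
        unfolding 1[symmetric] by simp_all
      ultimately show "R x' v' y'" by (cases as) (simp, (simp, blast))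
    qed
  next
    assume *: "\<forall>as x' v' y' bs. x # v # y # zs = as @ x' # v' # y' # bs \<longrightarrow> R x' v' y'"
    then have "R x v y" by blast
    moreover have "tri R (v # y # zs)" unfolding 1
    proof (intro allI impI)
      fix as x' v' y' bs assume "v # y # zs = as @ x' # v' # y' # bs"
      then have "x # v # y # zs = (x # as) @ x' # v' # y' # bs" by simp
      then show "R x' v' y'" using * by blast
    qed
    ultimately show "tri R (x # v # y # zs)" by simp
  qed
qed auto

lemma tri_middle: "tri R (as @ x # v # y # bs) \<Longrightarrow> R x v y"
  by (simp add: tri_append[of R as x v "y # bs"])

lemma in_set_butlast_tlD: "x \<in> set (butlast (tl xs)) \<Longrightarrow> x \<in> set xs"
  by (cases xs) (auto dest: in_set_butlastD)

text \<open>The negation of the blocking condition at one inner node \<open>v\<close> with path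
  neighbours \<open>x\<close> and \<open>y\<close>, free of list indices and symmetric in the
  neighbours.\<close>

definition open_at :: "(nat \<times> nat) set \<Rightarrow> nat set \<Rightarrow> nat \<Rightarrow> nat \<Rightarrow> nat \<Rightarrow> bool" where
  "open_at D C x v y \<longleftrightarrow>
    (if (x, v) \<in> D \<and> (y, v) \<in> D then descendants D v \<inter> C \<noteq> {} else v \<notin> C)"

lemma open_at_sym: "open_at D C x v y \<Longrightarrow> open_at D C y v x"
  by (auto simp: open_at_def)

lemma blocked_iff: "blocked D C vs \<longleftrightarrow> \<not> tri (open_at D C) vs"
proof
  assume "blocked D C vs"
  then obtain k where k: "0 < k" "Suc k < length vs"
    "if (vs ! (k - 1), vs ! k) \<in> D \<and> (vs ! Suc k, vs ! k) \<in> D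
      then descendants D (vs ! k) \<inter> C = {} else vs ! k \<in> C"
    unfolding blocked_def by blast
  then have "\<not> open_at D C (vs ! (k - 1)) (vs ! k) (vs ! Suc k)"
    by (auto simp: open_at_def split: if_splits)
  moreover have "vs = take (k - 1) vs @ vs ! (k - 1) # vs ! k # vs ! Suc k # drop (Suc (Suc k)) vs"
    using k by (metis Cons_nth_drop_Suc Suc_lessD Suc_pred' append_take_drop_id)
  ultimately show "\<not> tri (open_at D C) vs" unfolding tri_iff by blast
next
  assume "\<not> tri (open_at D C) vs"
  then obtain as x v y bs where *: "vs = as @ x # v # y # bs" "\<not> open_at D C x v y"
    unfolding tri_iff by blast
  show "blocked D C vs" unfolding blocked_def
    by (rule exI[of _ "Suc (length as)"]) (use * in \<open>auto simp: open_at_def nth_append split: if_splits\<close>)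
qed

text \<open>An active path from \<open>a\<close> to \<open>b\<close> given \<open>C\<close>, that
  is, a witness against d-separation.\<close>

definition joins :: "(nat \<times> nat) set \<Rightarrow> nat set \<Rightarrow> nat \<Rightarrow> nat \<Rightarrow> nat list \<Rightarrow> bool" where
  "joins D C a b vs \<longleftrightarrow> vs \<noteq> [] \<and> distinct vs \<and> successively (adjacent D) vs
     \<and> tri (open_at D C) vs \<and> hd vs = a \<and> last vs = b"

lemma d_separated_iff:
  "d_separated D A B C \<longleftrightarrow> \<not> (\<exists>a\<in>A. \<exists>b\<in>B. \<exists>vs. joins D C a b vs)"
  unfolding d_separated_def is_path_def joins_def blocked_iff successively_conv_nth by blast

lemma adjacent_sym: "adjacent D u v \<longleftrightarrow> adjacent D v u"
  by (auto simp: adjacent_def)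

lemma joins_rev: "joins D C a b vs \<Longrightarrow> joins D C b a (rev vs)"
  unfolding joins_def
  by (auto simp: hd_rev last_rev adjacent_sym intro: tri_rev open_at_sym)

section \<open>Active paths under the reversal of one covered edge\<close>

locale covered_edge =
  fixes D :: "(nat \<times> nat) set" and i j :: nat
  assumes acyc: "acyclic D" and cov: "covered D i j"
begin

abbreviation "D' \<equiv> reverse_edge D i j"

lemma ij: "(i, j) \<in> D" "i \<noteq> j" "(j, i) \<notin> D" "(j, i) \<in> D'" "(i, j) \<notin> D'"
  and loopfree: "(v, v) \<notin> D"
proof -
  show *: "(v, v) \<notin> D" for v using acyc by (auto simp: acyclic_def)
  show "(i, j) \<in> D" using cov by (simp add: covered_def)
  show "i \<noteq> j" using \<open>(i, j) \<in> D\<close> * by auto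
  show "(j, i) \<notin> D" using acyc \<open>(i, j) \<in> D\<close> by (meson acyclic_def r_into_trancl trancl_into_trancl)
  show "(j, i) \<in> D'" "(i, j) \<notin> D'" using \<open>i \<noteq> j\<close> by (auto simp: reverse_edge_def)
qed

lemma parent_iff: "v \<noteq> i \<Longrightarrow> (v, j) \<in> D \<longleftrightarrow> (v, i) \<in> D"
  using cov loopfree ij unfolding covered_def pa_def by blast

lemma edge_iff: "{u, v} \<noteq> {i, j} \<Longrightarrow> (u, v) \<in> D' \<longleftrightarrow> (u, v) \<in> D"
  by (auto simp: reverse_edge_def)

lemma acyclic_reverse: "acyclic D'"
proof -
  have "(i, j) \<notin> (D - {(i, j)})\<^sup>*"
  proof
    assume "(i, j) \<in> (D - {(i, j)})\<^sup>*"
    then obtain k where k: "(i, k) \<in> (D - {(i, j)})\<^sup>*" "(k, j) \<in> D - {(i, j)}"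
      using ij(2) by (metis rtranclE)
    have "(i, k) \<in> D\<^sup>*" using k(1) rtrancl_mono[of "D - {(i, j)}" D] by blast
    moreover have "(k, i) \<in> D" using k parent_iff[of k] by auto
    ultimately show False using acyc by (meson acyclic_def rtrancl_into_trancl1)
  qed
  moreover have "acyclic (D - {(i, j)})" using acyc by (rule acyclic_subset) blast
  ultimately show ?thesis by (simp add: reverse_edge_def)
qed

lemma covered_reverse: "covered D' j i"
  using cov ij loopfree unfolding covered_def pa_def reverse_edge_def by auto

lemma reverse_reverse: "reverse_edge D' j i = D"
  using ij by (auto simp: reverse_edge_def)

lemma adjacent_reverse: "adjacent D' u v \<longleftrightarrow> adjacent D u v"
  using ij(1) by (auto simp: adjacent_def reverse_edge_def)

lemma parentD:
  assumes "(v, i) \<in> D"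
  shows "v \<noteq> i" "v \<noteq> j" "(v, j) \<in> D" "(v, i) \<in> D'" "(v, j) \<in> D'"
proof -
  show "v \<noteq> i" "v \<noteq> j" using assms loopfree ij by blast+
  then show "(v, j) \<in> D" using assms parent_iff by blast
  then show "(v, i) \<in> D'" "(v, j) \<in> D'"
    using assms \<open>v \<noteq> i\<close> \<open>v \<noteq> j\<close> by (auto simp: reverse_edge_def)
qed

lemma no_back: "(u, v) \<in> D \<Longrightarrow> (v, u) \<notin> D"
  using acyc by (meson acyclic_def r_into_trancl trancl_into_trancl)

lemma no_back': "(u, v) \<in> D' \<Longrightarrow> (v, u) \<notin> D'"
  using acyclic_reverse by (meson acyclic_def r_into_trancl trancl_into_trancl)

text \<open>The only lost edge is i -> j. A path from \<open>v \<noteq> i\<close> enters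
  \<open>i\<close> through a parent of \<open>i\<close>, which by coverage points to
  \<open>j\<close> as well. The second conjunct carries this information to the step where the lost
  edge would be used.\<close>

lemma reach:
  assumes "(v, d) \<in> D\<^sup>*" "v \<noteq> i"
  shows "(v, d) \<in> D'\<^sup>* \<and> (d = i \<longrightarrow> (v, j) \<in> D'\<^sup>*)"
  using assms(1)
proof induction
  case (step y z)
  have "(v, j) \<in> D'\<^sup>*" if "z = i"
  proof -
    have "(y, j) \<in> D'" using step.hyps(2) that parentD by blast
    then show ?thesis using step.IH by (meson rtrancl.rtrancl_into_rtrancl)
  qed
  moreover have "(v, z) \<in> D'\<^sup>*"
  proof (cases "(y, z) = (i, j)")
    case False
    then have "(y, z) \<in> D'" using step.hyps(2) by (auto simp: reverse_edge_def)
    then show ?thesis using step.IH by (meson rtrancl.rtrancl_into_rtrancl)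
  qed (use step.IH in auto)
  ultimately show ?case by blast
qed (use assms in auto)

lemma descendants_mono: "v \<noteq> i \<Longrightarrow> descendants D v \<subseteq> descendants D' v"
  using reach by (auto simp: descendants_def)

text \<open>\<open>i\<close> itself can lose descendants, but \<open>j\<close> now points to
  \<open>i\<close> and inherits them all. This opens at \<open>j\<close> a collider that used to be
  open at \<open>i\<close>.\<close>

lemma descendants_i: "descendants D i \<subseteq> descendants D' j"
proof
  fix d assume "d \<in> descendants D i"
  then have "(i, d) \<in> D\<^sup>*" by (simp add: descendants_def)
  then have "(j, d) \<in> D'\<^sup>*"
  proof induction
    case base
    then show ?case using ij by auto
  next
    case (step y z)
    show ?case
    proof (cases "(y, z) = (i, j)")
      case False
      then have "(y, z) \<in> D'" using step.hyps(2) by (auto simp: reverse_edge_def)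
      then show ?thesis using step.IH by (meson rtrancl.rtrancl_into_rtrancl)
    qed auto
  qed
  then show "d \<in> descendants D' j" by (simp add: descendants_def)
qed

text \<open>A triple is endangered only if it uses the reversed edge or is a collider at
  \<open>i\<close>, the one node whose set of descendants can shrink.\<close>

lemma open_at_transfer:
  assumes "open_at D C x v y" "{x, v} \<noteq> {i, j}" "{y, v} \<noteq> {i, j}"
    "v \<noteq> i \<or> \<not> ((x, v) \<in> D \<and> (y, v) \<in> D)"
  shows "open_at D' C x v y"
  using assms descendants_mono[of v] edge_iff[of x v] edge_iff[of y v]
  unfolding open_at_def by (auto split: if_splits)

lemma tri_transfer:
  assumes "tri (open_at D C) vs" "i \<notin> set vs \<or> j \<notin> set vs" "i \<notin> set (butlast (tl vs))"
  shows "tri (open_at D' C) vs"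
  unfolding tri_iff
proof (intro allI impI)
  fix as x v y bs assume vs: "vs = as @ x # v # y # bs"
  have "v \<noteq> i" using assms(3) vs by (cases as) (auto simp: butlast_append split: if_splits)
  moreover have "open_at D C x v y" using assms(1) vs tri_middle by fast
  moreover have "{x, v} \<noteq> {i, j}" "{y, v} \<noteq> {i, j}"
    using assms(2) vs by (auto simp: doubleton_eq_iff)
  ultimately show "open_at D' C x v y" by (intro open_at_transfer) auto
qed

text \<open>The last edge leaves \<open>x\<close> before and after the change of endpoint, so an
  inner \<open>x\<close> is a noncollider outside \<open>C\<close> both times.\<close>

lemma tri_switch:
  assumes "tri (open_at D C) (as @ [x, u])" "(x, u) \<in> D" "(x, w) \<in> D'"
    "i \<notin> set (as @ [x])" "j \<notin> set (as @ [x])"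
  shows "tri (open_at D' C) (as @ [x, w])"
proof (cases as rule: rev_cases)
  case (snoc a' z)
  have *: "tri (open_at D C) (a' @ [z, x])" "open_at D C z x u"
    using assms(1) snoc tri_append[of _ a' z x "[u]"] by auto
  have "tri (open_at D' C) (a' @ [z, x])"
    by (rule tri_transfer) (use * assms snoc in \<open>auto dest!: in_set_butlast_tlD\<close>)
  moreover have "open_at D' C z x w"
    using *(2) assms(2,3) no_back no_back' unfolding open_at_def by (auto split: if_splits)
  ultimately show ?thesis using snoc tri_append[of _ a' z x "[w]"] by auto
qed simp

lemma tri_switch':
  assumes "tri (open_at D C) (u # x # bs)" "(x, u) \<in> D" "(x, w) \<in> D'"
    "i \<notin> set (x # bs)" "j \<notin> set (x # bs)"
  shows "tri (open_at D' C) (w # x # bs)"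
proof -
  have "tri (open_at D C) (rev bs @ [x, u])" using tri_rev[OF open_at_sym assms(1)] by simp
  from tri_switch[OF this assms(2,3)] assms(4,5) have "tri (open_at D' C) (rev bs @ [x, w])" by simp
  from tri_rev[OF open_at_sym this] show ?thesis by simp
qed

text \<open>Coverage offers shortcuts: a parent of \<open>i\<close> preceding \<open>i\<close> leads
  straight to \<open>j\<close>, and a parent of \<open>j\<close> following \<open>j\<close> is
  reached straight from \<open>i\<close>. If neither is present, \<open>i\<close> and
  \<open>j\<close> are noncolliders in both DAGs wherever they are inner nodes, and the path is
  kept.\<close>

lemma joins_forward_edge:
  assumes "joins D C a b (as @ i # j # bs)"
  shows "\<exists>vs. joins D' C a b vs"
proof -
  let ?vs = "as @ i # j # bs"
  have ds: "distinct ?vs" and su: "successively (adjacent D) ?vs" and ok: "tri (open_at D C) ?vs"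
    and ends: "hd ?vs = a" "last ?vs = b"
    using assms by (auto simp: joins_def)
  have su': "successively (adjacent D') ?vs" using su adjacent_reverse by (simp add: successively_conv_nth)
  have okl: "tri (open_at D C) (as @ [i, j])" and okr: "tri (open_at D C) (i # j # bs)"
    using ok tri_append[of _ as i j bs] by simp_all
  have okl1: "tri (open_at D C) (as @ [i])"
    using okl by (cases as rule: rev_cases) (auto simp: tri_append[of _ _ _ i "[j]"])
  have okr1: "tri (open_at D C) (j # bs)" using okr by (cases bs) auto
  have okr1': "tri (open_at D' C) (j # bs)"
    by (rule tri_transfer[OF okr1]) (use ds in \<open>auto dest: in_set_butlastD\<close>)
  have okl1': "tri (open_at D' C) (as @ [i])"
    by (rule tri_transfer[OF okl1]) (use ds in \<open>cases as; auto simp: butlast_append\<close>)+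
  show ?thesis
  proof (cases "as \<noteq> [] \<and> (last as, i) \<in> D")
    case True
    then obtain as' x where as: "as = as' @ [x]" and x: "(x, i) \<in> D" by (metis append_butlast_last_id)
    have xj: "(x, j) \<in> D" "(x, j) \<in> D'" "x \<noteq> i" "x \<noteq> j"
      using x parentD by blast+
    have l: "tri (open_at D' C) (as' @ [x, j])"
      by (rule tri_switch[of C as' x i]) (use as okl1 x xj ds in auto)
    \<comment> \<open>The arrow from \<open>x\<close> into \<open>j\<close> takes the place of the
      arrow from \<open>i\<close>, so \<open>j\<close> is a collider now exactly if it was one
      before.\<close>
    have "open_at D' C x j y" if "bs = y # bs'" for y bs'
    proof -
      have o: "open_at D C i j y" using okr that by simp
      have y: "y \<noteq> i" "y \<noteq> j" using ds that by auto
      have e: "(y, j) \<in> D' \<longleftrightarrow> (y, j) \<in> D" using edge_iff[of y j] y by auto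
      show ?thesis using o e xj ij(1) descendants_mono[of j] ij(2) unfolding open_at_def
        by (auto split: if_splits)
    qed
    then have "tri (open_at D' C) (x # j # bs)" using okr1' by (cases bs) auto
    then have "tri (open_at D' C) (as' @ x # j # bs)" using l tri_append[of "open_at D' C"] by fast
    moreover have "successively (adjacent D') (as' @ x # j # bs)"
      using su' xj(2) as by (auto simp: successively_append_iff adjacent_def successively_Cons)
    ultimately have "joins D' C a b (as' @ x # j # bs)"
      using ds ends as unfolding joins_def by (auto simp: hd_append split: if_splits)
    then show ?thesis by blast
  next
    case False
    \<comment> \<open>The edge to \<open>j\<close> leaves \<open>i\<close>, so an inner
      \<open>i\<close> is a noncollider of an open path.\<close>
    have iC: "i \<notin> C" if "as \<noteq> []"
    proof -
      obtain as' x where as: "as = as' @ [x]" using \<open>as \<noteq> []\<close> by (cases as rule: rev_cases) auto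
      have "open_at D C x i j" using okl as tri_append[of _ as' x i "[j]"] by auto
      then show ?thesis using ij by (auto simp: open_at_def)
    qed
    have nx: "(x, i) \<notin> D'" if "as = as' @ [x]" for x as'
      using False ds that edge_iff[of x i] by auto
    show ?thesis
    proof (cases "bs \<noteq> [] \<and> (hd bs, j) \<in> D")
      case True
      then obtain y bs' where bs: "bs = y # bs'" and y: "(y, j) \<in> D" by (cases bs) auto
      have yi: "(y, i) \<in> D" "(y, i) \<in> D'" "y \<noteq> i" "y \<noteq> j"
        using y bs parent_iff[of y] parentD[of y] ds by auto
      have r: "tri (open_at D' C) (i # y # bs')"
        by (rule tri_switch'[of C j y]) (use bs okr1 y yi ds in auto)
      have "tri (open_at D' C) (as @ [i, y])"
      proof (cases as rule: rev_cases)
        case (snoc as' x)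
        have "open_at D' C x i y" using iC snoc nx[OF snoc] by (auto simp: open_at_def)
        then show ?thesis using okl1' snoc tri_append[of _ as' x i "[y]"] by auto
      qed simp
      then have "tri (open_at D' C) (as @ i # y # bs')" using r tri_append[of "open_at D' C"] by fast
      moreover have "successively (adjacent D') (as @ i # y # bs')"
        using su' yi(2) bs by (auto simp: successively_append_iff adjacent_def successively_Cons)
      ultimately have "joins D' C a b (as @ i # y # bs')"
        using ds ends bs unfolding joins_def by (auto simp: hd_append split: if_splits)
      then show ?thesis by blast
    next
      case False2: False
      have "open_at D' C x i j" if "as = as' @ [x]" for x as'
        using iC that nx[OF that] by (auto simp: open_at_def)
      then have l: "tri (open_at D' C) (as @ [i, j])"
        using okl1' tri_append[of _ _ _ i "[j]"] by (cases as rule: rev_cases) auto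
      have "open_at D' C i j y" if "bs = y # bs'" for y bs'
      proof -
        have o: "open_at D C i j y" using okr that by simp
        then show ?thesis using False2 that ij by (auto simp: open_at_def)
      qed
      then have "tri (open_at D' C) (i # j # bs)" using okr1' by (cases bs) auto
      then have "joins D' C a b ?vs"
        using ds ends l su' tri_append[of _ as i j bs] unfolding joins_def by auto
      then show ?thesis by blast
    qed
  qed
qed

text \<open>After the reversal \<open>j\<close> is no descendant of \<open>i\<close>, so the
  collider may have lost what opened it. Both its parents point to \<open>j\<close> too, and the
  descendants of \<open>j\<close> include all former ones of \<open>i\<close>; the path is led
  through \<open>j\<close>.\<close>

lemma joins_collider:
  assumes "joins D C a b (as @ x # i # y # bs)" "(x, i) \<in> D" "(y, i) \<in> D" "j \<notin> set as"
  shows "\<exists>vs. joins D' C a b vs"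
proof -
  let ?vs = "as @ x # i # y # bs"
  have ds: "distinct ?vs" and su: "successively (adjacent D) ?vs" and ok: "tri (open_at D C) ?vs"
    and ends: "hd ?vs = a" "last ?vs = b"
    using assms by (auto simp: joins_def)
  have su': "successively (adjacent D') ?vs" using su adjacent_reverse by (simp add: successively_conv_nth)
  have x: "x \<noteq> i" "x \<noteq> j" "(x, j) \<in> D'" and y: "y \<noteq> i" "y \<noteq> j" "(y, j) \<in> D'"
    using assms(2,3) parentD by blast+
  have okl: "tri (open_at D C) (as @ [x, i])" and okm: "open_at D C x i y"
    and okr: "tri (open_at D C) (i # y # bs)"
    using ok tri_append[of _ as x i "y # bs"] by auto
  have hit: "descendants D' j \<inter> C \<noteq> {}"
    using okm assms(2,3) descendants_i by (auto simp: open_at_def)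
  have l: "tri (open_at D' C) (as @ [x, j])"
    by (rule tri_switch[OF okl assms(2) x(3)]) (use ds assms(4) x in auto)
  show ?thesis
  \<comment> \<open>If \<open>j\<close> occurs later on the path, inserting it would repeat a node.
    The detour then goes from \<open>x\<close> directly to that occurrence and drops everything
    between.\<close>
  proof (cases "j \<in> set bs")
    case False
    have "tri (open_at D' C) (j # y # bs)"
      by (rule tri_switch'[OF okr assms(3) y(3)]) (use ds False y in auto)
    moreover have "open_at D' C x j y" using x y hit by (simp add: open_at_def)
    ultimately have "tri (open_at D' C) (x # j # y # bs)" by simp
    then have "tri (open_at D' C) (as @ x # j # y # bs)" using l tri_append[of "open_at D' C"] by fast
    moreover have "successively (adjacent D') (as @ x # j # y # bs)"
      using su' x y by (auto simp: successively_append_iff adjacent_def successively_Cons)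
    ultimately have "joins D' C a b (as @ x # j # y # bs)"
      using ds ends x y assms(4) False unfolding joins_def by (auto simp: hd_append split: if_splits)
    then show ?thesis by blast
  next
    case True
    then obtain b1 b2 where bs: "bs = b1 @ j # b2" by (meson split_list)
    obtain c1 c where c: "i # y # b1 = c1 @ [c]" by (metis append_butlast_last_id list.distinct(1))
    have "?vs = (as @ x # c1) @ c # j # b2" using bs c by simp
    then have okc: "tri (open_at D C) (c # j # b2)" using ok tri_append by metis
    then have "tri (open_at D C) (j # b2)" by (cases b2) auto
    then have r: "tri (open_at D' C) (j # b2)"
      by (rule tri_transfer) (use ds bs in \<open>auto dest: in_set_butlastD\<close>)
    \<comment> \<open>A collider at \<open>j\<close> is opened by \<open>hit\<close>. Otherwise the
      edge towards \<open>z\<close> made \<open>j\<close> a noncollider of the old path as well, so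
      \<open>j \<notin> C\<close>.\<close>
    have "open_at D' C x j z" if "b2 = z # b3" for z b3
    proof (cases "(z, j) \<in> D'")
      case True
      then show ?thesis using hit x by (simp add: open_at_def)
    next
      case False
      have "(z, j) \<notin> D" using False edge_iff[of z j] ds bs that by (auto simp: doubleton_eq_iff)
      moreover have "open_at D C c j z" using okc that by simp
      ultimately show ?thesis using False by (auto simp: open_at_def)
    qed
    then have "tri (open_at D' C) (x # j # b2)" using r by (cases b2) auto
    then have "tri (open_at D' C) (as @ x # j # b2)" using l tri_append[of "open_at D' C"] by fast
    moreover have "successively (adjacent D') (as @ x # j # b2)"
      using su' x bs by (auto simp: successively_append_iff adjacent_def successively_Cons)
    ultimately have "joins D' C a b (as @ x # j # b2)"
      using ds ends bs assms(4) x unfolding joins_def by (auto simp: hd_append split: if_splits)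
    then show ?thesis by blast
  qed
qed

lemma joins_reverse:
  assumes "joins D C a b vs"
  shows "\<exists>ws. joins D' C a b ws"
proof -
  consider (fwd) as bs where "vs = as @ i # j # bs" | (bwd) as bs where "vs = as @ j # i # bs"
    | (coll) as x y bs where "vs = as @ x # i # y # bs" "(x, i) \<in> D" "(y, i) \<in> D"
    | (plain) "\<nexists>as bs. vs = as @ i # j # bs" "\<nexists>as bs. vs = as @ j # i # bs"
      "\<nexists>as x y bs. vs = as @ x # i # y # bs \<and> (x, i) \<in> D \<and> (y, i) \<in> D" by blast
  then show ?thesis
  proof cases
    case fwd
    then show ?thesis using joins_forward_edge assms by blast
  next
    case bwd
    have "joins D C b a (rev bs @ i # j # rev as)" using joins_rev[OF assms] bwd by simp
    then show ?thesis using joins_forward_edge joins_rev by blast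
  next
    case coll
    show ?thesis
    \<comment> \<open>As nodes do not repeat, \<open>j\<close> lies on at most one side of the
      collider; reading the path backwards moves that side to the end.\<close>
    proof (cases "j \<in> set as")
      case False
      then show ?thesis using joins_collider coll assms by blast
    next
      case True
      have d: "distinct vs" using assms by (simp add: joins_def)
      have "joins D C b a (rev bs @ y # i # x # rev as)" using joins_rev[OF assms] coll by simp
      moreover have "j \<notin> set (rev bs)" using True d coll by auto
      ultimately show ?thesis using joins_collider coll joins_rev by blast
    qed
  next
    case plain
    have "tri (open_at D' C) vs"
      unfolding tri_iff
    proof (intro allI impI)
      fix as x v y bs assume vs: "vs = as @ x # v # y # bs"
      have n: "vs = (as @ [x]) @ v # y # bs" using vs by simp
      have "open_at D C x v y" using assms tri_middle unfolding joins_def vs by fast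
      then show "open_at D' C x v y"
      proof (rule open_at_transfer)
        show "{x, v} \<noteq> {i, j}" using plain(1,2) vs by (metis doubleton_eq_iff)
        show "{y, v} \<noteq> {i, j}" using plain(1,2) n by (metis doubleton_eq_iff)
        show "v \<noteq> i \<or> \<not> ((x, v) \<in> D \<and> (y, v) \<in> D)" using plain(3) vs by blast
      qed
    qed
    moreover have "successively (adjacent D') vs" 
      using assms adjacent_reverse by (simp add: joins_def successively_conv_nth)
    ultimately show ?thesis using assms by (auto simp: joins_def)
  qed
qed

lemma d_separated_reverse_imp: "d_separated D' A B C \<Longrightarrow> d_separated D A B C"
  unfolding d_separated_iff using joins_reverse by blast

end

text \<open>The reversed edge is covered in the new DAG and reversing it again restores
  \<open>D\<close>, so the implication of the locale can be used in both directions.\<close>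

lemma d_separated_reverse:
  assumes "acyclic D" "covered D i j"
  shows "d_separated (reverse_edge D i j) A B C \<longleftrightarrow> d_separated D A B C"
proof -
  interpret E: covered_edge D i j by unfold_locales (fact assms)+
  interpret E': covered_edge "reverse_edge D i j" j i
    by unfold_locales (fact E.acyclic_reverse E.covered_reverse)+
  show ?thesis
    using E.d_separated_reverse_imp E'.d_separated_reverse_imp E.reverse_reverse by metis
qed

section \<open>Markov equivalent DAGs\<close>

definition dsep_equiv :: "nat set \<Rightarrow> (nat \<times> nat) set \<Rightarrow> (nat \<times> nat) set \<Rightarrow> bool" where
  "dsep_equiv V D E \<longleftrightarrow> (\<forall>A B C. A \<subseteq> V \<and> B \<subseteq> V \<and> C \<subseteq> V \<and> A \<inter> B = {} \<and> A \<inter> C = {} \<and> B \<inter> C = {} \<longrightarrow>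
     (d_separated D A B C \<longleftrightarrow> d_separated E A B C))"

lemma dsep_equiv_sym: "dsep_equiv V D E \<Longrightarrow> dsep_equiv V E D"
  by (auto simp: dsep_equiv_def)

lemma adjacent_not_d_separated:
  assumes "adjacent D u v" "u \<noteq> v"
  shows "\<not> d_separated D {u} {v} C"
proof -
  have "joins D C u v [u, v]" using assms by (simp add: joins_def)
  then show ?thesis by (auto simp: d_separated_iff)
qed

text \<open>A path leaving v along an outgoing edge towards a non-descendant must turn around,
  and it does so at a descendant of v.\<close>
lemma directed_away_blocked:
  assumes "acyclic D" "C \<subseteq> pa D v"
  shows "successively (adjacent D) (w # x # zs) \<Longrightarrow> (v, w) \<in> D\<^sup>* \<Longrightarrow> (w, x) \<in> D
    \<Longrightarrow> (v, last (x # zs)) \<notin> D\<^sup>* \<Longrightarrow> \<not> tri (open_at D C) (w # x # zs)"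
proof (induction zs arbitrary: w x)
  case Nil
  then show ?case by (auto intro: rtrancl_into_rtrancl)
next
  case (Cons y zs)
  have vx: "(v, x) \<in> D\<^sup>*" using Cons.prems by (auto intro: rtrancl_into_rtrancl)
  show ?case
  proof (cases "(y, x) \<in> D")
    case True
    have "descendants D x \<inter> C = {}"
    proof (rule ccontr)
      assume "\<not> ?thesis"
      then obtain c where "(x, c) \<in> D\<^sup>*" "(c, v) \<in> D" using assms(2) by (auto simp: descendants_def pa_def)
      then have "(v, v) \<in> D\<^sup>+" using vx by (meson rtrancl_into_trancl1 rtrancl_trans)
      then show False using assms(1) by (auto simp: acyclic_def)
    qed
    then show ?thesis using True Cons.prems(3) by (auto simp: open_at_def)
  next
    case False
    then have "(x, y) \<in> D" using Cons.prems(1) by (auto simp: adjacent_def)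
    then have "\<not> tri (open_at D C) (x # y # zs)"
      using Cons.IH[of x y] Cons.prems vx by auto
    then show ?thesis by auto
  qed
qed

text \<open>A path from \<open>v\<close> starts along an outgoing edge and then has to turn around
  at a descendant of \<open>v\<close>, or it starts with a parent of \<open>v\<close>, which is an
  inner noncollider belonging to the conditioning set.\<close>

lemma nonadjacent_d_separated_parents:
  assumes "acyclic D" "\<not> adjacent D u v" "u \<noteq> v" "(v, u) \<notin> D\<^sup>*"
  shows "d_separated D {v} {u} (pa D v)"
  unfolding d_separated_iff
proof safe
  fix vs assume "joins D (pa D v) v u vs"
  then have vs: "vs \<noteq> []" "distinct vs" "successively (adjacent D) vs"
    "tri (open_at D (pa D v)) vs" "hd vs = v" "last vs = u" by (auto simp: joins_def)
  obtain x zs where x: "vs = v # x # zs"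
    using vs assms(3) by (cases vs; cases "tl vs") auto
  show False
  proof (cases "(v, x) \<in> D")
    case True
    then show False
      using directed_away_blocked[of D "pa D v" v v x zs] assms vs x by auto
  next
    case False
    then have xv: "(x, v) \<in> D" using vs x by (auto simp: adjacent_def)
    then have "x \<noteq> u" using assms(2) by (auto simp: adjacent_def)
    then obtain y ys where y: "zs = y # ys" using vs x by (cases zs) auto
    have "(v, x) \<notin> D" using False .
    then show False using vs(4) x y xv by (auto simp: open_at_def pa_def)
  qed
qed

lemma nonadjacent_d_separated:
  assumes "acyclic D" "D \<subseteq> V \<times> V" "\<not> adjacent D u v" "u \<noteq> v"
  shows "\<exists>C\<subseteq>V - {u, v}. d_separated D {u} {v} C"
proof -
  have sym: "d_separated D {b} {a} C" if "d_separated D {a} {b} C" for a b C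
    using that joins_rev by (fastforce simp: d_separated_iff)
  have sub: "pa D a \<subseteq> V - {u, v}" if "a = u \<or> a = v" for a
    using assms that by (auto simp: pa_def adjacent_def acyclic_def)
  show ?thesis
  proof (cases "(v, u) \<in> D\<^sup>*")
    case False
    then show ?thesis using sym[OF nonadjacent_d_separated_parents[OF assms(1,3,4)]] sub[of v] by auto
  next
    case True
    then have "(u, v) \<notin> D\<^sup>*" using assms(1,4)
      by (metis acyclic_def rtrancl_eq_or_trancl trancl_trans)
    then show ?thesis
      using nonadjacent_d_separated_parents[of D v u] assms(1,3,4) adjacent_sym[of D u v] sub[of u] by auto
  qed
qed

lemma dsep_equiv_adjacent_imp:
  assumes "dsep_equiv V D E" "acyclic D" "acyclic E" "D \<subseteq> V \<times> V" "E \<subseteq> V \<times> V" "adjacent D u v"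
  shows "adjacent E u v"
proof (rule ccontr)
  assume n: "\<not> adjacent E u v"
  have uv: "u \<noteq> v" "u \<in> V" "v \<in> V" using assms by (auto simp: adjacent_def acyclic_def)
  obtain C where C: "C \<subseteq> V - {u, v}" "d_separated E {u} {v} C"
    using nonadjacent_d_separated[OF assms(3,5) n uv(1)] by blast
  then have "d_separated D {u} {v} C"
    using assms(1)[unfolded dsep_equiv_def, rule_format, of "{u}" "{v}" C] uv by auto
  then show False using adjacent_not_d_separated[OF assms(6) uv(1)] by blast
qed

text \<open>A set separating \<open>u\<close> from \<open>v\<close> in \<open>D\<close> cannot
  contain the collider \<open>w\<close>. It also blocks the path over \<open>w\<close> in
  \<open>E\<close>, and with \<open>w\<close> outside the set this is possible only at a
  collider.\<close>

lemma dsep_equiv_v_structure: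
  assumes "dsep_equiv V D E" "acyclic D" "acyclic E" "D \<subseteq> V \<times> V" "E \<subseteq> V \<times> V"
    "(u, w) \<in> D" "(v, w) \<in> D" "\<not> adjacent D u v" "u \<noteq> v"
  shows "(u, w) \<in> E" "(v, w) \<in> E"
proof -
  have uvw: "u \<in> V" "v \<in> V" "w \<in> V" "u \<noteq> w" "v \<noteq> w" using assms by (auto simp: acyclic_def)
  obtain C where C: "C \<subseteq> V - {u, v}" "d_separated D {u} {v} C"
    using nonadjacent_d_separated[OF assms(2,4,8,9)] by blast
  then have CE: "d_separated E {u} {v} C"
    using assms(1)[unfolded dsep_equiv_def, rule_format, of "{u}" "{v}" C] uvw assms(9) by auto
  have "joins D C u v [u, w, v]" if "w \<in> C"
    using assms uvw that by (auto simp: joins_def adjacent_def open_at_def descendants_def)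
  then have "w \<notin> C" using C by (auto simp: d_separated_iff)
  have adj: "adjacent E u w" "adjacent E w v"
    using dsep_equiv_adjacent_imp[OF assms(1-5)] assms(6,7) by (auto simp: adjacent_def)
  have "\<not> joins E C u v [u, w, v]" using CE by (auto simp: d_separated_iff)
  then have "\<not> open_at E C u w v"
    using adj uvw assms(9) by (auto simp: joins_def)
  then show "(u, w) \<in> E" "(v, w) \<in> E" using \<open>w \<notin> C\<close> by (auto simp: open_at_def split: if_splits)
qed

section \<open>Chickering's sequence of covered reversals\<close>

definition reversed_edges :: "(nat \<times> nat) set \<Rightarrow> (nat \<times> nat) set \<Rightarrow> (nat \<times> nat) set" where
  "reversed_edges D E = {(u, v). (u, v) \<in> D \<and> (v, u) \<in> E}"

text \<open>Chickering's choice: the first node j with a differing incoming edge, and the last such parent i.\<close>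
lemma ex_covered_reversed_edge:
  assumes eq: "dsep_equiv V D E" and ac: "acyclic D" "acyclic E"
    and V: "finite V" "D \<subseteq> V \<times> V" "E \<subseteq> V \<times> V" and ne: "D \<noteq> E"
  shows "\<exists>(i, j)\<in>reversed_edges D E. covered D i j"
proof -
  have adjDE: "adjacent E u v \<longleftrightarrow> adjacent D u v" for u v
    using dsep_equiv_adjacent_imp[OF eq ac V(2,3)]
      dsep_equiv_adjacent_imp[OF dsep_equiv_sym[OF eq] ac(2,1) V(3,2)] by blast
  have nb: "(v, u) \<notin> F" if "acyclic F" "(u, v) \<in> F" for F :: "(nat \<times> nat) set" and u v
    using that by (meson acyclic_def r_into_trancl trancl_into_trancl)
  have noloop: "u \<noteq> v" if "(u, v) \<in> D \<or> (u, v) \<in> E" for u v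
    using that ac by (auto simp: acyclic_def)
  have keep: "(u, v) \<in> E" if "(u, v) \<in> D" "(u, v) \<notin> reversed_edges D E" for u v
    using that adjDE[of u v] by (auto simp: adjacent_def reversed_edges_def)
  have "finite D" using V finite_subset by blast
  then have wf: "wf D" "wf (D\<inverse>)" using ac finite_acyclic_wf finite_acyclic_wf_converse by auto
  define J where "J = {j. \<exists>i. (i, j) \<in> reversed_edges D E}"
  have "J \<noteq> {}"
  proof
    assume "J = {}"
    then have "D \<subseteq> E" using keep by (auto simp: J_def)
    moreover have "E \<subseteq> D"
    proof clarify
      fix u v assume "(u, v) \<in> E"
      then show "(u, v) \<in> D" using adjDE[of u v] \<open>D \<subseteq> E\<close> nb[OF ac(2)] by (auto simp: adjacent_def)
    qed
    ultimately show False using ne by blast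
  qed
  then obtain j where j: "j \<in> J" "\<And>k. (k, j) \<in> D \<Longrightarrow> k \<notin> J" 
    using wfE_min[OF wf(1)] by (metis ex_in_conv)
  define I where "I = {i. (i, j) \<in> reversed_edges D E}"
  have "I \<noteq> {}" using j by (auto simp: I_def J_def)
  then obtain i where i: "i \<in> I" "\<And>k. (i, k) \<in> D \<Longrightarrow> k \<notin> I"
    using wfE_min[OF wf(2)] by (metis ex_in_conv converse_iff)
  have ij: "(i, j) \<in> D" "(j, i) \<in> E" using i by (auto simp: I_def reversed_edges_def)
  have "pa D i \<subseteq> pa D j - {i}"
  proof
    fix k assume "k \<in> pa D i"
    then have k: "(k, i) \<in> D" by (simp add: pa_def)
    have "(k, i) \<in> E" using k keep j(2)[OF ij(1)] by (auto simp: J_def)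
    have "k \<noteq> j" using k ij nb[OF ac(1)] by blast
    \<comment> \<open>Without this adjacency, k -> i <- j would be an unshielded collider of
      \<open>E\<close>, hence of \<open>D\<close>, against i -> j.\<close>
    have "adjacent D k j"
    proof (rule ccontr)
      assume "\<not> adjacent D k j"
      then have "(j, i) \<in> D"
        using dsep_equiv_v_structure(2)[OF dsep_equiv_sym[OF eq] ac(2,1) V(3,2) \<open>(k, i) \<in> E\<close> ij(2)]
          adjDE \<open>k \<noteq> j\<close> by blast
      then show False using nb[OF ac(1) ij(1)] by blast
    qed
    moreover have "(j, k) \<notin> D"
    proof
      assume "(j, k) \<in> D"
      then have "(j, j) \<in> D\<^sup>+" using k ij by (meson trancl.simps)
      then show False using ac(1) by (auto simp: acyclic_def)
    qed
    ultimately show "k \<in> pa D j - {i}" using k noloop by (auto simp: adjacent_def pa_def)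
  qed
  moreover have "pa D j - {i} \<subseteq> pa D i"
  proof
    fix k assume "k \<in> pa D j - {i}"
    then have k: "(k, j) \<in> D" "k \<noteq> i" by (auto simp: pa_def)
    have "adjacent D k i"
    proof (rule ccontr)
      assume "\<not> adjacent D k i"
      then have "(i, j) \<in> E" using dsep_equiv_v_structure(2)[OF eq ac V(2,3) k(1) ij(1)] k by blast
      then show False using ij nb[OF ac(2)] by blast
    qed
    moreover have "(i, k) \<notin> D"
    proof
      assume ik: "(i, k) \<in> D"
      then have "(k, j) \<in> E" using i(2) k keep by (auto simp: I_def)
      have "(i, k) \<in> E" using ik keep j(2)[OF k(1)] by (auto simp: J_def)
      then have "(i, i) \<in> E\<^sup>+" using \<open>(k, j) \<in> E\<close> ij by (meson trancl.simps)
      then show False using ac(2) by (auto simp: acyclic_def)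
    qed
    ultimately show "k \<in> pa D i" by (auto simp: adjacent_def pa_def)
  qed
  ultimately have "covered D i j" using ij by (auto simp: covered_def)
  then show ?thesis using i by (auto simp: I_def)
qed

lemma reversed_edges_reverse_edge:
  assumes "(i, j) \<in> reversed_edges D E" "acyclic D" "acyclic E"
  shows "reversed_edges (reverse_edge D i j) E = reversed_edges D E - {(i, j)}"
proof -
  have "(i, j) \<notin> E" using assms by (auto simp: reversed_edges_def) (meson acyclic_def r_into_trancl trancl_into_trancl)
  then show ?thesis using assms by (auto simp: reversed_edges_def reverse_edge_def acyclic_def)
qed

text \<open>Abstracting the class of DAGs and the predicate \<open>L\<close> separates the
  combinatorics from the analysis. The bound on \<open>set es\<close> strengthens the induction: it
  keeps the later reversals away from the pair just used.\<close>

lemma covered_reversal_sequence: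
  assumes dag: "\<And>D. D \<in> \<D> \<Longrightarrow> acyclic D \<and> D \<subseteq> V \<times> V" and "finite V"
    and equiv: "\<And>D E. D \<in> \<D> \<Longrightarrow> E \<in> \<D> \<Longrightarrow> dsep_equiv V D E"
    and rev: "\<And>D i j. D \<in> \<D> \<Longrightarrow> covered D i j \<Longrightarrow> L D i j \<Longrightarrow> reverse_edge D i j \<in> \<D>"
    and lin: "\<And>D E i j. D \<in> \<D> \<Longrightarrow> E \<in> \<D> \<Longrightarrow> covered D i j \<Longrightarrow> (j, i) \<in> E \<Longrightarrow> L D i j"
    and "D \<in> \<D>" "E \<in> \<D>"
  shows "\<exists>Ds es. length Ds = Suc (length es) \<and> Ds ! 0 = D \<and> last Ds = E \<and> set Ds \<subseteq> \<D> \<and>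
    (\<forall>r<length es. covered (Ds ! r) (fst (es ! r)) (snd (es ! r)) \<and>
       L (Ds ! r) (fst (es ! r)) (snd (es ! r)) \<and>
       Ds ! Suc r = reverse_edge (Ds ! r) (fst (es ! r)) (snd (es ! r))) \<and>
    distinct (map (\<lambda>e. {fst e, snd e}) es) \<and> set es \<subseteq> reversed_edges D E"
  using \<open>D \<in> \<D>\<close>
proof (induction "card (reversed_edges D E)" arbitrary: D rule: less_induct)
  case less
  have D: "acyclic D" "D \<subseteq> V \<times> V" and E: "acyclic E" "E \<subseteq> V \<times> V"
    using dag less.prems \<open>E \<in> \<D>\<close> by blast+
  show ?case
  proof (cases "D = E")
    case True
    show ?thesis by (rule exI[of _ "[D]"], rule exI[of _ "[]"]) (use True less.prems in auto)
  next
    case False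
    obtain i j where ij: "(i, j) \<in> reversed_edges D E" "covered D i j"
      using ex_covered_reversed_edge[OF equiv[OF less.prems \<open>E \<in> \<D>\<close>] D(1) E(1) \<open>finite V\<close> D(2) E(2) False]
      by blast
    have L: "L D i j" using lin[OF less.prems \<open>E \<in> \<D>\<close> ij(2)] ij(1) by (auto simp: reversed_edges_def)
    let ?D = "reverse_edge D i j"
    have D': "?D \<in> \<D>" using rev[OF less.prems ij(2) L] .
    have re: "reversed_edges ?D E = reversed_edges D E - {(i, j)}"
      by (rule reversed_edges_reverse_edge[OF ij(1) D(1) E(1)])
    have "finite (reversed_edges D E)"
      using D(2) \<open>finite V\<close> by (rule_tac finite_subset[of _ "V \<times> V"]) (auto simp: reversed_edges_def)
    then have "card (reversed_edges ?D E) < card (reversed_edges D E)"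
      using ij(1) re by (metis card_Diff1_less)
    from less.hyps[OF this D'] obtain Ds es where IH: "length Ds = Suc (length es)" "Ds ! 0 = ?D"
      "last Ds = E" "set Ds \<subseteq> \<D>"
      "\<forall>r<length es. covered (Ds ! r) (fst (es ! r)) (snd (es ! r)) \<and>
         L (Ds ! r) (fst (es ! r)) (snd (es ! r)) \<and>
         Ds ! Suc r = reverse_edge (Ds ! r) (fst (es ! r)) (snd (es ! r))"
      "distinct (map (\<lambda>e. {fst e, snd e}) es)" "set es \<subseteq> reversed_edges ?D E" by blast
    \<comment> \<open>The pair is now oriented as in \<open>E\<close>, so neither of its
      orientations is left among the edges still to be reversed.\<close>
    have new: "{i, j} \<notin> (\<lambda>e. {fst e, snd e}) ` set es"
    proof
      assume "{i, j} \<in> (\<lambda>e. {fst e, snd e}) ` set es"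
      then have "(i, j) \<in> set es \<or> (j, i) \<in> set es" by (auto simp: doubleton_eq_iff)
      then have "(j, i) \<in> D" "(i, j) \<in> D" using IH(7) re ij(1) by (auto simp: reversed_edges_def)
      then show False using D(1) by (meson acyclic_def r_into_trancl trancl_into_trancl)
    qed
    show ?thesis
    proof (rule exI[of _ "D # Ds"], rule exI[of _ "(i, j) # es"], intro conjI allI impI)
      fix r assume "r < length ((i, j) # es)"
      then show "covered ((D # Ds) ! r) (fst (((i, j) # es) ! r)) (snd (((i, j) # es) ! r))"
        "L ((D # Ds) ! r) (fst (((i, j) # es) ! r)) (snd (((i, j) # es) ! r))"
        "(D # Ds) ! Suc r = reverse_edge ((D # Ds) ! r) (fst (((i, j) # es) ! r)) (snd (((i, j) # es) ! r))"
        using IH ij(2) L by (cases r; auto)+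
    qed (use IH new less.prems re ij(1) in auto)
  qed
qed

section \<open>Weighted sums of squared residuals\<close>

definition affine_fun :: "(real \<Rightarrow> real) \<Rightarrow> bool" where
  "affine_fun g \<longleftrightarrow> (\<exists>a b. \<forall>s. g s = a * s + b)"

lemma affine_fun_add_linear_iff: "affine_fun (\<lambda>s. g s + a * s) \<longleftrightarrow> affine_fun g"
proof -
  have "affine_fun (\<lambda>s. g s + a * s)" if g: "affine_fun g" for g :: "real \<Rightarrow> real" and a
  proof -
    obtain c d where "\<And>s. g s = c * s + d" using g unfolding affine_fun_def by blast
    then have "\<forall>s. g s + a * s = (c + a) * s + d" by (simp add: algebra_simps)
    then show ?thesis unfolding affine_fun_def by blast
  qed
  from this[of g a] this[of "\<lambda>s. g s + a * s" "-a"] show ?thesis by auto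
qed

lemma affine_fun_const_deriv:
  assumes "\<And>s. (g has_real_derivative c) (at s)"
  shows "affine_fun g"
proof -
  have "((\<lambda>s. g s - c * s) has_real_derivative 0) (at s)" for s
    using assms[of s] by (auto intro!: derivative_eq_intros)
  then have "\<forall>s. ((\<lambda>s. g s - c * s) has_real_derivative 0) (at s)" by (rule allI)
  from DERIV_isconst_all[OF this] have "g s = c * s + g 0" for s
    by (metis add.commute diff_add_cancel diff_zero mult_zero_right)
  then have "\<forall>s. g s = c * s + g 0" by (rule allI)
  then show ?thesis unfolding affine_fun_def by (intro exI)
qed

text \<open>Differentiating the midpoint identity in \<open>t\<close> gives
  \<open>g' (s + t) = g' (s - t)\<close>; with \<open>s = t\<close> the derivative is
  constant.\<close>

lemma affine_fun_midpoint:
  fixes g :: "real \<Rightarrow> real"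
  assumes diff: "\<And>s. g differentiable (at s)" and mid: "\<And>s t. g (s + t) + g (s - t) = 2 * g s"
  shows "affine_fun g"
proof -
  obtain g' where g': "\<And>s. (g has_real_derivative g' s) (at s)"
    using diff unfolding real_differentiable_def by metis
  have eq: "g' (s + t) = g' (s - t)" for s t
  proof -
    have "((\<lambda>t. g (s + t) + g (s - t)) has_real_derivative (g' (s + t) - g' (s - t))) (at t)"
      by (rule derivative_eq_intros DERIV_chain2[OF g'] refl | simp)+
    moreover have "((\<lambda>t. g (s + t) + g (s - t)) has_real_derivative 0) (at t)"
      unfolding mid by simp
    ultimately show ?thesis using DERIV_unique by fastforce
  qed
  have const: "g' s = g' 0" for s using eq[of "s / 2" "s / 2"] by simp
  show ?thesis by (rule affine_fun_const_deriv[of g "g' 0"]) (use g' const in metis)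
qed

text \<open>Minus twice the log density of an additive Gaussian model up to a constant; the list is a reversed
  topological order (its head is the last node) and w holds the error variances.\<close>
fun quad :: "nat list \<Rightarrow> (nat \<Rightarrow> real) \<Rightarrow> (nat \<Rightarrow> nat \<Rightarrow> real \<Rightarrow> real) \<Rightarrow> (nat \<Rightarrow> real) \<Rightarrow> (nat \<Rightarrow> real) \<Rightarrow> real" where
  "quad [] \<mu> f w x = 0"
| "quad (l # r) \<mu> f w x = (x l - \<mu> l - (\<Sum>h\<in>set r. f l h (x h)))\<^sup>2 / w l + quad r \<mu> f w x"

lemma quad_cong: "(\<And>h. h \<in> set L \<Longrightarrow> x h = y h) \<Longrightarrow> quad L \<mu> f w x = quad L \<mu> f w y"
  by (induction L) (auto cong: sum.cong)

lemma quad_append_cong: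
  assumes "set ys = set ys'" "\<And>x. quad ys \<mu> f w x = quad ys' \<mu>' f' w' x"
    "\<And>q. q \<in> set xs \<Longrightarrow> \<mu> q = \<mu>' q \<and> f q = f' q \<and> w q = w' q"
  shows "quad (xs @ ys) \<mu> f w x = quad (xs @ ys') \<mu>' f' w' x"
  using assms(3) by (induction xs) (auto simp: assms(1,2))

lemma quad_param_cong:
  assumes "\<And>q. q \<in> set L \<Longrightarrow> \<mu> q = \<mu>' q \<and> f q = f' q \<and> w q = w' q"
  shows "quad L \<mu> f w x = quad L \<mu>' f' w' x"
  using assms by (induction L) auto

lemma quad_update_notin: "k \<notin> set L \<Longrightarrow> quad L \<mu> f w (x(k := v)) = quad L \<mu> f w x"
  by (rule quad_cong) auto

text \<open>The \<open>k\<close>-th coordinate is chosen to make the residual of \<open>k\<close> on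
  the right vanish; on the left that residual only contributes a nonnegative term.\<close>

lemma quad_drop_le:
  assumes "\<And>x. quad (k # r) \<mu> f w x = quad (k # r') \<mu>' f' w' x + c" "k \<notin> set r" "k \<notin> set r'" "w k > 0"
  shows "quad r \<mu> f w x \<le> quad r' \<mu>' f' w' x + c"
proof -
  define x1 where "x1 = x(k := \<mu>' k + (\<Sum>h\<in>set r'. f' k h (x h)))"
  have "(\<Sum>h\<in>set r'. f' k h (x1 h)) = (\<Sum>h\<in>set r'. f' k h (x h))"
    by (rule sum.cong) (use assms in \<open>auto simp: x1_def\<close>)
  then have "quad (k # r') \<mu>' f' w' x1 = quad r' \<mu>' f' w' x"
    using assms(3) by (simp add: x1_def quad_update_notin)
  moreover have "quad r \<mu> f w x \<le> quad (k # r) \<mu> f w x1"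
    using assms(2,4) by (simp add: x1_def quad_update_notin)
  ultimately show ?thesis using assms(1)[of x1] by simp
qed

lemma quad_drop:
  assumes "\<And>x. quad (k # r) \<mu> f w x = quad (k # r') \<mu>' f' w' x + c" "k \<notin> set r" "k \<notin> set r'"
    "w k > 0" "w' k > 0"
  shows "quad r \<mu> f w x = quad r' \<mu>' f' w' x + c"
  using quad_drop_le[of k r \<mu> f w r' \<mu>' f' w' c x] quad_drop_le[of k r' \<mu>' f' w' r \<mu> f w "- c" x] assms
  by force

text \<open>The nodes after \<open>k\<close> are peeled off, the last one first. The last node
  \<open>a\<close> enters no residual but its own, which isolates the second difference of
  \<open>f a k\<close> and forces it to vanish. Then \<open>a\<close> contributes a multiple of the
  squared step, and the remaining nodes satisfy the hypothesis with another constant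
  \<open>c\<close>.\<close>

lemma quad_out_edges_affine:
  assumes "distinct (xs @ k # ys)" "\<And>q. w q > 0" "\<And>q h s. f q h differentiable (at s)"
    "\<And>x t. quad (xs @ k # ys) \<mu> f w (x(k := x k + t)) + quad (xs @ k # ys) \<mu> f w (x(k := x k - t))
       - 2 * quad (xs @ k # ys) \<mu> f w x = c * t\<^sup>2"
    "l \<in> set xs"
  shows "affine_fun (f l k)"
  using assms(1,4,5)
proof (induction xs arbitrary: c)
  case (Cons a xs)
  define r where "r = xs @ k # ys"
  let ?F = "f a k" and ?d = "\<lambda>x s. x a - \<mu> a - (\<Sum>h\<in>set r - {k}. f a h (x h)) - f a k s"
  have ak: "a \<noteq> k" "a \<notin> set r" "k \<in> set r" using Cons.prems(1) by (auto simp: r_def)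
  have split: "quad (a # r) \<mu> f w (x(k := s)) = (?d x s)\<^sup>2 / w a + quad r \<mu> f w (x(k := s))" for x s
  proof -
    have "(\<Sum>h\<in>set r. f a h ((x(k := s)) h)) = f a k s + (\<Sum>h\<in>set r - {k}. f a h (x h))"
      using ak by (subst sum.remove[of _ k]) (auto intro!: sum.cong)
    then show ?thesis using ak by (simp add: algebra_simps)
  qed
  define A where "A x s t = (?d x (s + t))\<^sup>2 + (?d x (s - t))\<^sup>2 - 2 * (?d x s)\<^sup>2" for x s t
  define R where "R x s t = quad r \<mu> f w (x(k := s + t)) + quad r \<mu> f w (x(k := s - t))
      - 2 * quad r \<mu> f w (x(k := s))" for x s t
  have main: "A x s t / w a + R x s t = c * t\<^sup>2" for x s t
  proof -
    have "quad (a # r) \<mu> f w (x(k := s + t)) + quad (a # r) \<mu> f w (x(k := s - t))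
       - 2 * quad (a # r) \<mu> f w (x(k := s)) = c * t\<^sup>2"
      using Cons.prems(2)[of "x(k := s)" t] unfolding r_def append_Cons fun_upd_upd fun_upd_same .
    then show ?thesis unfolding split A_def R_def by (simp add: add_divide_distrib diff_divide_distrib)
  qed
  \<comment> \<open>Raising \<open>x a\<close> by 1 adds 1 to the residual \<open>d\<close> of
    \<open>a\<close> and leaves \<open>R\<close> fixed. The second differences of the squares of
    \<open>d + 1\<close> and \<open>d\<close> therefore agree, and they differ by twice the second
    difference of \<open>d\<close>.\<close>
  have "?F (s + t) + ?F (s - t) = 2 * ?F s" for s t
  proof -
    define x where "x = (\<lambda>_ :: nat. 0 :: real)"
    let ?x = "x(a := x a + 1)"
    have e: "?d ?x u = ?d x u + 1" for u
    proof -
      have "(\<Sum>h\<in>set r - {k}. f a h (?x h)) = (\<Sum>h\<in>set r - {k}. f a h (x h))"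
        using ak by (intro sum.cong) auto
      then show ?thesis by simp
    qed
    have "R ?x s t = R x s t" 
      unfolding R_def using ak by (simp add: fun_upd_twist[of a k] quad_update_notin[of a r])
    then have "A ?x s t = A x s t" using main[of ?x s t] main[of x s t] assms(2)[of a] by (simp add: field_simps)
    then show ?thesis unfolding A_def e by (simp add: power2_eq_square algebra_simps)
  qed
  then have aff: "affine_fun ?F" using affine_fun_midpoint[of ?F] assms(3) by blast
  then obtain \<alpha> \<beta> where F: "\<And>s. ?F s = \<alpha> * s + \<beta>" by (auto simp: affine_fun_def)
  have A: "A x s t = 2 * \<alpha>\<^sup>2 * t\<^sup>2" for x s t
    unfolding A_def F by (simp add: power2_eq_square algebra_simps)
  have "R x s t = (c - 2 * \<alpha>\<^sup>2 / w a) * t\<^sup>2" for x s t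
    using main[of x s t] unfolding A by (simp add: field_simps)
  then have "quad (xs @ k # ys) \<mu> f w (x(k := x k + t)) + quad (xs @ k # ys) \<mu> f w (x(k := x k - t))
       - 2 * quad (xs @ k # ys) \<mu> f w x = (c - 2 * \<alpha>\<^sup>2 / w a) * t\<^sup>2" for x t
    unfolding R_def r_def by (metis fun_upd_triv)
  from Cons.IH[OF _ this] have "l \<in> set xs \<Longrightarrow> affine_fun (f l k)" using Cons.prems(1) by simp
  then show ?case using Cons.prems(3) aff by auto
qed simp

text \<open>Completing the square in the first node: this is Bayes' rule for two Gaussian errors.\<close>
lemma swap_squares:
  fixes u y a w v :: real
  assumes "w > 0" "v > 0"
  shows "(y - a * u)\<^sup>2 / v + u\<^sup>2 / w =
    (u - a * w / (v + a\<^sup>2 * w) * y)\<^sup>2 / (w * v / (v + a\<^sup>2 * w)) + y\<^sup>2 / (v + a\<^sup>2 * w)"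
proof -
  \<comment> \<open>If \<open>u\<close> has variance \<open>w\<close> and \<open>y - a * u\<close>
    is an independent error of variance \<open>v\<close>, then \<open>y\<close> has variance
    \<open>z\<close>, the regression coefficient of \<open>u\<close> on \<open>y\<close> is
    \<open>a * w / z\<close>, and the remaining variance of \<open>u\<close> is
    \<open>w * v / z\<close>.\<close>
  define z where "z = v + a\<^sup>2 * w"
  have z: "z > 0" using assms by (simp add: z_def add_pos_nonneg)
  have "(u - a * w / z * y)\<^sup>2 / (w * v / z) + y\<^sup>2 / z = ((z * u - a * w * y)\<^sup>2 + w * v * y\<^sup>2) / (w * v * z)"
    using z assms by (simp add: field_simps power2_eq_square)
  also have "(z * u - a * w * y)\<^sup>2 + w * v * y\<^sup>2 = z * (w * (y - a * u)\<^sup>2 + v * u\<^sup>2)"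
    unfolding z_def by (simp add: algebra_simps power2_eq_square)
  also have "z * (w * (y - a * u)\<^sup>2 + v * u\<^sup>2) / (w * v * z) = (y - a * u)\<^sup>2 / v + u\<^sup>2 / w"
    using z assms by (simp add: field_simps)
  finally show ?thesis by (simp add: z_def)
qed

text \<open>The equation of \<open>k\<close> is substituted into that of \<open>l\<close>, and
  \<open>k\<close> is then regressed on \<open>l\<close> with coefficient \<open>b\<close>. The
  formulas for \<open>f'\<close> belong to the conclusion because it matters later that the rows
  change only by multiples of each other and that the new edge from \<open>l\<close> to
  \<open>k\<close> is linear.\<close>

lemma quad_swap:
  assumes "l \<noteq> k" "l \<notin> set ys" "k \<notin> set ys" "\<And>q. w q > 0" "\<And>q h s. f q h differentiable (at s)"
    "affine_fun (f l k)"
  shows "\<exists>\<mu>' f' w' a b. (\<forall>x. quad (l # k # ys) \<mu> f w x = quad (k # l # ys) \<mu>' f' w' x) \<and>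
    (\<forall>q. w' q > 0) \<and> (\<forall>q h s. f' q h differentiable (at s)) \<and>
    (\<forall>q. q \<noteq> l \<and> q \<noteq> k \<longrightarrow> \<mu>' q = \<mu> q \<and> f' q = f q \<and> w' q = w q) \<and>
    f' k l = (\<lambda>s. b * s) \<and> (\<forall>h. f' l h = (\<lambda>s. f l h s + a * f k h s)) \<and>
    (\<forall>h. h \<noteq> l \<longrightarrow> f' k h = (\<lambda>s. f k h s - b * f' l h s))"
proof -
  obtain a d where ad: "\<And>s. f l k s = a * s + d" using assms(6) by (auto simp: affine_fun_def)
  define z where "z = w l + a\<^sup>2 * w k"
  have z: "z > 0" using assms(4) by (simp add: z_def add_pos_nonneg less_imp_le)
  define b where "b = a * w k / z"
  define fl where "fl = (\<lambda>h s. f l h s + a * f k h s)"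
  define f' where "f' = f(l := fl, k := (\<lambda>h s. if h = l then b * s else f k h s - b * fl h s))"
  \<comment> \<open>Substituting the equation of \<open>k\<close> into that of \<open>l\<close>
    leaves the constant \<open>\<mu> l + d + a * \<mu> k\<close>, where \<open>d\<close> is the
    intercept of \<open>f l k\<close>; the new constant of \<open>k\<close> has \<open>b\<close>
    times this subtracted.\<close>
  define \<mu>' where "\<mu>' = \<mu>(l := \<mu> l + d + a * \<mu> k, k := \<mu> k - b * (\<mu> l + d + a * \<mu> k))"
  define w' where "w' = w(l := z, k := w k * w l / z)"
  have "quad (l # k # ys) \<mu> f w x = quad (k # l # ys) \<mu>' f' w' x" for x
  proof -
    define u where "u = x k - \<mu> k - (\<Sum>h\<in>set ys. f k h (x h))"
    define y where "y = x l - (\<mu> l + d + a * \<mu> k) - (\<Sum>h\<in>set ys. fl h (x h))"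
    have s: "(\<Sum>h\<in>set ys. fl h (x h)) = (\<Sum>h\<in>set ys. f l h (x h)) + a * (\<Sum>h\<in>set ys. f k h (x h))"
      by (simp add: fl_def sum.distrib sum_distrib_left)
    have s2: "(\<Sum>h\<in>set ys. f' k h (x h)) = (\<Sum>h\<in>set ys. f k h (x h)) - b * (\<Sum>h\<in>set ys. fl h (x h))"
    proof -
      have "(\<Sum>h\<in>set ys. f' k h (x h)) = (\<Sum>h\<in>set ys. f k h (x h) - b * fl h (x h))"
        using assms(2) by (intro sum.cong) (auto simp: f'_def)
      then show ?thesis by (simp add: sum_subtractf sum_distrib_left)
    qed
    have e1: "x l - \<mu> l - (\<Sum>h\<in>set (k # ys). f l h (x h)) = y - a * u"
      using assms(3) by (simp add: y_def u_def s ad algebra_simps)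
    have e2: "x k - \<mu>' k - (\<Sum>h\<in>set (l # ys). f' k h (x h)) = u - b * y"
      using assms(2) by (simp add: s2) (simp add: y_def u_def \<mu>'_def f'_def algebra_simps)
    have e3: "x l - \<mu>' l - (\<Sum>h\<in>set ys. f' l h (x h)) = y"
      using assms(1) by (simp add: y_def \<mu>'_def f'_def)
    have "quad (l # k # ys) \<mu> f w x = ((y - a * u)\<^sup>2 / w l + u\<^sup>2 / w k) + quad ys \<mu> f w x"
      unfolding quad.simps e1 by (simp add: u_def)
    also have "\<dots> = (u - b * y)\<^sup>2 / w' k + y\<^sup>2 / w' l + quad ys \<mu> f w x"
      using swap_squares[of "w k" "w l" y a u] assms(1,4) by (simp add: w'_def b_def z_def)
    also have "quad ys \<mu> f w x = quad ys \<mu>' f' w' x"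
      by (rule quad_param_cong) (use assms(2,3) in \<open>auto simp: \<mu>'_def f'_def w'_def\<close>)
    finally show ?thesis unfolding quad.simps e2 e3 by simp
  qed
  moreover have "\<forall>q. w' q > 0" using assms(4) z by (simp add: w'_def)
  moreover have "\<forall>q h s. f' q h differentiable (at s)"
  proof (intro allI)
    fix q h s
    have fl: "fl h differentiable (at s)"
      unfolding fl_def by (intro derivative_intros assms(5))
    consider "q = k" "h = l" | "q = k" "h \<noteq> l" | "q = l" "q \<noteq> k" | "q \<noteq> k" "q \<noteq> l" by blast
    then show "f' q h differentiable (at s)"
      by cases (use fl assms(5) in \<open>auto simp: f'_def intro!: derivative_intros\<close>)
  qed
  moreover have "f' k l = (\<lambda>s. b * s)" "\<forall>h. f' l h = (\<lambda>s. f l h s + a * f k h s)"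
    "\<forall>h. h \<noteq> l \<longrightarrow> f' k h = (\<lambda>s. f k h s - b * f' l h s)"
    using assms(1) by (auto simp: f'_def fl_def)
  moreover have "\<forall>q. q \<noteq> l \<and> q \<noteq> k \<longrightarrow> \<mu>' q = \<mu> q \<and> f' q = f q \<and> w' q = w q"
    by (simp add: \<mu>'_def f'_def w'_def)
  ultimately show ?thesis by blast
qed

text \<open>\<open>k\<close> is exchanged with one neighbour after another. An exchange alters only
  the rows of the two nodes involved, so the nodes still to be passed stay affine in
  \<open>k\<close>.\<close>

lemma quad_move_to_head:
  assumes "distinct (xs @ k # ys)" "\<And>q. w q > 0" "\<And>q h s. f q h differentiable (at s)"
    "\<And>l. l \<in> set xs \<Longrightarrow> affine_fun (f l k)"
  shows "\<exists>\<mu>' f' w'. (\<forall>x. quad (xs @ k # ys) \<mu> f w x = quad (k # xs @ ys) \<mu>' f' w' x) \<and>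
    (\<forall>q. w' q > 0) \<and> (\<forall>q h s. f' q h differentiable (at s)) \<and>
    (\<forall>q. q \<notin> set xs \<and> q \<noteq> k \<longrightarrow> \<mu>' q = \<mu> q \<and> f' q = f q \<and> w' q = w q)"
  using assms
proof (induction xs arbitrary: ys \<mu> f w rule: rev_induct)
  case Nil
  show ?case by (rule exI[of _ \<mu>], rule exI[of _ f], rule exI[of _ w]) (use Nil in auto)
next
  case (snoc l xs)
  have l: "l \<noteq> k" "l \<notin> set ys" "k \<notin> set ys" "l \<notin> set xs" "k \<notin> set xs" using snoc.prems(1) by auto
  obtain \<mu>1 f1 w1 a b where 1: "\<And>x. quad (l # k # ys) \<mu> f w x = quad (k # l # ys) \<mu>1 f1 w1 x"
    "\<And>q. w1 q > 0" "\<And>q h s. f1 q h differentiable (at s)"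
    "\<And>q. q \<noteq> l \<and> q \<noteq> k \<Longrightarrow> \<mu>1 q = \<mu> q \<and> f1 q = f q \<and> w1 q = w q"
    using quad_swap[of l k ys w f \<mu>] l snoc.prems by auto
  have e: "quad (xs @ l # k # ys) \<mu> f w x = quad (xs @ k # l # ys) \<mu>1 f1 w1 x" for x
  proof (rule quad_append_cong)
    show "\<mu> q = \<mu>1 q \<and> f q = f1 q \<and> w q = w1 q" if "q \<in> set xs" for q
    proof -
      have "q \<noteq> l \<and> q \<noteq> k" using that l by auto
      then show ?thesis using 1(4) by simp
    qed
  qed (use 1(1) in auto)
  have "distinct (xs @ k # l # ys)" using snoc.prems(1) by auto
  moreover have "affine_fun (f1 q k)" if "q \<in> set xs" for q
  proof -
    have "q \<noteq> l \<and> q \<noteq> k" using that l by auto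
    then show ?thesis using 1(4) snoc.prems(4)[of q] that by simp
  qed
  ultimately obtain \<mu>2 f2 w2 where 2: "\<And>x. quad (xs @ k # l # ys) \<mu>1 f1 w1 x = quad (k # xs @ l # ys) \<mu>2 f2 w2 x"
    "\<And>q. w2 q > 0" "\<And>q h s. f2 q h differentiable (at s)"
    "\<And>q. q \<notin> set xs \<and> q \<noteq> k \<Longrightarrow> \<mu>2 q = \<mu>1 q \<and> f2 q = f1 q \<and> w2 q = w1 q"
    using snoc.IH[of "l # ys" w1 f1 \<mu>1] 1 by auto
  show ?case
    by (rule exI[of _ \<mu>2], rule exI[of _ f2], rule exI[of _ w2]) (use e 1 2 in auto)
qed

text \<open>For the last node \<open>k\<close> only its own residual involves \<open>x k\<close>,
  and with slope one.\<close>

lemma second_difference_head: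
  assumes "k \<notin> set r" "w k \<noteq> 0"
  shows "quad (k # r) \<mu> f w (x(k := x k + t)) + quad (k # r) \<mu> f w (x(k := x k - t))
    - 2 * quad (k # r) \<mu> f w x = 2 / w k * t\<^sup>2"
proof -
  have "(\<Sum>h\<in>set r. f k h ((x(k := v)) h)) = (\<Sum>h\<in>set r. f k h (x h))" for v
    using assms by (intro sum.cong) auto
  then show ?thesis using assms
    by (simp add: quad_update_notin field_simps power2_eq_square del: fun_upd_apply) (simp add: algebra_simps)
qed

text \<open>The last node k of L' has only affine out-edges in L, so it can be moved to the end of L
  as well and then removed from both orders; a non-affine f j i survives this.\<close>
lemma quad_nonaffine_order:
  assumes "distinct (as @ j # i # bs)" "\<And>q. w q > 0" "\<And>q h s. f q h differentiable (at s)"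
    "\<not> affine_fun (f j i)"
    "distinct L'" "set L' = set (as @ j # i # bs)" "\<And>q. w' q > 0"
    "\<And>x. quad (as @ j # i # bs) \<mu> f w x = quad L' \<mu>' f' w' x + c"
  shows "\<exists>us vs. L' = us @ j # vs \<and> i \<in> set vs"
  using assms(1-6,8)
proof (induction L' arbitrary: as bs \<mu> f w)
  case (Cons k r')
  let ?L = "as @ j # i # bs"
  have k: "k \<notin> set r'" using Cons.prems by auto
  have sd: "quad ?L \<mu> f w (x(k := x k + t)) + quad ?L \<mu> f w (x(k := x k - t))
    - 2 * quad ?L \<mu> f w x = (2 / w' k) * t\<^sup>2" for x t
    unfolding Cons.prems(7) using second_difference_head[of k r' w' \<mu>' f' x t] k assms(7)[of k] by simp
  have out: "affine_fun (f l k)" if "?L = xs @ k # ys" "l \<in> set xs" for xs ys l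
    using quad_out_edges_affine[of xs k ys w f \<mu> "2 / w' k" l] sd that Cons.prems(1-3) by auto
  \<comment> \<open>All out-edges of \<open>k\<close> are affine, whereas \<open>j\<close> depends
    on \<open>i\<close> through the nonaffine \<open>f j i\<close>.\<close>
  have "k \<noteq> i" using out[of "as @ [j]" bs j] Cons.prems(4) by auto
  show ?case
  proof (cases "k = j")
    case True
    have "i \<in> set r'" using Cons.prems(6) \<open>k \<noteq> i\<close> by auto
    then show ?thesis using True by (metis append_Nil)
  next
    case False
    have "\<exists>as' bs' \<mu>1 f1 w1. (\<forall>x. quad ?L \<mu> f w x = quad (k # as' @ j # i # bs') \<mu>1 f1 w1 x) \<and>
       (\<forall>q. w1 q > 0) \<and> (\<forall>q h s. f1 q h differentiable (at s)) \<and> \<not> affine_fun (f1 j i) \<and>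
       distinct (k # as' @ j # i # bs') \<and> set (k # as' @ j # i # bs') = set ?L"
    proof -
      have "k \<in> set as \<or> k \<in> set bs" using Cons.prems(6) False \<open>k \<noteq> i\<close> by auto
      then show ?thesis
      proof
        \<comment> \<open>Here \<open>k\<close> comes after \<open>j\<close>, and its move does not
          touch the row of \<open>j\<close>.\<close>
        assume "k \<in> set as"
        then obtain a1 a2 where as: "as = a1 @ k # a2" by (meson split_list)
        have L: "?L = a1 @ k # (a2 @ j # i # bs)" by (simp add: as)
        have d: "distinct (a1 @ k # (a2 @ j # i # bs))" using Cons.prems(1) L by simp
        obtain \<mu>1 f1 w1 where 1: "\<And>x. quad ?L \<mu> f w x = quad (k # a1 @ a2 @ j # i # bs) \<mu>1 f1 w1 x"
          "\<And>q. w1 q > 0" "\<And>q h s. f1 q h differentiable (at s)"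
          "\<And>q. q \<notin> set a1 \<and> q \<noteq> k \<Longrightarrow> f1 q = f q"
          using quad_move_to_head[of a1 k "a2 @ j # i # bs" w f \<mu>, OF d Cons.prems(2,3)] out[OF L]
          unfolding L[symmetric] by (auto simp del: quad.simps)
        have "f1 j = f j" using 1(4)[of j] d False by auto
        then show ?thesis
          by (intro exI[of _ "a1 @ a2"] exI[of _ bs] exI[of _ \<mu>1] exI[of _ f1] exI[of _ w1])
            (use 1(1-3) Cons.prems(1,4) as in \<open>auto simp del: quad.simps\<close>)
      next
        \<comment> \<open>Here \<open>k\<close> comes before \<open>i\<close> and has to pass
          \<open>b1\<close>, \<open>i\<close>, \<open>j\<close> and \<open>as\<close>. These are
          four separate stages because the explicit formulas of \<open>quad_swap\<close> are needed
          when \<open>i\<close> and \<open>j\<close> are passed.\<close>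
        assume "k \<in> set bs"
        then obtain b1 b2 where bs: "bs = b1 @ k # b2" by (meson split_list)
        have L: "?L = (as @ j # i # b1) @ k # b2" by (simp add: bs)
        have d: "distinct (as @ j # i # b1 @ k # b2)" using Cons.prems(1) bs by simp
        have aff: "affine_fun (f l k)" if "l \<in> set as \<union> {j, i} \<union> set b1" for l
          using out[OF L, of l] that by auto
        obtain \<mu>1 f1 w1 where 1: "\<And>x. quad (b1 @ k # b2) \<mu> f w x = quad (k # b1 @ b2) \<mu>1 f1 w1 x"
          "\<And>q. w1 q > 0" "\<And>q h s. f1 q h differentiable (at s)"
          "\<And>q. q \<notin> set b1 \<and> q \<noteq> k \<Longrightarrow> \<mu>1 q = \<mu> q \<and> f1 q = f q \<and> w1 q = w q"
          using quad_move_to_head[of b1 k b2 w f \<mu>] Cons.prems(2,3) aff d by auto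
        have f1: "f1 q = f q" if "q \<in> set as \<union> {j, i}" for q using 1(4)[of q] d that by auto
        obtain \<mu>2 f2 w2 b where 2: "\<And>x. quad (i # k # b1 @ b2) \<mu>1 f1 w1 x = quad (k # i # b1 @ b2) \<mu>2 f2 w2 x"
          "\<And>q. w2 q > 0" "\<And>q h s. f2 q h differentiable (at s)"
          "\<And>q. q \<noteq> i \<and> q \<noteq> k \<Longrightarrow> \<mu>2 q = \<mu>1 q \<and> f2 q = f1 q \<and> w2 q = w1 q"
          "f2 k i = (\<lambda>s. b * s)"
          using quad_swap[of i k "b1 @ b2" w1 f1 \<mu>1, OF _ _ _ 1(2,3)] f1[of i] aff[of i] d
          by (auto simp del: quad.simps)
        have f2: "f2 q = f q" if "q \<in> set as \<union> {j}" for q using 2(4)[of q] f1[of q] d that by auto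
        obtain \<mu>3 f3 w3 a where 3: "\<And>x. quad (j # k # i # b1 @ b2) \<mu>2 f2 w2 x = quad (k # j # i # b1 @ b2) \<mu>3 f3 w3 x"
          "\<And>q. w3 q > 0" "\<And>q h s. f3 q h differentiable (at s)"
          "\<And>q. q \<noteq> j \<and> q \<noteq> k \<Longrightarrow> \<mu>3 q = \<mu>2 q \<and> f3 q = f2 q \<and> w3 q = w2 q"
          "\<And>h. f3 j h = (\<lambda>s. f2 j h s + a * f2 k h s)"
          using quad_swap[of j k "i # b1 @ b2" w2 f2 \<mu>2, OF _ _ _ 2(2,3)] f2[of j] aff[of j] d
          by (auto simp del: quad.simps)
        have f3: "f3 q = f q" if "q \<in> set as" for q using 3(4)[of q] f2[of q] d that by auto
        \<comment> \<open>Passing \<open>i\<close> gave \<open>k\<close> the linear function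
          \<open>b * s\<close> of the coordinate of \<open>i\<close>; passing \<open>j\<close> adds
          \<open>a\<close> times that function to \<open>f j i\<close>.\<close>
        have "f3 j i = (\<lambda>s. f j i s + (a * b) * s)" using 3(5)[of i] 2(5) f2[of j] by (simp add: mult.assoc)
        then have na: "\<not> affine_fun (f3 j i)" using affine_fun_add_linear_iff Cons.prems(4) by simp
        have d4: "distinct (as @ k # j # i # b1 @ b2)" using d by auto
        obtain \<mu>4 f4 w4 where 4: "\<And>x. quad (as @ k # j # i # b1 @ b2) \<mu>3 f3 w3 x = quad (k # as @ j # i # b1 @ b2) \<mu>4 f4 w4 x"
          "\<And>q. w4 q > 0" "\<And>q h s. f4 q h differentiable (at s)"
          "\<And>q. q \<notin> set as \<and> q \<noteq> k \<Longrightarrow> f4 q = f3 q"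
          using quad_move_to_head[of as k "j # i # b1 @ b2" w3 f3 \<mu>3, OF d4] 3(2,3) f3 aff by auto
        have "\<mu> q = \<mu>1 q \<and> f q = f1 q \<and> w q = w1 q" if "q \<in> set (as @ [j, i])" for q
        proof -
          have "q \<notin> set b1 \<and> q \<noteq> k" using d that by auto
          then show ?thesis using 1(4)[of q] by simp
        qed
        then have "quad ?L \<mu> f w x = quad (as @ j # i # k # b1 @ b2) \<mu>1 f1 w1 x" for x
          using quad_append_cong[of "b1 @ k # b2" "k # b1 @ b2" \<mu> f w \<mu>1 f1 w1 "as @ [j, i]" x] 1(1) bs
          by simp
        moreover have "\<mu>1 q = \<mu>2 q \<and> f1 q = f2 q \<and> w1 q = w2 q" if "q \<in> set (as @ [j])" for q
        proof -
          have "q \<noteq> i \<and> q \<noteq> k" using d that by auto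
          then show ?thesis using 2(4)[of q] by simp
        qed
        then have "quad (as @ j # i # k # b1 @ b2) \<mu>1 f1 w1 x = quad (as @ j # k # i # b1 @ b2) \<mu>2 f2 w2 x" for x
          using quad_append_cong[of "i # k # b1 @ b2" "k # i # b1 @ b2" \<mu>1 f1 w1 \<mu>2 f2 w2 "as @ [j]" x] 2(1)
          by (simp add: insert_commute)
        moreover have "\<mu>2 q = \<mu>3 q \<and> f2 q = f3 q \<and> w2 q = w3 q" if "q \<in> set as" for q
        proof -
          have "q \<noteq> j \<and> q \<noteq> k" using d that by auto
          then show ?thesis using 3(4)[of q] by simp
        qed
        then have "quad (as @ j # k # i # b1 @ b2) \<mu>2 f2 w2 x = quad (as @ k # j # i # b1 @ b2) \<mu>3 f3 w3 x" for x
          using quad_append_cong[of "j # k # i # b1 @ b2" "k # j # i # b1 @ b2" \<mu>2 f2 w2 \<mu>3 f3 w3 as x] 3(1)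
          by (simp add: insert_commute)
        ultimately have q: "quad ?L \<mu> f w x = quad (k # as @ j # i # b1 @ b2) \<mu>4 f4 w4 x" for x
          using 4(1) by simp
        have "f4 j = f3 j" using 4(4)[of j] d by auto
        then show ?thesis
          by (intro exI[of _ as] exI[of _ "b1 @ b2"] exI[of _ \<mu>4] exI[of _ f4] exI[of _ w4] conjI allI)
            (use q 4(2,3) na d bs in \<open>auto simp del: quad.simps\<close>)
      qed
    qed
    then obtain as' bs' \<mu>1 f1 w1 where 1: "\<And>x. quad ?L \<mu> f w x = quad (k # as' @ j # i # bs') \<mu>1 f1 w1 x"
      "\<And>q. w1 q > 0" "\<And>q h s. f1 q h differentiable (at s)" "\<not> affine_fun (f1 j i)"
      "distinct (k # as' @ j # i # bs')" "set (k # as' @ j # i # bs') = set ?L" by blast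
    have "quad (as' @ j # i # bs') \<mu>1 f1 w1 x = quad r' \<mu>' f' w' x + c" for x
      by (rule quad_drop[of k]) (use 1(2) assms(7) 1(5) k 1(1)[symmetric] Cons.prems(7) in \<open>auto simp del: quad.simps\<close>)
    moreover have "set r' = set (as' @ j # i # bs')" using 1(5,6) k Cons.prems(6) by auto
    moreover have "distinct r'" using Cons.prems by auto
    ultimately obtain us vs where "r' = us @ j # vs" "i \<in> set vs"
      using Cons.IH[of as' bs' w1 f1 \<mu>1] 1 by auto
    then have "k # r' = (k # us) @ j # vs" by simp
    then show ?thesis using \<open>i \<in> set vs\<close> by blast
  qed
qed simp

section \<open>The law of a structural equation model\<close>

text \<open>The head is the last node, as in \<open>quad\<close>, so that induction on the list
  removes a node on which no other one in the list depends.\<close>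

fun topo :: "(nat \<times> nat) set \<Rightarrow> nat list \<Rightarrow> bool" where
  "topo D [] \<longleftrightarrow> True"
| "topo D (l # r) \<longleftrightarrow> pa D l \<subseteq> set r \<and> l \<notin> set r \<and> topo D r"

lemma topo_distinct: "topo D L \<Longrightarrow> distinct L"
  by (induction L) auto

lemma topo_appendD: "topo D (xs @ ys) \<Longrightarrow> topo D ys"
  by (induction xs) auto

lemma topo_mono: "topo D L \<Longrightarrow> (\<And>l. l \<in> set L \<Longrightarrow> pa E l \<subseteq> pa D l) \<Longrightarrow> topo E L"
  by (induction L) auto

text \<open>The order grows by a minimal missing node at a time. Allowing a prescribed tail
  \<open>ys\<close> is what later places a covered edge at neighbouring positions.\<close>

lemma ex_topo_extension:
  assumes "acyclic D" "finite D" "finite V" "\<And>l. l \<in> V \<Longrightarrow> pa D l \<subseteq> V"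
  shows "topo D ys \<Longrightarrow> set ys \<subseteq> V \<Longrightarrow> \<exists>xs. topo D (xs @ ys) \<and> set (xs @ ys) = V"
proof (induction "card (V - set ys)" arbitrary: ys rule: less_induct)
  case less
  show ?case
  proof (cases "V = set ys")
    case True
    then show ?thesis using less.prems by (intro exI[of _ "[]"]) auto
  next
    case False
    have "wf D" using assms finite_acyclic_wf by blast
    moreover have "V - set ys \<noteq> {}" using False less.prems by auto
    ultimately obtain v where v: "v \<in> V - set ys" "\<And>u. (u, v) \<in> D \<Longrightarrow> u \<notin> V - set ys"
      by (metis ex_in_conv wfE_min)
    have "topo D (v # ys)" using v less.prems assms(4)[of v] by (auto simp: pa_def)
    moreover have "card (V - set (v # ys)) < card (V - set ys)"
      using v assms(3) by (intro psubset_card_mono) auto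
    moreover have "set (v # ys) \<subseteq> V" using v less.prems by auto
    ultimately obtain xs where "topo D (xs @ v # ys)" "set (xs @ v # ys) = V" using less.hyps by blast
    then show ?thesis by (intro exI[of _ "xs @ [v]"]) simp
  qed
qed

lemma topo_append_cong:
  assumes "topo D (xs @ ys)" "set ys = set zs" "topo E zs" "\<And>l. l \<in> set xs \<Longrightarrow> pa E l = pa D l"
  shows "topo E (xs @ zs)"
  using assms by (induction xs) auto

section \<open>Solving the structural equations along an order\<close>

definition cmean :: "(nat \<times> nat) set \<Rightarrow> (nat \<Rightarrow> real) \<Rightarrow> (nat \<Rightarrow> nat \<Rightarrow> real \<Rightarrow> real) \<Rightarrow> nat \<Rightarrow> (nat \<Rightarrow> real) \<Rightarrow> real" where
  "cmean D \<mu> f j x = \<mu> j + (\<Sum>i\<in>pa D j. f j i (x i))"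

lemma cmean_cong: "(\<And>i. i \<in> pa D j \<Longrightarrow> x i = y i) \<Longrightarrow> cmean D \<mu> f j x = cmean D \<mu> f j y"
  by (auto simp: cmean_def)

text \<open>The value \<open>undefined\<close> off the list makes the solution extensional, as the
  definite description in \<open>sem_sol\<close> demands.\<close>

fun sol :: "(nat \<times> nat) set \<Rightarrow> (nat \<Rightarrow> real) \<Rightarrow> (nat \<Rightarrow> nat \<Rightarrow> real \<Rightarrow> real) \<Rightarrow> nat list \<Rightarrow> (nat \<Rightarrow> real) \<Rightarrow> nat \<Rightarrow> real" where
  "sol D \<mu> f [] e = (\<lambda>_. undefined)"
| "sol D \<mu> f (s # r) e = (sol D \<mu> f r e)(s := cmean D \<mu> f s (sol D \<mu> f r e) + e s)"

lemma sol_extensional: "sol D \<mu> f L e \<in> extensional (set L)"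
  by (induction L) (auto simp: extensional_def)

lemma sol_cong: "(\<And>j. j \<in> set L \<Longrightarrow> e j = e' j) \<Longrightarrow> sol D \<mu> f L e = sol D \<mu> f L e'"
  by (induction L) auto

lemma sol_update_notin: "s \<notin> set L \<Longrightarrow> sol D \<mu> f L (e(s := t)) = sol D \<mu> f L e"
  by (rule sol_cong) auto

lemma sol_eq: "topo D L \<Longrightarrow> j \<in> set L \<Longrightarrow> sol D \<mu> f L e j = cmean D \<mu> f j (sol D \<mu> f L e) + e j"
proof (induction L)
  case (Cons s r)
  have c: "cmean D \<mu> f j (sol D \<mu> f (s # r) e) = cmean D \<mu> f j (sol D \<mu> f r e)"
    if "pa D j \<subseteq> set r"
    by (rule cmean_cong) (use that Cons.prems in auto)
  show ?case
  proof (cases "j = s")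
    case True
    then show ?thesis using c Cons.prems by (metis fun_upd_same sol.simps(2) topo.simps(2))
  next
    case False
    then have "j \<in> set r" using Cons.prems by simp
    moreover have "pa D j \<subseteq> set r" using Cons.prems \<open>j \<in> set r\<close>
    proof -
      have "topo D r \<Longrightarrow> j \<in> set r \<Longrightarrow> pa D j \<subseteq> set r" for r by (induction r) auto
      then show ?thesis using Cons.prems \<open>j \<in> set r\<close> by auto
    qed
    moreover have "sol D \<mu> f r e j = cmean D \<mu> f j (sol D \<mu> f r e) + e j"
      using Cons.IH Cons.prems \<open>j \<in> set r\<close> by simp
    ultimately show ?thesis using c False by (metis fun_upd_other sol.simps(2))
  qed
qed simp

lemma sol_unique:
  "topo D L \<Longrightarrow> (\<And>j. j \<in> set L \<Longrightarrow> x j = cmean D \<mu> f j x + e j) \<Longrightarrow> j \<in> set L \<Longrightarrow> x j = sol D \<mu> f L e j"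
proof (induction L arbitrary: j)
  case (Cons s r)
  have IH: "x j = sol D \<mu> f r e j" if "j \<in> set r" for j using Cons that by auto
  have "cmean D \<mu> f s x = cmean D \<mu> f s (sol D \<mu> f r e)"
    by (rule cmean_cong) (use IH Cons.prems in auto)
  then show ?case using IH Cons.prems(2)[of s] Cons.prems(3) Cons.prems(1) by auto
qed simp

text \<open>Along a topological order the equations determine one coordinate after another, which
  gives existence and uniqueness for the definite description.\<close>

lemma sem_sol_eq_sol:
  assumes "topo D L" "set L = nodes p"
  shows "sem_sol p D \<mu> f e = sol D \<mu> f L e"
  unfolding sem_sol_def
proof (rule the_equality)
  show "sol D \<mu> f L e \<in> extensional (nodes p) \<and>
    (\<forall>j\<in>nodes p. sol D \<mu> f L e j = \<mu> j + (\<Sum>i\<in>pa D j. f j i (sol D \<mu> f L e i)) + e j)"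
    using sol_extensional[of D \<mu> f L e] sol_eq[OF assms(1), of _ \<mu> f e] assms(2) by (simp add: cmean_def)
next
  fix x assume x: "x \<in> extensional (nodes p) \<and> (\<forall>j\<in>nodes p. x j = \<mu> j + (\<Sum>i\<in>pa D j. f j i (x i)) + e j)"
  show "x = sol D \<mu> f L e"
  proof (rule extensionalityI)
    show "x \<in> extensional (nodes p)" "sol D \<mu> f L e \<in> extensional (nodes p)"
      using x sol_extensional[of D \<mu> f L e] assms(2) by auto
    show "x j = sol D \<mu> f L e j" if "j \<in> nodes p" for j
      by (rule sol_unique) (use x assms that in \<open>auto simp: cmean_def\<close>)
  qed
qed

section \<open>Change of variables from noises to coordinates\<close>

abbreviation Bor :: "nat set \<Rightarrow> (nat \<Rightarrow> real) measure" where
  "Bor I \<equiv> \<Pi>\<^sub>M j\<in>I. borel"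

abbreviation Leb :: "nat set \<Rightarrow> (nat \<Rightarrow> real) measure" where
  "Leb I \<equiv> \<Pi>\<^sub>M j\<in>I. lborel"

abbreviation gauss :: "real \<Rightarrow> real measure" where
  "gauss s \<equiv> density lborel (normal_density 0 s)"

abbreviation Noise :: "nat set \<Rightarrow> (nat \<Rightarrow> real) \<Rightarrow> (nat \<Rightarrow> real) measure" where
  "Noise I \<sigma> \<equiv> \<Pi>\<^sub>M j\<in>I. gauss (\<sigma> j)"

lemma sets_Leb: "sets (Leb I) = sets (Bor I)" and sets_Noise: "sets (Noise I \<sigma>) = sets (Bor I)"
  by (auto intro!: sets_PiM_cong)

lemma cmean_measurable:
  assumes "\<And>l h. f l h \<in> borel_measurable borel" "pa D j \<subseteq> I"
  shows "cmean D \<mu> f j \<in> borel_measurable (Bor I)"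
proof -
  have "(\<lambda>x. f j i (x i)) \<in> borel_measurable (Bor I)" if "i \<in> pa D j" for i
    using assms that by (intro measurable_compose[OF measurable_component_singleton]) auto
  then show ?thesis unfolding cmean_def[abs_def] by (intro borel_measurable_add borel_measurable_sum) auto
qed

lemma sol_measurable:
  assumes "\<And>l h. f l h \<in> borel_measurable borel"
  shows "topo D L \<Longrightarrow> set L \<subseteq> J \<Longrightarrow> sol D \<mu> f L \<in> Bor J \<rightarrow>\<^sub>M Bor (set L)"
proof (induction L)
  case Nil
  have "sol D \<mu> f [] = (\<lambda>_. \<lambda>_. undefined)" by (rule ext) simp
  then show ?case by (simp add: space_PiM)
next
  case (Cons s r)
  have IH: "sol D \<mu> f r \<in> Bor J \<rightarrow>\<^sub>M Bor (set r)" using Cons by auto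
  have c: "cmean D \<mu> f s \<in> borel_measurable (Bor (set r))"
    by (rule cmean_measurable) (use assms Cons.prems in auto)
  have "(\<lambda>e. cmean D \<mu> f s (sol D \<mu> f r e) + e s) \<in> borel_measurable (Bor J)"
    using measurable_compose[OF IH c] Cons.prems
    by (intro borel_measurable_add measurable_component_singleton) auto
  then have "(\<lambda>e. (sol D \<mu> f r e)(s := cmean D \<mu> f s (sol D \<mu> f r e) + e s)) \<in> Bor J \<rightarrow>\<^sub>M Bor (set (s # r))"
    by (intro measurable_fun_upd[OF _ IH]) auto
  moreover have "sol D \<mu> f (s # r) = (\<lambda>e. (sol D \<mu> f r e)(s := cmean D \<mu> f s (sol D \<mu> f r e) + e s))"
    by (rule ext) simp
  ultimately show ?case by (simp del: fun_upd_apply)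
qed

lemma prob_space_gauss: "s > 0 \<Longrightarrow> prob_space (gauss s)"
  by (rule prob_space_normal_density)

lemma product_sigma_finite_gauss: "(\<And>j. \<sigma> j > 0) \<Longrightarrow> product_sigma_finite (\<lambda>j. gauss (\<sigma> j))"
  by (simp add: product_sigma_finite_def prob_space_gauss prob_space_imp_sigma_finite)

lemma nn_integral_Noise_insert:
  assumes "\<And>j. \<sigma> j > 0" "finite I" "s \<notin> I" "F \<in> borel_measurable (Bor (insert s I))"
  shows "(\<integral>\<^sup>+ e. F e \<partial>Noise (insert s I) \<sigma>) = (\<integral>\<^sup>+ e. (\<integral>\<^sup>+ t. F (e(s := t)) \<partial>gauss (\<sigma> s)) \<partial>Noise I \<sigma>)"
proof -
  interpret product_sigma_finite "\<lambda>j. gauss (\<sigma> j)" using assms(1) by (rule product_sigma_finite_gauss)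
  have "F \<in> borel_measurable (Noise (insert s I) \<sigma>)"
    using assms(4) measurable_cong_sets[OF sets_Noise refl] by blast
  then show ?thesis using product_nn_integral_insert assms(2,3) by simp
qed

lemma nn_integral_Leb_insert:
  assumes "finite I" "s \<notin> I" "F \<in> borel_measurable (Bor (insert s I))"
  shows "(\<integral>\<^sup>+ x. F x \<partial>Leb (insert s I)) = (\<integral>\<^sup>+ x. (\<integral>\<^sup>+ t. F (x(s := t)) \<partial>lborel) \<partial>Leb I)"
proof -
  interpret product_sigma_finite "\<lambda>_. lborel :: real measure"
    by (simp add: product_sigma_finite_def sigma_finite_lborel)
  have "F \<in> borel_measurable (Leb (insert s I))"
    using assms(3) measurable_cong_sets[OF sets_Leb refl] by blast
  then show ?thesis using product_nn_integral_insert[OF assms(1,2)] by blast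
qed

lemma nn_integral_gauss_shift:
  assumes "F \<in> borel_measurable borel"
  shows "(\<integral>\<^sup>+ t. F (m + t) \<partial>gauss s) = (\<integral>\<^sup>+ y. ennreal (normal_density 0 s (y - m)) * F y \<partial>lborel)"
proof -
  note [measurable] = assms
  have "(\<integral>\<^sup>+ t. F (m + t) \<partial>gauss s) = (\<integral>\<^sup>+ t. ennreal (normal_density 0 s t) * F (m + t) \<partial>lborel)"
    by (subst nn_integral_density) auto
  also have "\<dots> = (\<integral>\<^sup>+ y. ennreal (normal_density 0 s (y - m)) * F y \<partial>lborel)"
    by (subst (2) nn_integral_real_affine[where c=1 and t=m]) auto
  finally show ?thesis .
qed

definition sem_density :: "(nat \<times> nat) set \<Rightarrow> (nat \<Rightarrow> real) \<Rightarrow> (nat \<Rightarrow> nat \<Rightarrow> real \<Rightarrow> real) \<Rightarrow> (nat \<Rightarrow> real)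
    \<Rightarrow> nat list \<Rightarrow> (nat \<Rightarrow> real) \<Rightarrow> real" where
  "sem_density D \<mu> f \<sigma> L x = (\<Prod>l\<in>set L. normal_density 0 (\<sigma> l) (x l - cmean D \<mu> f l x))"

lemma topo_pa_subset: "topo D L \<Longrightarrow> j \<in> set L \<Longrightarrow> pa D j \<subseteq> set L"
  by (induction L) auto

lemma sem_density_measurable:
  assumes "\<And>l h. f l h \<in> borel_measurable borel" "topo D L" "set L \<subseteq> J"
  shows "sem_density D \<mu> f \<sigma> L \<in> borel_measurable (Bor J)"
proof -
  have "(\<lambda>x. normal_density 0 (\<sigma> l) (x l - cmean D \<mu> f l x)) \<in> borel_measurable (Bor J)" if "l \<in> set L" for l
  proof -
    have "cmean D \<mu> f l \<in> borel_measurable (Bor J)"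
      by (rule cmean_measurable) (use assms topo_pa_subset that in blast)+
    then have "(\<lambda>x. x l - cmean D \<mu> f l x) \<in> borel_measurable (Bor J)"
      using that assms by (intro borel_measurable_diff measurable_component_singleton) auto
    then show ?thesis by (rule measurable_compose) simp
  qed
  then show ?thesis unfolding sem_density_def[abs_def] by (rule borel_measurable_prod)
qed

lemma sem_density_nonneg: "sem_density D \<mu> f \<sigma> L x \<ge> 0"
  unfolding sem_density_def by (rule prod_nonneg) simp

lemma sem_density_Cons:
  assumes "topo D (s # r)"
  shows "sem_density D \<mu> f \<sigma> (s # r) (x(s := y)) =
    normal_density 0 (\<sigma> s) (y - cmean D \<mu> f s x) * sem_density D \<mu> f \<sigma> r x"
proof -
  have "cmean D \<mu> f l (x(s := y)) = cmean D \<mu> f l x" if "l \<in> set (s # r)" for l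
    by (rule cmean_cong) (use assms that topo_pa_subset[of D r l] in auto)
  then show ?thesis using assms unfolding sem_density_def by (auto intro!: prod.cong)
qed

text \<open>The map from noises to coordinates is triangular with unit diagonal, so no Jacobian
  appears: given the earlier coordinates, the last one is its noise translated by
  \<open>cmean\<close>. Integrating it out reduces the claim to the test function \<open>G\<close>
  of the earlier coordinates.\<close>

lemma nn_integral_sol:
  assumes f: "\<And>l h. f l h \<in> borel_measurable borel" and \<sigma>: "\<And>j. \<sigma> j > 0"
  shows "topo D L \<Longrightarrow> g \<in> borel_measurable (Bor (set L)) \<Longrightarrow>
    (\<integral>\<^sup>+ e. g (sol D \<mu> f L e) \<partial>Noise (set L) \<sigma>) = (\<integral>\<^sup>+ x. ennreal (sem_density D \<mu> f \<sigma> L x) * g x \<partial>Leb (set L))"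
proof (induction L arbitrary: g)
  case Nil
  show ?case by (simp add: PiM_empty nn_integral_count_space_finite sem_density_def)
next
  case (Cons s r)
  have t: "topo D r" "s \<notin> set r" using Cons.prems by auto
  let ?N = "Noise (set r) \<sigma>"
  let ?m = "cmean D \<mu> f s"
  have gm: "(\<lambda>t. g (x(s := t))) \<in> borel_measurable borel" if "x \<in> space (Bor (set r))" for x
  proof -
    have "(\<lambda>t. x(s := t)) \<in> borel \<rightarrow>\<^sub>M Bor (set (s # r))"
      by (rule measurable_fun_upd[of _ "set r"]) (use that in auto)
    then show ?thesis using Cons.prems(2) by (rule measurable_compose)
  qed
  define G where "G x = (\<integral>\<^sup>+ y. ennreal (normal_density 0 (\<sigma> s) (y - ?m x)) * g (x(s := y)) \<partial>lborel)" for x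
  have mm: "?m \<in> borel_measurable (Bor (set r))" by (rule cmean_measurable) (use f Cons.prems in auto)
  have Gm: "G \<in> borel_measurable (Bor (set r))"
  proof -
    have 1: "(\<lambda>z. (fst z)(s := snd z)) \<in> Bor (set r) \<Otimes>\<^sub>M lborel \<rightarrow>\<^sub>M Bor (set (s # r))"
      by (rule measurable_fun_upd[of _ "set r"]) auto
    have 2: "(\<lambda>z. snd z - ?m (fst z)) \<in> borel_measurable (Bor (set r) \<Otimes>\<^sub>M lborel)"
      using measurable_compose[OF measurable_fst mm] by (intro borel_measurable_diff) auto
    have "(\<lambda>z. ennreal (normal_density 0 (\<sigma> s) (snd z - ?m (fst z))) * g ((fst z)(s := snd z)))
       \<in> borel_measurable (Bor (set r) \<Otimes>\<^sub>M lborel)"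
      using measurable_compose[OF 1 Cons.prems(2)] measurable_compose[OF 2 borel_measurable_normal_density]
      by measurable
    then have "(\<lambda>(x, y). ennreal (normal_density 0 (\<sigma> s) (y - ?m x)) * g (x(s := y)))
       \<in> borel_measurable (Bor (set r) \<Otimes>\<^sub>M lborel)"
      by (simp add: case_prod_beta')
    then show ?thesis unfolding G_def by (rule lborel.borel_measurable_nn_integral)
  qed
  have "(\<integral>\<^sup>+ e. g (sol D \<mu> f (s # r) e) \<partial>Noise (set (s # r)) \<sigma>)
      = (\<integral>\<^sup>+ e. (\<integral>\<^sup>+ t. g (sol D \<mu> f (s # r) (e(s := t))) \<partial>gauss (\<sigma> s)) \<partial>?N)"
    unfolding list.set(2)
    by (rule nn_integral_Noise_insert)
      (use \<sigma> t measurable_compose[OF sol_measurable[where f=f and \<mu>=\<mu>, OF f Cons.prems(1) order_refl] Cons.prems(2)]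
        in \<open>auto simp del: fun_upd_apply\<close>)
  also have "\<dots> = (\<integral>\<^sup>+ e. G (sol D \<mu> f r e) \<partial>?N)"
  proof (rule nn_integral_cong)
    fix e assume "e \<in> space ?N"
    let ?x = "sol D \<mu> f r e"
    have "?x \<in> space (Bor (set r))" using sol_extensional by (auto simp: space_PiM PiE_def)
    then have "(\<integral>\<^sup>+ t. g (?x(s := ?m ?x + t)) \<partial>gauss (\<sigma> s)) = G ?x"
      unfolding G_def by (rule nn_integral_gauss_shift[OF gm])
    then show "(\<integral>\<^sup>+ t. g (sol D \<mu> f (s # r) (e(s := t))) \<partial>gauss (\<sigma> s)) = G ?x"
      using t by (simp add: sol_update_notin)
  qed
  also have "\<dots> = (\<integral>\<^sup>+ x. ennreal (sem_density D \<mu> f \<sigma> r x) * G x \<partial>Leb (set r))"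
    by (rule Cons.IH) (use t Gm in auto)
  also have "\<dots> = (\<integral>\<^sup>+ x. (\<integral>\<^sup>+ y. ennreal (sem_density D \<mu> f \<sigma> (s # r) (x(s := y))) * g (x(s := y)) \<partial>lborel) \<partial>Leb (set r))"
  proof (rule nn_integral_cong)
    fix x assume x: "x \<in> space (Leb (set r))"
    have x': "x \<in> space (Bor (set r))" using x by (simp add: space_PiM)
    show "ennreal (sem_density D \<mu> f \<sigma> r x) * G x =
      (\<integral>\<^sup>+ y. ennreal (sem_density D \<mu> f \<sigma> (s # r) (x(s := y))) * g (x(s := y)) \<partial>lborel)"
      unfolding sem_density_Cons[OF Cons.prems(1)] G_def
      by (subst nn_integral_cmult[symmetric])
        (use gm[OF x'] in \<open>auto simp: ennreal_mult sem_density_nonneg mult_ac\<close>)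
  qed
  also have "\<dots> = (\<integral>\<^sup>+ x. ennreal (sem_density D \<mu> f \<sigma> (s # r) x) * g x \<partial>Leb (set (s # r)))"
    unfolding list.set(2)
    by (rule nn_integral_Leb_insert[symmetric])
      (use t Cons.prems sem_density_measurable[where f=f, OF f Cons.prems(1) order_refl] in auto)
  finally show ?case .
qed

definition sem_law :: "(nat \<times> nat) set \<Rightarrow> (nat \<Rightarrow> real) \<Rightarrow> (nat \<Rightarrow> nat \<Rightarrow> real \<Rightarrow> real) \<Rightarrow> (nat \<Rightarrow> real)
    \<Rightarrow> nat list \<Rightarrow> (nat \<Rightarrow> real) measure" where
  "sem_law D \<mu> f \<sigma> L = distr (Noise (set L) \<sigma>) (Bor (set L)) (sol D \<mu> f L)"

lemma sol_measurable_Noise: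
  assumes "\<And>l h. f l h \<in> borel_measurable borel" "topo D L" "set L \<subseteq> J"
  shows "sol D \<mu> f L \<in> Noise J \<sigma> \<rightarrow>\<^sub>M Bor (set L)"
  using sol_measurable[where f=f, OF assms] measurable_cong_sets[OF sets_Noise refl] by blast

lemma sem_law_eq_density:
  assumes "\<And>l h. f l h \<in> borel_measurable borel" "\<And>j. \<sigma> j > 0" "topo D L"
  shows "sem_law D \<mu> f \<sigma> L = density (Leb (set L)) (\<lambda>x. ennreal (sem_density D \<mu> f \<sigma> L x))"
proof (rule measure_eqI)
  show "sets (sem_law D \<mu> f \<sigma> L) = sets (density (Leb (set L)) (\<lambda>x. ennreal (sem_density D \<mu> f \<sigma> L x)))"
    by (simp add: sem_law_def sets_Leb)
  fix A assume "A \<in> sets (sem_law D \<mu> f \<sigma> L)"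
  then have A: "A \<in> sets (Bor (set L))" by (simp add: sem_law_def)
  then have A': "A \<in> sets (Leb (set L))" by (simp add: sets_Leb)
  have d: "(\<lambda>x. ennreal (sem_density D \<mu> f \<sigma> L x)) \<in> borel_measurable (Leb (set L))"
    using sem_density_measurable[where f=f, OF assms(1,3) order_refl] measurable_cong_sets[OF sets_Leb refl]
    by (intro measurable_compose[OF _ measurable_ennreal]) blast
  have "emeasure (sem_law D \<mu> f \<sigma> L) A = (\<integral>\<^sup>+ x. indicator A x \<partial>sem_law D \<mu> f \<sigma> L)"
    using A by (simp add: sem_law_def)
  also have "\<dots> = (\<integral>\<^sup>+ e. indicator A (sol D \<mu> f L e) \<partial>Noise (set L) \<sigma>)"
    unfolding sem_law_def by (rule nn_integral_distr) (use sol_measurable_Noise[where f=f, OF assms(1,3)] A in auto)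
  also have "\<dots> = (\<integral>\<^sup>+ x. ennreal (sem_density D \<mu> f \<sigma> L x) * indicator A x \<partial>Leb (set L))"
    by (rule nn_integral_sol[where f=f, OF assms]) (use A in auto)
  also have "\<dots> = emeasure (density (Leb (set L)) (\<lambda>x. ennreal (sem_density D \<mu> f \<sigma> L x))) A"
    by (rule emeasure_density[symmetric]) (use d A' in auto)
  finally show "emeasure (sem_law D \<mu> f \<sigma> L) A = \<dots>" .
qed

lemma prob_space_sem_law:
  assumes "\<And>l h. f l h \<in> borel_measurable borel" "\<And>j. \<sigma> j > 0" "topo D L"
  shows "prob_space (sem_law D \<mu> f \<sigma> L)"
proof -
  have "prob_space (Noise (set L) \<sigma>)" by (rule prob_space_PiM) (simp add: assms(2) prob_space_gauss)
  then show ?thesis unfolding sem_law_def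
    by (rule prob_space.prob_space_distr) (rule sol_measurable_Noise[where f=f, OF assms(1,3) order_refl])
qed

section \<open>Equal laws and equal sums of squares\<close>

lemma emeasure_lborel_open_pos:
  fixes S :: "real set"
  assumes "open S" "S \<noteq> {}"
  shows "emeasure lborel S \<noteq> 0"
proof
  assume "emeasure lborel S = 0"
  then have "S \<in> null_sets lborel" using assms(1) by (simp add: null_sets_def)
  then have "negligible S" by (simp add: negligible_iff_null_sets null_sets_completionI)
  then show False using open_not_negligible[OF assms] by simp
qed

text \<open>Around a point where the functions differ there is an open product of such points, and
  its factors over \<open>I\<close> form a box of positive measure. Since \<open>x\<close> is
  extensional, the points of that box agree with \<open>x\<close> off \<open>I\<close> and so lie in
  the product.\<close>

lemma AE_Leb_continuous_eq:
  fixes g h :: "(nat \<Rightarrow> real) \<Rightarrow> real"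
  assumes "finite I" "continuous_on UNIV g" "continuous_on UNIV h" "AE x in Leb I. g x = h x"
    "x \<in> extensional I"
  shows "g x = h x"
proof (rule ccontr)
  assume ne: "g x \<noteq> h x"
  interpret product_sigma_finite "\<lambda>_. lborel :: real measure"
    by (simp add: product_sigma_finite_def sigma_finite_lborel)
  have "open {y. g y \<noteq> h y}" using assms(2,3) by (rule open_Collect_neq)
  then have "openin (product_topology (\<lambda>i. euclidean) UNIV) {y. g y \<noteq> h y}" by (simp add: open_fun_def)
  then obtain X where X: "x \<in> (\<Pi>\<^sub>E i\<in>UNIV. X i)" "\<And>i. open (X i)" "(\<Pi>\<^sub>E i\<in>UNIV. X i) \<subseteq> {y. g y \<noteq> h y}"
    using product_topology_open_contains_basis[of "\<lambda>i. euclidean" UNIV "{y. g y \<noteq> h y}" x] ne by auto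
  have "(\<Pi>\<^sub>E i\<in>I. X i) \<subseteq> (\<Pi>\<^sub>E i\<in>UNIV. X i)"
  proof
    fix y assume y: "y \<in> (\<Pi>\<^sub>E i\<in>I. X i)"
    have "y i \<in> X i" for i
    proof (cases "i \<in> I")
      case False
      then have "y i = x i" using y assms(5) by (auto simp: extensional_def PiE_def)
      then show ?thesis using X(1) by (auto simp: PiE_def)
    qed (use y in auto)
    then show "y \<in> (\<Pi>\<^sub>E i\<in>UNIV. X i)" by (auto simp: PiE_def)
  qed
  then have sub: "(\<Pi>\<^sub>E i\<in>I. X i) \<subseteq> {y \<in> space (Leb I). \<not> g y = h y}"
    using X(3) by (force simp: space_PiM PiE_def)
  obtain N where N: "{y \<in> space (Leb I). \<not> g y = h y} \<subseteq> N" "emeasure (Leb I) N = 0" "N \<in> sets (Leb I)"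
    using assms(4) by (rule AE_E)
  have "emeasure (Leb I) (\<Pi>\<^sub>E i\<in>I. X i) \<le> emeasure (Leb I) N"
    by (rule emeasure_mono) (use sub N in auto)
  moreover have "emeasure (Leb I) (\<Pi>\<^sub>E i\<in>I. X i) = (\<Prod>i\<in>I. emeasure lborel (X i))"
    by (rule emeasure_PiM) (use assms(1) X(2) in auto)
  moreover have "\<dots> \<noteq> 0"
    using emeasure_lborel_open_pos[OF X(2)] X(1) assms(1) by (auto simp: PiE_def)
  ultimately show False using N(2) by simp
qed

lemma sem_density_continuous:
  assumes "\<And>l h s. f l h differentiable (at s)" "\<And>j. \<sigma> j > 0"
  shows "continuous_on UNIV (sem_density D \<mu> f \<sigma> L)"
proof -
  have c: "continuous_on UNIV (f l h)" for l h
    using assms(1) by (simp add: continuous_at_imp_continuous_on differentiable_imp_continuous_within)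
  have fc: "continuous_on UNIV (\<lambda>x :: nat \<Rightarrow> real. f l h (x h))" for l h
    by (rule continuous_on_compose2[OF c]) (auto intro: continuous_on_product_coordinates)
  have "\<sigma> j \<noteq> 0" for j using assms(2)[of j] by simp
  then show ?thesis
    unfolding sem_density_def[abs_def] cmean_def normal_density_def
    by (intro continuous_intros fc) (auto intro: continuous_on_product_coordinates)
qed

lemma differentiable_measurable:
  fixes g :: "real \<Rightarrow> real"
  shows "(\<And>s. g differentiable (at s)) \<Longrightarrow> g \<in> borel_measurable borel"
  by (auto intro!: borel_measurable_continuous_onI
      simp: continuous_at_imp_continuous_on differentiable_imp_continuous_within)

definition sem_const :: "(nat \<Rightarrow> real) \<Rightarrow> nat list \<Rightarrow> real" where
  "sem_const \<sigma> L = (\<Prod>l\<in>set L. 1 / sqrt (2 * pi * (\<sigma> l)\<^sup>2))"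

lemma sem_const_pos: "(\<And>j. \<sigma> j > 0) \<Longrightarrow> sem_const \<sigma> L > 0"
  unfolding sem_const_def by (intro prod_pos ballI) (simp add: zero_less_mult_iff less_imp_neq[symmetric])

text \<open>The density sums over parents and \<open>quad\<close> over all earlier nodes; the
  vanishing of \<open>f\<close> off the edges reconciles the two.\<close>

lemma sem_density_eq_quad:
  assumes "\<And>j. \<sigma> j > 0" "\<And>l h. (h, l) \<notin> D \<Longrightarrow> f l h = (\<lambda>_. 0)"
  shows "topo D L \<Longrightarrow> sem_density D \<mu> f \<sigma> L x = sem_const \<sigma> L * exp (- quad L \<mu> f (\<lambda>l. (\<sigma> l)\<^sup>2) x / 2)"
proof (induction L)
  case Nil
  show ?case by (simp add: sem_density_def sem_const_def)
next
  case (Cons s r)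
  have "(\<Sum>i\<in>pa D s. f s i (x i)) = (\<Sum>h\<in>set r. f s h (x h))"
    by (rule sum.mono_neutral_left) (use Cons.prems assms(2) in \<open>auto simp: pa_def\<close>)
  then have m: "x s - cmean D \<mu> f s x = x s - \<mu> s - (\<Sum>h\<in>set r. f s h (x h))" (is "_ = ?z")
    by (simp add: cmean_def)
  have "sem_density D \<mu> f \<sigma> (s # r) x = normal_density 0 (\<sigma> s) ?z * sem_density D \<mu> f \<sigma> r x"
    using sem_density_Cons[OF Cons.prems, of \<mu> f \<sigma> x "x s"] m by simp
  also have "\<dots> = (1 / sqrt (2 * pi * (\<sigma> s)\<^sup>2) * exp (- (?z\<^sup>2 / (\<sigma> s)\<^sup>2) / 2)) *
      (sem_const \<sigma> r * exp (- quad r \<mu> f (\<lambda>l. (\<sigma> l)\<^sup>2) x / 2))"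
    using Cons by (simp add: normal_density_def)
  also have "\<dots> = sem_const \<sigma> (s # r) * exp (- quad (s # r) \<mu> f (\<lambda>l. (\<sigma> l)\<^sup>2) x / 2)"
    using Cons.prems by (simp add: sem_const_def exp_add[symmetric] add_divide_distrib)
  finally show ?case .
qed

text \<open>The densities agree almost everywhere, hence everywhere by continuity, and after taking
  logarithms only the normalising constants distinguish the two sums.\<close>

lemma sem_law_quad_eq:
  assumes f: "\<And>l h s. f l h differentiable (at s)" and \<sigma>: "\<And>j. \<sigma> j > 0"
    and z: "\<And>l h. (h, l) \<notin> D \<Longrightarrow> f l h = (\<lambda>_. 0)" and t: "topo D L"
    and f': "\<And>l h s. f' l h differentiable (at s)" and \<sigma>': "\<And>j. \<sigma>' j > 0"
    and z': "\<And>l h. (h, l) \<notin> D' \<Longrightarrow> f' l h = (\<lambda>_. 0)" and t': "topo D' L'"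
    and S: "set L = set L'" and eq: "sem_law D \<mu> f \<sigma> L = sem_law D' \<mu>' f' \<sigma>' L'"
  shows "\<exists>c. \<forall>x. quad L \<mu> f (\<lambda>l. (\<sigma> l)\<^sup>2) x = quad L' \<mu>' f' (\<lambda>l. (\<sigma>' l)\<^sup>2) x + c"
proof -
  have m: "f l h \<in> borel_measurable borel" "f' l h \<in> borel_measurable borel" for l h
    using f f' by (auto intro: differentiable_measurable)
  interpret product_sigma_finite "\<lambda>_. lborel :: real measure"
    by (simp add: product_sigma_finite_def sigma_finite_lborel)
  interpret sigma_finite_measure "Leb (set L)" by (rule sigma_finite) simp
  have d: "(\<lambda>x. ennreal (sem_density D \<mu> f \<sigma> L x)) \<in> borel_measurable (Leb (set L))"
    "(\<lambda>x. ennreal (sem_density D' \<mu>' f' \<sigma>' L' x)) \<in> borel_measurable (Leb (set L))"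
    using sem_density_measurable[where f=f, OF m(1) t order_refl]
      sem_density_measurable[where f=f', OF m(2) t' order_refl] S
      measurable_cong_sets[OF sets_Leb refl]
    by (auto intro!: measurable_compose[OF _ measurable_ennreal])
  have "density (Leb (set L)) (\<lambda>x. ennreal (sem_density D \<mu> f \<sigma> L x)) =
    density (Leb (set L)) (\<lambda>x. ennreal (sem_density D' \<mu>' f' \<sigma>' L' x))"
    using eq unfolding sem_law_eq_density[where f=f and \<sigma>=\<sigma>, OF m(1) \<sigma> t]
      sem_law_eq_density[where f=f' and \<sigma>=\<sigma>', OF m(2) \<sigma>' t'] S .
  then have "AE x in Leb (set L). ennreal (sem_density D \<mu> f \<sigma> L x) = ennreal (sem_density D' \<mu>' f' \<sigma>' L' x)"
    using density_unique_iff[OF d] by simp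
  then have ae: "AE x in Leb (set L). sem_density D \<mu> f \<sigma> L x = sem_density D' \<mu>' f' \<sigma>' L' x"
    by (simp add: sem_density_nonneg)
  define c where "c = 2 * (ln (sem_const \<sigma> L) - ln (sem_const \<sigma>' L'))"
  have "quad L \<mu> f (\<lambda>l. (\<sigma> l)\<^sup>2) x = quad L' \<mu>' f' (\<lambda>l. (\<sigma>' l)\<^sup>2) x + c" for x
  proof -
    \<comment> \<open>The densities are compared at extensional points; as \<open>quad\<close> does
      not look outside \<open>L\<close>, the identity extends to every \<open>x\<close>.\<close>
    let ?x = "restrict x (set L)"
    have "sem_density D \<mu> f \<sigma> L ?x = sem_density D' \<mu>' f' \<sigma>' L' ?x"
      by (rule AE_Leb_continuous_eq[OF _ sem_density_continuous sem_density_continuous ae])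
        (use f \<sigma> f' \<sigma>' in auto)
    then have "sem_const \<sigma> L * exp (- quad L \<mu> f (\<lambda>l. (\<sigma> l)\<^sup>2) ?x / 2) =
      sem_const \<sigma>' L' * exp (- quad L' \<mu>' f' (\<lambda>l. (\<sigma>' l)\<^sup>2) ?x / 2)"
      using sem_density_eq_quad[where f=f and \<sigma>=\<sigma>, OF \<sigma> z t]
        sem_density_eq_quad[where f=f' and \<sigma>=\<sigma>', OF \<sigma>' z' t'] by simp
    then have "ln (sem_const \<sigma> L * exp (- quad L \<mu> f (\<lambda>l. (\<sigma> l)\<^sup>2) ?x / 2)) =
      ln (sem_const \<sigma>' L' * exp (- quad L' \<mu>' f' (\<lambda>l. (\<sigma>' l)\<^sup>2) ?x / 2))" by simp
    then have "quad L \<mu> f (\<lambda>l. (\<sigma> l)\<^sup>2) ?x = quad L' \<mu>' f' (\<lambda>l. (\<sigma>' l)\<^sup>2) ?x + c"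
      using sem_const_pos[where \<sigma>=\<sigma>, OF \<sigma>, of L] sem_const_pos[where \<sigma>=\<sigma>', OF \<sigma>', of L']
      by (simp add: ln_mult c_def)
    moreover have "quad L \<mu> f (\<lambda>l. (\<sigma> l)\<^sup>2) ?x = quad L \<mu> f (\<lambda>l. (\<sigma> l)\<^sup>2) x"
      "quad L' \<mu>' f' (\<lambda>l. (\<sigma>' l)\<^sup>2) ?x = quad L' \<mu>' f' (\<lambda>l. (\<sigma>' l)\<^sup>2) x"
      using S by (auto intro!: quad_cong)
    ultimately show ?thesis by simp
  qed
  then show ?thesis by blast
qed

text \<open>The normalising constants agree because both laws have mass one.\<close>
lemma sem_law_eqI_quad:
  assumes f: "\<And>l h s. f l h differentiable (at s)" and \<sigma>: "\<And>j. \<sigma> j > 0"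
    and z: "\<And>l h. (h, l) \<notin> D \<Longrightarrow> f l h = (\<lambda>_. 0)" and t: "topo D L"
    and f': "\<And>l h s. f' l h differentiable (at s)" and \<sigma>': "\<And>j. \<sigma>' j > 0"
    and z': "\<And>l h. (h, l) \<notin> D' \<Longrightarrow> f' l h = (\<lambda>_. 0)" and t': "topo D' L'"
    and S: "set L = set L'"
    and eq: "\<And>x. quad L \<mu> f (\<lambda>l. (\<sigma> l)\<^sup>2) x = quad L' \<mu>' f' (\<lambda>l. (\<sigma>' l)\<^sup>2) x"
  shows "sem_law D \<mu> f \<sigma> L = sem_law D' \<mu>' f' \<sigma>' L'"
proof -
  have m: "f l h \<in> borel_measurable borel" "f' l h \<in> borel_measurable borel" for l h
    using f f' by (auto intro: differentiable_measurable)
  let ?p = "sem_density D \<mu> f \<sigma> L" and ?p' = "sem_density D' \<mu>' f' \<sigma>' L'"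
  define r where "r = sem_const \<sigma>' L' / sem_const \<sigma> L"
  have K: "sem_const \<sigma> L > 0" "sem_const \<sigma>' L' > 0" using sem_const_pos \<sigma> \<sigma>' by auto
  then have r: "r > 0" by (simp add: r_def)
  have p': "?p' x = r * ?p x" for x
    using sem_density_eq_quad[where f=f and \<sigma>=\<sigma>, OF \<sigma> z t, of \<mu> x]
      sem_density_eq_quad[where f=f' and \<sigma>=\<sigma>', OF \<sigma>' z' t', of \<mu>' x] eq K
    by (simp add: r_def)
  have mp: "(\<lambda>x. ennreal (?p x)) \<in> borel_measurable (Leb (set L))"
    using sem_density_measurable[where f=f, OF m(1) t order_refl] measurable_cong_sets[OF sets_Leb refl]
    by (auto intro!: measurable_compose[OF _ measurable_ennreal])
  note law = sem_law_eq_density[where f=f and \<sigma>=\<sigma> and \<mu>=\<mu>, OF m(1) \<sigma> t]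
  note law' = sem_law_eq_density[where f=f' and \<sigma>=\<sigma>' and \<mu>=\<mu>', OF m(2) \<sigma>' t']
  have "prob_space (density (Leb (set L)) (\<lambda>x. ennreal (?p x)))"
    using prob_space_sem_law[where f=f and \<sigma>=\<sigma> and \<mu>=\<mu>, OF m(1) \<sigma> t] unfolding law .
  then have 1: "(\<integral>\<^sup>+ x. ennreal (?p x) \<partial>Leb (set L)) = 1"
    using prob_space.emeasure_space_1 mp by (fastforce simp: emeasure_density cong: nn_integral_cong)
  have mp': "(\<lambda>x. ennreal (?p' x)) \<in> borel_measurable (Leb (set L))"
    using mp unfolding p' using r by (simp add: ennreal_mult sem_density_nonneg)
  have "prob_space (density (Leb (set L)) (\<lambda>x. ennreal (?p' x)))"
    using prob_space_sem_law[where f=f' and \<sigma>=\<sigma>' and \<mu>=\<mu>', OF m(2) \<sigma>' t'] unfolding law' S .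
  then have "(\<integral>\<^sup>+ x. ennreal (?p' x) \<partial>Leb (set L)) = 1"
    using prob_space.emeasure_space_1 mp' by (fastforce simp: emeasure_density cong: nn_integral_cong)
  moreover have "(\<integral>\<^sup>+ x. ennreal (?p' x) \<partial>Leb (set L)) = ennreal r * (\<integral>\<^sup>+ x. ennreal (?p x) \<partial>Leb (set L))"
    unfolding p' using r mp by (simp add: ennreal_mult sem_density_nonneg nn_integral_cmult)
  ultimately have "r = 1" using 1 by simp
  then show ?thesis unfolding law law' S using p' by simp
qed

section \<open>Local Markov property\<close>

text \<open>Later noises do not influence earlier coordinates and integrate to one, so the marginal
  law of an initial part of the order is the model on that part.\<close>

lemma nn_integral_Noise_sol_suffix:
  assumes f: "\<And>l h. f l h \<in> borel_measurable borel" and \<sigma>: "\<And>j. \<sigma> j > 0"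
    and F: "F \<in> borel_measurable (Bor (set zs))"
  shows "topo D (xs @ zs) \<Longrightarrow>
    (\<integral>\<^sup>+ e. F (restrict (sol D \<mu> f (xs @ zs) e) (set zs)) \<partial>Noise (set (xs @ zs)) \<sigma>) =
    (\<integral>\<^sup>+ e. F (sol D \<mu> f zs e) \<partial>Noise (set zs) \<sigma>)"
proof (induction xs)
  case Nil
  have "restrict (sol D \<mu> f zs e) (set zs) = sol D \<mu> f zs e" for e
    using sol_extensional extensional_restrict by blast
  then show ?case by simp
next
  case (Cons s xs)
  let ?r = "xs @ zs"
  have t: "topo D ?r" "s \<notin> set ?r" using Cons.prems by auto
  interpret G: prob_space "gauss (\<sigma> s)" by (rule prob_space_gauss[OF \<sigma>])
  have r: "restrict (sol D \<mu> f (s # ?r) e) (set zs) = restrict (sol D \<mu> f ?r e) (set zs)" for e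
    using t by (auto simp: restrict_def fun_eq_iff)
  have m: "(\<lambda>e. F (restrict (sol D \<mu> f ?r e) (set zs))) \<in> borel_measurable (Bor (insert s (set ?r)))"
  proof -
    have "(\<lambda>x. restrict x (set zs)) \<in> Bor (set ?r) \<rightarrow>\<^sub>M Bor (set zs)" by (rule measurable_restrict_subset) auto
    moreover have "sol D \<mu> f ?r \<in> Bor (insert s (set ?r)) \<rightarrow>\<^sub>M Bor (set ?r)"
      by (rule sol_measurable[where f=f, OF f t(1)]) auto
    ultimately show ?thesis using measurable_compose[OF measurable_compose F] by blast
  qed
  have "(\<integral>\<^sup>+ e. F (restrict (sol D \<mu> f (s # ?r) e) (set zs)) \<partial>Noise (insert s (set ?r)) \<sigma>)
     = (\<integral>\<^sup>+ e. (\<integral>\<^sup>+ u. F (restrict (sol D \<mu> f ?r (e(s := u))) (set zs)) \<partial>gauss (\<sigma> s)) \<partial>Noise (set ?r) \<sigma>)"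
    unfolding r by (rule nn_integral_Noise_insert[where \<sigma>=\<sigma>, OF \<sigma> _ t(2) m]) simp
  also have "\<dots> = (\<integral>\<^sup>+ e. F (restrict (sol D \<mu> f ?r e) (set zs)) \<partial>Noise (set ?r) \<sigma>)"
    unfolding sol_update_notin[OF t(2)] using G.emeasure_space_1 by simp
  also have "\<dots> = (\<integral>\<^sup>+ e. F (sol D \<mu> f zs e) \<partial>Noise (set zs) \<sigma>)" by (rule Cons.IH[OF t(1)])
  finally show ?case unfolding append_Cons list.set(2) .
qed

text \<open>A version of the conditional probability that the coordinate of \<open>v\<close> lies in
  \<open>a\<close> given its parents, from the normal law centred at \<open>cmean\<close>.\<close>

definition cond_prob :: "(nat \<times> nat) set \<Rightarrow> (nat \<Rightarrow> real) \<Rightarrow> (nat \<Rightarrow> nat \<Rightarrow> real \<Rightarrow> real) \<Rightarrow> (nat \<Rightarrow> real)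
    \<Rightarrow> nat \<Rightarrow> real set \<Rightarrow> (nat \<Rightarrow> real) \<Rightarrow> ennreal" where
  "cond_prob D \<mu> f \<sigma> v a x = (\<integral>\<^sup>+ t. indicator a (cmean D \<mu> f v x + t) \<partial>gauss (\<sigma> v))"

lemma cond_prob_le_1: "\<sigma> v > 0 \<Longrightarrow> cond_prob D \<mu> f \<sigma> v a x \<le> 1"
proof -
  assume "\<sigma> v > 0"
  then interpret prob_space "gauss (\<sigma> v)" by (rule prob_space_gauss)
  have "cond_prob D \<mu> f \<sigma> v a x \<le> (\<integral>\<^sup>+ t. 1 \<partial>gauss (\<sigma> v))"
    unfolding cond_prob_def by (intro nn_integral_mono) (simp add: indicator_def)
  also have "\<dots> = 1" using emeasure_space_1 by simp
  finally show ?thesis .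
qed

lemma cond_prob_cong: "(\<And>i. i \<in> pa D v \<Longrightarrow> x i = y i) \<Longrightarrow> cond_prob D \<mu> f \<sigma> v a x = cond_prob D \<mu> f \<sigma> v a y"
  unfolding cond_prob_def using cmean_cong[of D v x y] by simp

lemma cond_prob_measurable:
  assumes "\<And>l h. f l h \<in> borel_measurable borel" "\<sigma> v > 0" "pa D v \<subseteq> I" "a \<in> sets borel"
  shows "cond_prob D \<mu> f \<sigma> v a \<in> borel_measurable (Bor I)"
proof -
  interpret G: sigma_finite_measure "gauss (\<sigma> v)"
    using prob_space_gauss[OF assms(2)] by (rule prob_space_imp_sigma_finite)
  have m: "cmean D \<mu> f v \<in> borel_measurable (Bor I)" by (rule cmean_measurable) (use assms in auto)
  have "(\<lambda>z. cmean D \<mu> f v (fst z) + snd z) \<in> borel_measurable (Bor I \<Otimes>\<^sub>M gauss (\<sigma> v))"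
    using measurable_compose[OF measurable_fst m]
    by (intro borel_measurable_add) (auto intro: measurable_compose[OF measurable_snd])
  then have "(\<lambda>z. indicator a (cmean D \<mu> f v (fst z) + snd z) :: ennreal) \<in> borel_measurable (Bor I \<Otimes>\<^sub>M gauss (\<sigma> v))"
    by (rule measurable_compose) (use assms(4) in simp)
  then have "(\<lambda>(x, t). indicator a (cmean D \<mu> f v x + t) :: ennreal) \<in> borel_measurable (Bor I \<Otimes>\<^sub>M gauss (\<sigma> v))"
    by (simp add: case_prod_beta')
  then show ?thesis unfolding cond_prob_def[abs_def] by (rule G.borel_measurable_nn_integral)
qed

text \<open>Both integrands involve only coordinates of \<open>v # ys\<close>, so the later nodes
  drop out; the noise of \<open>v\<close> is then integrated out with the coordinates of
  \<open>ys\<close> fixed.\<close>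

lemma nn_integral_sem_law_condition:
  fixes \<mu> :: "nat \<Rightarrow> real"
  assumes f: "\<And>l h. f l h \<in> borel_measurable borel" and \<sigma>: "\<And>j. \<sigma> j > 0"
    and t: "topo D (xs @ v # ys)" and a: "a \<in> sets borel" and u: "u \<in> borel_measurable (Bor (set ys))"
  defines "P \<equiv> sem_law D \<mu> f \<sigma> (xs @ v # ys)"
  shows "(\<integral>\<^sup>+ x. indicator a (x v) * u (restrict x (set ys)) \<partial>P) =
    (\<integral>\<^sup>+ x. cond_prob D \<mu> f \<sigma> v a x * u (restrict x (set ys)) \<partial>P)"
proof -
  let ?L = "xs @ v # ys" and ?H = "cond_prob D \<mu> f \<sigma> v a"
  have tv: "topo D (v # ys)" using t topo_appendD by blast
  then have ty: "topo D ys" "v \<notin> set ys" "pa D v \<subseteq> set ys" by auto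
  have rs: "(\<lambda>x. restrict x (set ys)) \<in> Bor J \<rightarrow>\<^sub>M Bor (set ys)" if "set ys \<subseteq> J" for J
    using that by (rule measurable_restrict_subset)
  define F where "F x = indicator a (x v) * u (restrict x (set ys))" for x :: "nat \<Rightarrow> real"
  have F: "F \<in> borel_measurable (Bor J)" if "set (v # ys) \<subseteq> J" for J
  proof -
    have "(\<lambda>x. indicator a (x v) :: ennreal) \<in> borel_measurable (Bor J)"
      by (rule measurable_compose[OF measurable_component_singleton]) (use a that in auto)
    moreover have "(\<lambda>x. u (restrict x (set ys))) \<in> borel_measurable (Bor J)"
      using measurable_compose[OF rs u] that by auto
    ultimately show ?thesis unfolding F_def by (rule borel_measurable_times_ennreal)
  qed
  have Hm: "?H \<in> borel_measurable (Bor J)" if "set ys \<subseteq> J" for J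
    by (rule cond_prob_measurable[where f=f and \<sigma>=\<sigma>, OF f \<sigma> _ a]) (use ty that in blast)
  define F' where "F' x = ?H x * u x" for x
  have F': "F' \<in> borel_measurable (Bor (set ys))" unfolding F'_def using Hm u by auto
  have F'2: "(\<lambda>x. F' (restrict x (set ys))) \<in> borel_measurable (Bor (set ?L))"
    using measurable_compose[OF rs F', of "set ?L"] by auto
  have sm: "sol D \<mu> f ?L \<in> Noise (set ?L) \<sigma> \<rightarrow>\<^sub>M Bor (set ?L)"
    by (rule sol_measurable_Noise[where f=f, OF f t order_refl])
  have "(\<integral>\<^sup>+ x. F x \<partial>P) = (\<integral>\<^sup>+ e. F (sol D \<mu> f ?L e) \<partial>Noise (set ?L) \<sigma>)"
    unfolding P_def sem_law_def by (rule nn_integral_distr[OF sm]) (use F in auto)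
  also have "\<dots> = (\<integral>\<^sup>+ e. F (restrict (sol D \<mu> f ?L e) (set (v # ys))) \<partial>Noise (set ?L) \<sigma>)"
  proof -
    have "restrict (restrict x (set (v # ys))) (set ys) = restrict x (set ys)" for x :: "nat \<Rightarrow> real"
      by (auto simp: restrict_def fun_eq_iff)
    then show ?thesis unfolding F_def by simp
  qed
  also have "\<dots> = (\<integral>\<^sup>+ e. F (sol D \<mu> f (v # ys) e) \<partial>Noise (set (v # ys)) \<sigma>)"
    by (rule nn_integral_Noise_sol_suffix[where f=f and \<sigma>=\<sigma>, OF f \<sigma> F t]) simp
  also have "\<dots> = (\<integral>\<^sup>+ e. (\<integral>\<^sup>+ s. F (sol D \<mu> f (v # ys) (e(v := s))) \<partial>gauss (\<sigma> v)) \<partial>Noise (set ys) \<sigma>)"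
    unfolding list.set(2)
    by (rule nn_integral_Noise_insert[where \<sigma>=\<sigma>, OF \<sigma> _ ty(2)])
      (use measurable_compose[OF sol_measurable[where f=f and \<mu>=\<mu>, OF f tv order_refl] F[OF order_refl]]
        in \<open>auto simp del: sol.simps\<close>)
  also have "\<dots> = (\<integral>\<^sup>+ e. F' (sol D \<mu> f ys e) \<partial>Noise (set ys) \<sigma>)"
  proof (rule nn_integral_cong)
    fix e
    let ?x = "sol D \<mu> f ys e"
    have "restrict (?x(v := y)) (set ys) = ?x" for y
      using ty(2) sol_extensional[of D \<mu> f ys e] by (auto simp: restrict_def fun_eq_iff extensional_def)
    then have "F (sol D \<mu> f (v # ys) (e(v := s))) = indicator a (cmean D \<mu> f v ?x + s) * u ?x" for s
      using ty(2) by (simp add: sol_update_notin F_def)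
    then have "(\<integral>\<^sup>+ s. F (sol D \<mu> f (v # ys) (e(v := s))) \<partial>gauss (\<sigma> v)) =
        (\<integral>\<^sup>+ s. indicator a (cmean D \<mu> f v ?x + s) * u ?x \<partial>gauss (\<sigma> v))" by simp
    also have "\<dots> = F' ?x"
      unfolding F'_def cond_prob_def
    proof (rule nn_integral_multc)
      have "(\<lambda>s. cmean D \<mu> f v ?x + s) \<in> borel_measurable (gauss (\<sigma> v))" by simp
      then show "(\<lambda>s. indicator a (cmean D \<mu> f v ?x + s) :: ennreal) \<in> borel_measurable (gauss (\<sigma> v))"
        by (rule measurable_compose) (use a in simp)
    qed
    finally show "(\<integral>\<^sup>+ s. F (sol D \<mu> f (v # ys) (e(v := s))) \<partial>gauss (\<sigma> v)) = F' ?x" .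
  qed
  also have "\<dots> = (\<integral>\<^sup>+ e. F' (restrict (sol D \<mu> f ((xs @ [v]) @ ys) e) (set ys)) \<partial>Noise (set ((xs @ [v]) @ ys)) \<sigma>)"
    by (rule nn_integral_Noise_sol_suffix[where f=f and \<sigma>=\<sigma>, OF f \<sigma> F', symmetric]) (use t in simp)
  also have "\<dots> = (\<integral>\<^sup>+ x. F' (restrict x (set ys)) \<partial>P)"
    unfolding P_def sem_law_def using nn_integral_distr[OF sm, of "\<lambda>x. F' (restrict x (set ys))"] F'2 by simp
  also have "\<dots> = (\<integral>\<^sup>+ x. ?H x * u (restrict x (set ys)) \<partial>P)"
  proof -
    have "?H (restrict x (set ys)) = ?H x" for x by (rule cond_prob_cong) (use ty in auto)
    then show ?thesis unfolding F'_def by simp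
  qed
  finally show ?thesis by (simp add: F_def)
qed

lemma integral_sem_law_condition:
  fixes \<mu> :: "nat \<Rightarrow> real"
  assumes f: "\<And>l h. f l h \<in> borel_measurable borel" and \<sigma>: "\<And>j. \<sigma> j > 0"
    and t: "topo D (xs @ v # ys)" and a: "a \<in> sets borel" and U: "U \<in> sets (Bor (set ys))"
  defines "P \<equiv> sem_law D \<mu> f \<sigma> (xs @ v # ys)"
  shows "(\<integral>x. indicator a (x v) * indicator U (restrict x (set ys)) \<partial>P) =
    (\<integral>x. enn2real (cond_prob D \<mu> f \<sigma> v a x) * indicator U (restrict x (set ys)) \<partial>P)"
proof -
  let ?L = "xs @ v # ys" and ?H = "cond_prob D \<mu> f \<sigma> v a"
  have S: "sets P = sets (Bor (set ?L))" by (simp add: P_def sem_law_def)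
  have Um: "(\<lambda>x. indicator U (restrict x (set ys)) :: real) \<in> borel_measurable P"
    unfolding measurable_cong_sets[OF S refl]
    by (rule measurable_compose[OF measurable_restrict_subset[of "set ys"]]) (use U in auto)
  have am: "(\<lambda>x. indicator a (x v) :: real) \<in> borel_measurable P"
    unfolding measurable_cong_sets[OF S refl]
    by (rule measurable_compose[OF measurable_component_singleton]) (use a in auto)
  have Hm: "?H \<in> borel_measurable P"
    unfolding measurable_cong_sets[OF S refl]
    by (rule cond_prob_measurable[where f=f and \<sigma>=\<sigma>, OF f \<sigma> _ a]) (use topo_pa_subset[OF t] in auto)
  have H1: "?H x < \<top>" for x
    using cond_prob_le_1[of \<sigma> v D \<mu> f a x] \<sigma> by (simp add: order.strict_trans1)
  have "(\<integral>x. indicator a (x v) * indicator U (restrict x (set ys)) \<partial>P) =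
    enn2real (\<integral>\<^sup>+ x. ennreal (indicator a (x v) * indicator U (restrict x (set ys))) \<partial>P)"
    using am Um by (intro integral_eq_nn_integral) auto
  also have "(\<integral>\<^sup>+ x. ennreal (indicator a (x v) * indicator U (restrict x (set ys))) \<partial>P) =
    (\<integral>\<^sup>+ x. indicator a (x v) * indicator U (restrict x (set ys)) \<partial>P)"
    by (intro nn_integral_cong) (simp add: indicator_def)
  also have "\<dots> = (\<integral>\<^sup>+ x. ?H x * indicator U (restrict x (set ys)) \<partial>P)"
    unfolding P_def by (rule nn_integral_sem_law_condition[where f=f and \<sigma>=\<sigma>, OF f \<sigma> t a]) (use U in simp)
  also have "\<dots> = (\<integral>\<^sup>+ x. ennreal (enn2real (?H x) * indicator U (restrict x (set ys))) \<partial>P)"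
    using H1 by (intro nn_integral_cong) (simp add: indicator_def ennreal_mult)
  also have "enn2real \<dots> = (\<integral>x. enn2real (?H x) * indicator U (restrict x (set ys)) \<partial>P)"
    using Hm Um by (intro integral_eq_nn_integral[symmetric]) auto
  finally show ?thesis .
qed

text \<open>Both the events of the parents and the event at \<open>k\<close> are events of the
  earlier nodes \<open>ys\<close>. Testing against these shows that \<open>h\<close> is the
  conditional probability of the event at \<open>v\<close>, and that this event may be replaced by
  \<open>h\<close> in the joint one. Being a function of the parents, \<open>h\<close> can then be
  taken out of the conditional expectation.\<close>

lemma cond_indep_given_parents:
  assumes f: "\<And>l h. f l h \<in> borel_measurable borel" and \<sigma>: "\<And>j. \<sigma> j > 0"
    and t: "topo D (xs @ v # ys)" and k: "k \<in> set ys"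
  shows "cond_indep (sem_law D \<mu> f \<sigma> (xs @ v # ys)) {v} {k} (pa D v)"
  unfolding cond_indep_def
proof (intro ballI)
  let ?L = "xs @ v # ys" and ?C = "pa D v"
  define P where "P = sem_law D \<mu> f \<sigma> ?L"
  define G where "G = coord_alg P ?C"
  fix a b :: "(nat \<Rightarrow> real) set" assume a: "a \<in> sets (Bor {v})" and b: "b \<in> sets (Bor {k})"
  have C: "?C \<subseteq> set ys" using topo_appendD[OF t] by simp
  interpret prob_space P unfolding P_def by (rule prob_space_sem_law[where f=f and \<sigma>=\<sigma>, OF f \<sigma> t])
  have S: "sets P = sets (Bor (set ?L))" by (simp add: P_def sem_law_def)
  have sp: "space P = space (Bor (set ?L))" by (simp add: P_def sem_law_def)
  have rs: "(\<lambda>x. restrict x J) \<in> P \<rightarrow>\<^sub>M Bor J" if "J \<subseteq> set ?L" for J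
    unfolding measurable_cong_sets[OF S refl] using that by (rule measurable_restrict_subset)
  have rsC: "(\<lambda>x. restrict x ?C) \<in> space P \<rightarrow> space (Bor ?C)"
    using measurable_space[OF rs[of ?C]] C by auto
  have setsG: "sets G = {(\<lambda>x. restrict x ?C) -` A \<inter> space P | A. A \<in> sets (Bor ?C)}"
    unfolding G_def coord_alg_def by (rule sets_vimage_algebra2[OF rsC])
  have sub: "subalgebra P G"
    unfolding subalgebra_def setsG using measurable_sets[OF rs[of ?C]] C
    by (auto simp: G_def coord_alg_def)
  interpret F: finite_measure_subalgebra P G by unfold_locales (rule sub)
  \<comment> \<open>\<open>a\<close> is a set of functions on the single index \<open>v\<close>;
    \<open>a'\<close> is the corresponding set of reals.\<close>
  define a' where "a' = (\<lambda>s. (\<lambda>_. undefined)(v := s)) -` a \<inter> UNIV"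
  have a': "a' \<in> sets borel"
  proof -
    have "(\<lambda>s. (\<lambda>_. undefined)(v := s)) \<in> borel \<rightarrow>\<^sub>M Bor {v}"
      by (rule measurable_fun_upd[of _ "{}"]) (auto simp: space_PiM)
    from measurable_sets[OF this a] show ?thesis by (simp add: a'_def)
  qed
  have ea: "x \<in> coord_event P {v} a \<longleftrightarrow> x v \<in> a'" if "x \<in> space P" for x
  proof -
    have "restrict x {v} = (\<lambda>_. undefined)(v := x v)" by (auto simp: restrict_def fun_eq_iff)
    then show ?thesis using that by (simp add: coord_event_def a'_def)
  qed
  define h where "h x = enn2real (cond_prob D \<mu> f \<sigma> v a' x)" for x
  have hG: "h \<in> borel_measurable G"
  proof -
    have "(\<lambda>x. enn2real (cond_prob D \<mu> f \<sigma> v a' x)) \<in> borel_measurable (Bor ?C)"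
      using cond_prob_measurable[where f=f and \<sigma>=\<sigma> and \<mu>=\<mu>, OF f \<sigma> order_refl a'] by simp
    moreover have "(\<lambda>x. restrict x ?C) \<in> G \<rightarrow>\<^sub>M Bor ?C"
      unfolding G_def coord_alg_def by (rule measurable_vimage_algebra1[OF rsC])
    ultimately have "(\<lambda>x. enn2real (cond_prob D \<mu> f \<sigma> v a' (restrict x ?C))) \<in> borel_measurable G"
      by (rule measurable_compose[rotated])
    moreover have "cond_prob D \<mu> f \<sigma> v a' (restrict x ?C) = cond_prob D \<mu> f \<sigma> v a' x" for x
      by (rule cond_prob_cong) simp
    ultimately show ?thesis by (simp add: h_def[abs_def])
  qed
  have hP: "h \<in> borel_measurable P" by (rule measurable_from_subalg[OF sub hG])
  have h01: "0 \<le> h x" "h x \<le> 1" for x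
  proof -
    have "enn2real (cond_prob D \<mu> f \<sigma> v a' x) \<le> enn2real 1"
      by (rule enn2real_mono) (use cond_prob_le_1[of \<sigma> v D \<mu> f a' x] \<sigma> in auto)
    then show "0 \<le> h x" "h x \<le> 1" by (auto simp: h_def)
  qed
  let ?A = "coord_event P {v} a" and ?B = "coord_event P {k} b"
  have Am: "?A \<in> sets P" and Bm: "?B \<in> sets P"
    using measurable_sets[OF rs[of "{v}"] a] measurable_sets[OF rs[of "{k}"] b] k
    by (auto simp: coord_event_def)
  have intg: "(\<integral>x. indicator ?A x * indicator W x \<partial>P) = (\<integral>x. h x * indicator W x \<partial>P)"
    if U: "U \<in> sets (Bor (set ys))" and W: "\<And>x. x \<in> space P \<Longrightarrow> x \<in> W \<longleftrightarrow> restrict x (set ys) \<in> U" for U W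
  proof -
    have "(\<integral>x. indicator ?A x * indicator W x \<partial>P) = (\<integral>x. indicator a' (x v) * indicator U (restrict x (set ys)) \<partial>P)"
      by (rule Bochner_Integration.integral_cong) (auto simp: indicator_def ea W)
    also have "\<dots> = (\<integral>x. h x * indicator U (restrict x (set ys)) \<partial>P)"
      unfolding P_def h_def by (rule integral_sem_law_condition[where f=f and \<sigma>=\<sigma>, OF f \<sigma> t a' U])
    also have "\<dots> = (\<integral>x. h x * indicator W x \<partial>P)"
      by (rule Bochner_Integration.integral_cong) (auto simp: indicator_def W)
    finally show ?thesis .
  qed
  have GE: "\<exists>U\<in>sets (Bor (set ys)). \<forall>x\<in>space P. x \<in> W \<longleftrightarrow> restrict x (set ys) \<in> U" if W: "W \<in> sets G" for W
  proof -
    obtain A where A: "A \<in> sets (Bor ?C)" "W = (\<lambda>x. restrict x ?C) -` A \<inter> space P" using W setsG by auto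
    let ?U = "(\<lambda>x. restrict x ?C) -` A \<inter> space (Bor (set ys))"
    have "?U \<in> sets (Bor (set ys))" by (rule measurable_sets[OF measurable_restrict_subset[OF C] A(1)])
    moreover have "restrict (restrict x (set ys)) ?C = restrict x ?C" for x :: "nat \<Rightarrow> real"
      using C by (auto simp: restrict_def fun_eq_iff)
    ultimately show ?thesis using A(2) measurable_space[OF rs[of "set ys"]] by (intro bexI[of _ ?U]) auto
  qed
  have BE: "\<exists>U\<in>sets (Bor (set ys)). \<forall>x\<in>space P. x \<in> ?B \<longleftrightarrow> restrict x (set ys) \<in> U"
  proof -
    let ?U = "(\<lambda>x. restrict x {k}) -` b \<inter> space (Bor (set ys))"
    have "?U \<in> sets (Bor (set ys))" by (rule measurable_sets[OF measurable_restrict_subset b]) (use k in auto)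
    moreover have "restrict (restrict x (set ys)) {k} = restrict x {k}" for x :: "nat \<Rightarrow> real"
      using k by (auto simp: restrict_def fun_eq_iff)
    ultimately show ?thesis using measurable_space[OF rs[of "set ys"]]
      by (intro bexI[of _ ?U]) (auto simp: coord_event_def)
  qed
  have iA: "integrable P (indicator ?A :: _ \<Rightarrow> real)" and iB: "integrable P (indicator ?B :: _ \<Rightarrow> real)"
    and iAB: "integrable P (indicator (?A \<inter> ?B) :: _ \<Rightarrow> real)"
    using Am Bm by (auto intro!: integrable_const_bound[where B=1])
  have ih: "integrable P h" by (rule integrable_const_bound[where B=1]) (use h01 hP in auto)
  have ihB: "integrable P (\<lambda>x. h x * indicator ?B x)"
    by (rule integrable_const_bound[where B=1]) (use h01 hP Bm in \<open>auto simp: indicator_def\<close>)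
  have 1: "AE x in P. real_cond_exp P G (indicator ?A) x = h x"
  proof (rule F.real_cond_exp_charact[OF _ iA ih hG])
    fix W assume W: "W \<in> sets G"
    obtain U where "U \<in> sets (Bor (set ys))" "\<forall>x\<in>space P. x \<in> W \<longleftrightarrow> restrict x (set ys) \<in> U" using GE[OF W] by blast
    then show "(\<integral>x\<in>W. indicator ?A x \<partial>P) = (\<integral>x\<in>W. h x \<partial>P)"
      using intg[of U W] by (simp add: set_lebesgue_integral_def mult.commute)
  qed
  have 2: "AE x in P. real_cond_exp P G (indicator (?A \<inter> ?B)) x = real_cond_exp P G (\<lambda>x. h x * indicator ?B x) x"
  proof (rule F.real_cond_exp_charact[OF _ iAB])
    show "integrable P (real_cond_exp P G (\<lambda>x. h x * indicator ?B x))" by (rule F.real_cond_exp_int(1)[OF ihB])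
    show "real_cond_exp P G (\<lambda>x. h x * indicator ?B x) \<in> borel_measurable G" by simp
    fix W assume W: "W \<in> sets G"
    obtain U1 where U1: "U1 \<in> sets (Bor (set ys))" "\<forall>x\<in>space P. x \<in> W \<longleftrightarrow> restrict x (set ys) \<in> U1" using GE[OF W] by blast
    obtain U2 where U2: "U2 \<in> sets (Bor (set ys))" "\<forall>x\<in>space P. x \<in> ?B \<longleftrightarrow> restrict x (set ys) \<in> U2" using BE by blast
    have "(\<integral>x. indicator ?A x * indicator (W \<inter> ?B) x \<partial>P) = (\<integral>x. h x * indicator (W \<inter> ?B) x \<partial>P)"
      by (rule intg[of "U1 \<inter> U2"]) (use U1 U2 in auto)
    then have "(\<integral>x\<in>W. indicator (?A \<inter> ?B) x \<partial>P) = (\<integral>x\<in>W. h x * indicator ?B x \<partial>P)"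
      by (simp add: set_lebesgue_integral_def indicator_inter_arith mult_ac)
    also have "\<dots> = (\<integral>x\<in>W. real_cond_exp P G (\<lambda>x. h x * indicator ?B x) x \<partial>P)"
      by (rule F.real_cond_exp_intA[OF ihB W])
    finally show "(\<integral>x\<in>W. indicator (?A \<inter> ?B) x \<partial>P) = \<dots>" .
  qed
  have 3: "AE x in P. real_cond_exp P G (\<lambda>x. h x * indicator ?B x) x = h x * real_cond_exp P G (indicator ?B) x"
    by (rule F.real_cond_exp_mult[OF hG _ ihB]) (use Bm in simp)
  show "AE x in sem_law D \<mu> f \<sigma> ?L. real_cond_exp (sem_law D \<mu> f \<sigma> ?L) (coord_alg (sem_law D \<mu> f \<sigma> ?L) ?C)
      (indicator (coord_event (sem_law D \<mu> f \<sigma> ?L) {v} a \<inter> coord_event (sem_law D \<mu> f \<sigma> ?L) {k} b)) x =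
     real_cond_exp (sem_law D \<mu> f \<sigma> ?L) (coord_alg (sem_law D \<mu> f \<sigma> ?L) ?C)
       (indicator (coord_event (sem_law D \<mu> f \<sigma> ?L) {v} a)) x *
     real_cond_exp (sem_law D \<mu> f \<sigma> ?L) (coord_alg (sem_law D \<mu> f \<sigma> ?L) ?C)
       (indicator (coord_event (sem_law D \<mu> f \<sigma> ?L) {k} b)) x"
    unfolding P_def[symmetric] G_def[symmetric] using 1 2 3 by eventually_elim simp
qed

section \<open>The faithful generating DAGs\<close>

lemma C2_differentiable: "C2 g \<Longrightarrow> g differentiable (at s)"
  unfolding C2_def real_differentiable_def by blast

lemma C2_add_scaled:
  assumes "C2 g" "C2 h"
  shows "C2 (\<lambda>s. g s + a * h s)"
proof -
  obtain g1 g2 where g: "\<And>x. (g has_real_derivative g1 x) (at x)" "\<And>x. (g1 has_real_derivative g2 x) (at x)"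
    "continuous_on UNIV g2" using assms(1) unfolding C2_def by blast
  obtain h1 h2 where h: "\<And>x. (h has_real_derivative h1 x) (at x)" "\<And>x. (h1 has_real_derivative h2 x) (at x)"
    "continuous_on UNIV h2" using assms(2) unfolding C2_def by blast
  show ?thesis unfolding C2_def
  proof (intro exI conjI allI)
    show "((\<lambda>s. g s + a * h s) has_real_derivative g1 x + a * h1 x) (at x)" for x
      using g(1) h(1) by (auto intro!: derivative_eq_intros)
    show "((\<lambda>s. g1 s + a * h1 s) has_real_derivative g2 x + a * h2 x) (at x)" for x
      using g(2) h(2) by (auto intro!: derivative_eq_intros)
    show "continuous_on UNIV (\<lambda>x. g2 x + a * h2 x)" using g(3) h(3) by (intro continuous_intros)
  qed
qed

lemma C2_affine: "C2 (\<lambda>s. b * s - c)"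
  unfolding C2_def
proof (intro exI conjI allI)
  show "((\<lambda>s. b * s - c) has_real_derivative b) (at x)" for x by (auto intro!: derivative_eq_intros)
  show "((\<lambda>s. b) has_real_derivative 0) (at x)" for x by simp
qed simp

lemma deriv_deriv_affine: "affine_fun g \<Longrightarrow> deriv (deriv g) x = 0"
proof -
  assume "affine_fun g"
  then obtain a b where g: "g = (\<lambda>s. a * s + b)" by (auto simp: affine_fun_def fun_eq_iff)
  have "(g has_real_derivative a) (at s)" for s unfolding g by (auto intro!: derivative_eq_intros)
  then have "deriv g = (\<lambda>_. a)" by (intro ext DERIV_imp_deriv)
  then show ?thesis by simp
qed

lemma affine_fun_C2:
  assumes "C2 g" "\<And>x. deriv (deriv g) x = 0"
  shows "affine_fun g"
proof -
  obtain g1 g2 where g: "\<And>x. (g has_real_derivative g1 x) (at x)" "\<And>x. (g1 has_real_derivative g2 x) (at x)"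
    using assms(1) unfolding C2_def by blast
  have "deriv g = g1" using g(1) by (intro ext DERIV_imp_deriv)
  then have "g2 x = 0" for x using assms(2)[of x] g(2)[of x] by (simp add: DERIV_imp_deriv)
  then have "\<forall>x. (g1 has_real_derivative 0) (at x)" using g(2) by metis
  from DERIV_isconst_all[OF this] have c: "g1 x = g1 0" for x .
  show ?thesis by (rule affine_fun_const_deriv[of g "g1 0"]) (use g(1) c in metis)
qed

lemma is_dag_finite:
  assumes "is_dag p D"
  shows "finite D" "acyclic D" "D \<subseteq> nodes p \<times> nodes p" "finite (nodes p)"
  using assms finite_subset[of D "nodes p \<times> nodes p"] by (auto simp: is_dag_def nodes_def)

lemma ex_topo_nodes:
  assumes "is_dag p D"
  shows "\<exists>L. topo D L \<and> set L = nodes p"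
  using ex_topo_extension[of D "nodes p" "[]"] is_dag_finite[OF assms] by (fastforce simp: pa_def)

text \<open>The proper ancestors of \<open>i\<close> are listed before \<open>i\<close>. By coverage
  \<open>j\<close> has no parents other than \<open>i\<close> and those of \<open>i\<close>, so it
  can follow immediately.\<close>

lemma ex_topo_covered:
  assumes "is_dag p D" "covered D i j"
  shows "\<exists>xs ys. topo D (xs @ j # i # ys) \<and> set (xs @ j # i # ys) = nodes p"
proof -
  note D = is_dag_finite[OF assms(1)]
  define V where "V = {u. (u, i) \<in> D\<^sup>+}"
  have "V \<subseteq> nodes p" using D(3) trancl_subset_Sigma[of D "nodes p"] by (auto simp: V_def)
  then have "finite V" using D(4) finite_subset by blast
  moreover have "pa D l \<subseteq> V" if "l \<in> V" for l using that by (auto simp: V_def pa_def intro: trancl_into_trancl2)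
  ultimately obtain ys where ys: "topo D ys" "set ys = V"
    using ex_topo_extension[of D V "[]"] D by auto
  have ij: "(i, j) \<in> D" "pa D j = insert i (pa D i)" using assms(2) by (auto simp: covered_def pa_def)
  have "i \<notin> V" "j \<notin> V" "i \<noteq> j" using D(2) ij(1) by (auto simp: V_def acyclic_def dest: trancl_into_trancl2)
  moreover have "pa D i \<subseteq> V" by (auto simp: V_def pa_def)
  ultimately have "topo D (j # i # ys)" using ys ij by auto
  moreover have "set (j # i # ys) \<subseteq> nodes p" using ij(1) D(3) ys(2) \<open>V \<subseteq> nodes p\<close> by auto
  moreover have "pa D l \<subseteq> nodes p" for l using D(3) by (auto simp: pa_def)
  ultimately obtain xs where "topo D (xs @ j # i # ys)" "set (xs @ j # i # ys) = nodes p"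
    using ex_topo_extension[OF D(2,1,4)] by metis
  then show ?thesis by blast
qed

section \<open>Normal forms and the linearity of covered edges\<close>

lemma sem_sol_cong:
  assumes "\<And>i j. (i, j) \<in> D \<Longrightarrow> f j i = f' j i"
  shows "sem_sol p D \<mu> f = sem_sol p D \<mu> f'"
proof -
  have "(\<Sum>i\<in>pa D j. f j i (x i)) = (\<Sum>i\<in>pa D j. f' j i (x i))" for j and x :: "nat \<Rightarrow> real"
    by (rule sum.cong) (use assms in \<open>auto simp: pa_def\<close>)
  then show ?thesis by (intro ext) (simp add: sem_sol_def)
qed

lemma noise_law_cong:
  assumes "\<And>j. j \<in> nodes p \<Longrightarrow> \<sigma> j = \<sigma>' j"
  shows "noise_law p \<sigma> = noise_law p \<sigma>'"
  unfolding noise_law_def by (rule PiM_cong) (use assms in auto)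

text \<open>\<open>plsem_generates\<close> speaks about \<open>f\<close> on edges and
  \<open>\<sigma>\<close> on nodes, while the lemmas on \<open>quad\<close> and densities want
  conditions at all indices. Values elsewhere can be reset without changing the law.\<close>

definition normal_form :: "(nat \<times> nat) set \<Rightarrow> (nat \<Rightarrow> nat \<Rightarrow> real \<Rightarrow> real) \<Rightarrow> (nat \<Rightarrow> real) \<Rightarrow> bool" where
  "normal_form D f \<sigma> \<longleftrightarrow> (\<forall>j. \<sigma> j > 0) \<and> (\<forall>h l. (h, l) \<notin> D \<longrightarrow> f l h = (\<lambda>_. 0)) \<and>
     (\<forall>l h s. f l h differentiable (at s))"

lemma plsem_normal_form:
  assumes "plsem_generates p D \<mu> f \<sigma> P"
  obtains f' \<sigma>' where "plsem_generates p D \<mu> f' \<sigma>' P" "normal_form D f' \<sigma>'"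
    "\<And>i j. (i, j) \<in> D \<Longrightarrow> f' j i = f j i"
proof
  let ?f = "\<lambda>j i. if (i, j) \<in> D then f j i else (\<lambda>_. 0)" and ?\<sigma> = "\<lambda>j. if j \<in> nodes p then \<sigma> j else 1"
  have s: "sem_sol p D \<mu> ?f = sem_sol p D \<mu> f" by (rule sem_sol_cong) simp
  have n: "noise_law p ?\<sigma> = noise_law p \<sigma>" by (rule noise_law_cong) simp
  show "plsem_generates p D \<mu> ?f ?\<sigma> P"
    using assms unfolding plsem_generates_def s n by (auto split: prod.splits)
  have "C2 (f l h)" if "(h, l) \<in> D" for h l using assms that unfolding plsem_generates_def by auto
  then show "normal_form D ?f ?\<sigma>"
    using assms C2_differentiable unfolding plsem_generates_def normal_form_def by auto
qed auto

lemma normal_formD: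
  assumes "normal_form D f \<sigma>"
  shows "\<sigma> j > 0" "(h, l) \<notin> D \<Longrightarrow> f l h = (\<lambda>_. 0)" "f l h differentiable (at s)" "f l h \<in> borel_measurable borel"
  using assms differentiable_measurable[of "f l h"] unfolding normal_form_def by auto

lemma distr_sem_sol_eq_sem_law:
  assumes "topo D L" "set L = nodes p"
  shows "distr (noise_law p \<sigma>) (state_space p) (sem_sol p D \<mu> f) = sem_law D \<mu> f \<sigma> L"
  unfolding sem_law_def noise_law_def state_space_def assms(2)
  using sem_sol_eq_sol[OF assms, of \<mu> f] by (simp add: ext[of "sem_sol p D \<mu> f" "sol D \<mu> f L"])

lemma plsem_sem_law:
  assumes "plsem_generates p D \<mu> f \<sigma> P" "topo D L" "set L = nodes p"
  shows "P = sem_law D \<mu> f \<sigma> L"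
  using assms distr_sem_sol_eq_sem_law[OF assms(2,3)] unfolding plsem_generates_def by simp

text \<open>If no PLSEM on \<open>D\<close> makes the edge linear, any chosen one has a nonaffine
  \<open>f j i\<close>. Then every topological order of \<open>D'\<close> puts \<open>j\<close>
  after \<open>i\<close>, whereas the edge j -> i requires the opposite.\<close>

lemma reversed_covered_edge_linear:
  assumes "generated_by_plsem p D P" "generated_by_plsem p D' P" "covered D i j" "(j, i) \<in> D'"
  shows "linear_edge p P D i j"
proof (rule ccontr)
  assume nl: "\<not> linear_edge p P D i j"
  obtain \<mu> f0 \<sigma>0 where p0: "plsem_generates p D \<mu> f0 \<sigma>0 P" using assms(1) by (auto simp: generated_by_plsem_def)
  obtain f \<sigma> where g: "plsem_generates p D \<mu> f \<sigma> P" "normal_form D f \<sigma>"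
    by (rule plsem_normal_form[OF p0])
  obtain \<mu>' f0' \<sigma>0' where q0: "plsem_generates p D' \<mu>' f0' \<sigma>0' P" using assms(2) by (auto simp: generated_by_plsem_def)
  obtain f' \<sigma>' where g': "plsem_generates p D' \<mu>' f' \<sigma>' P" "normal_form D' f' \<sigma>'"
    by (rule plsem_normal_form[OF q0])
  have dag: "is_dag p D" "is_dag p D'" using g(1) g'(1) by (auto simp: plsem_generates_def)
  obtain xs ys where L: "topo D (xs @ j # i # ys)" "set (xs @ j # i # ys) = nodes p"
    using ex_topo_covered[OF dag(1) assms(3)] by blast
  obtain L' where L': "topo D' L'" "set L' = nodes p" using ex_topo_nodes[OF dag(2)] by blast
  have "\<not> affine_fun (f j i)"
    using nl g(1) deriv_deriv_affine unfolding linear_edge_def by blast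
  note n = normal_formD[OF g(2)] and n' = normal_formD[OF g'(2)]
  have "\<exists>c. \<forall>x. quad (xs @ j # i # ys) \<mu> f (\<lambda>l. (\<sigma> l)\<^sup>2) x = quad L' \<mu>' f' (\<lambda>l. (\<sigma>' l)\<^sup>2) x + c"
    by (rule sem_law_quad_eq[OF n(3,1,2) L(1) n'(3,1,2) L'(1)])
      (use L(2) L'(2) plsem_sem_law[OF g(1) L] plsem_sem_law[OF g'(1) L'] in auto)
  then obtain c where c: "\<And>x. quad (xs @ j # i # ys) \<mu> f (\<lambda>l. (\<sigma> l)\<^sup>2) x = quad L' \<mu>' f' (\<lambda>l. (\<sigma>' l)\<^sup>2) x + c"
    by blast
  have pos: "(\<sigma> q)\<^sup>2 > 0" "(\<sigma>' q)\<^sup>2 > 0" for q using n(1)[of q] n'(1)[of q] by simp_all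
  obtain us vs where uv: "L' = us @ j # vs" "i \<in> set vs"
    using quad_nonaffine_order[OF topo_distinct[OF L(1)] pos(1) n(3) \<open>\<not> affine_fun (f j i)\<close>
        topo_distinct[OF L'(1)] _ pos(2) c] L(2) L'(2) by auto
  obtain v1 v2 where v: "vs = v1 @ i # v2" using uv(2) by (meson split_list)
  have "topo D' (i # v2)" using L'(1) topo_appendD[of D' "us @ j # v1" "i # v2"] uv(1) v by simp
  then have "j \<in> set v2" using assms(4) by (auto simp: pa_def)
  then show False using topo_distinct[OF L'(1)] uv(1) v by auto
qed

lemma sol_fun_cong: "(\<And>l x. cmean D \<mu> f l x = cmean E \<mu>' f' l x) \<Longrightarrow> sol D \<mu> f L e = sol E \<mu>' f' L e"
  by (induction L) auto

text \<open>Deleting an edge with zero function leaves the solution and hence the law unchanged, so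
  the local Markov property of the smaller DAG holds for this law. It separates two nodes that are
  adjacent in \<open>D\<close>.\<close>

lemma faithful_edge_nonzero:
  assumes nf: "normal_form D f \<sigma>" and t: "topo D L" and L: "set L = nodes p"
    and fa: "faithful p (sem_law D \<mu> f \<sigma> L) D" and e: "(h, l) \<in> D" "l \<in> nodes p"
  shows "f l h \<noteq> (\<lambda>_. 0)"
proof
  assume z: "f l h = (\<lambda>_. 0)"
  let ?E = "D - {(h, l)}"
  obtain xs ys where ll: "L = xs @ l # ys" using e(2) L by (metis split_list)
  have "topo D (l # ys)" using t ll topo_appendD by blast
  then have h: "h \<in> set ys" and l: "l \<notin> set ys" and ps: "pa D l \<subseteq> set ys" using e(1) by (auto simp: pa_def)
  have tE: "topo ?E L" by (rule topo_mono[OF t]) (auto simp: pa_def)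
  have "cmean D \<mu> f q x = cmean ?E \<mu> f q x" for q x
  proof (cases "q = l")
    case True
    have "pa D l = insert h (pa ?E l)" "h \<notin> pa ?E l" using e(1) by (auto simp: pa_def)
    moreover have "finite (pa D l)" using ps finite_subset by blast
    ultimately show ?thesis using True z by (simp add: cmean_def)
  next
    case False
    then have "pa D q = pa ?E q" by (auto simp: pa_def)
    then show ?thesis by (simp add: cmean_def)
  qed
  then have "sol D \<mu> f L = sol ?E \<mu> f L" by (intro ext) (simp add: sol_fun_cong[of D \<mu> f ?E \<mu> f])
  then have "sem_law D \<mu> f \<sigma> L = sem_law ?E \<mu> f \<sigma> L" by (simp add: sem_law_def)
  then have ci: "cond_indep (sem_law D \<mu> f \<sigma> L) {l} {h} (pa ?E l)"
    using cond_indep_given_parents[OF normal_formD(4,1)[OF nf], of ?E xs l ys h \<mu>] tE h unfolding ll by simp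
  have "pa ?E l \<subseteq> nodes p" "h \<in> nodes p" using ps h ll L by (auto simp: pa_def)
  moreover have "l \<noteq> h" "l \<notin> pa ?E l" "h \<notin> pa ?E l" using h l ps by (auto simp: pa_def)
  ultimately have "d_separated D {l} {h} (pa ?E l)"
    using fa[unfolded faithful_def, rule_format, of "{l}" "{h}" "pa ?E l"] ci e(2) by auto
  moreover have "adjacent D l h" using e(1) by (simp add: adjacent_def)
  ultimately show False using adjacent_not_d_separated \<open>l \<noteq> h\<close> by blast
qed

text \<open>A coordinate is the sum of a constant, integrable edge terms and its Gaussian noise. Its
  mean is what centres the linear function on the reversed edge.\<close>

lemma integrable_coordinate:
  assumes "plsem_generates p D \<mu> f \<sigma> P" "normal_form D f \<sigma>" "j \<in> nodes p"
  shows "integrable P (\<lambda>x. x j)"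
proof -
  have dag: "is_dag p D" using assms(1) by (simp add: plsem_generates_def)
  obtain L where L: "topo D L" "set L = nodes p" using ex_topo_nodes[OF dag] by blast
  have P: "P = distr (Noise (set L) \<sigma>) (Bor (set L)) (sol D \<mu> f L)"
    using plsem_sem_law[OF assms(1) L] by (simp add: sem_law_def)
  note n = normal_formD[OF assms(2)]
  have sm: "sol D \<mu> f L \<in> Noise (set L) \<sigma> \<rightarrow>\<^sub>M Bor (set L)"
    by (rule sol_measurable_Noise[OF n(4) L(1) order_refl])
  have cm: "(\<lambda>x. x q) \<in> borel_measurable (Bor (set L))" if "q \<in> set L" for q
    by (rule measurable_component_singleton[OF that])
  have g: "integrable (Noise (set L) \<sigma>) (\<lambda>e. e j)"
  proof -
    have "distr (Noise (set L) \<sigma>) (gauss (\<sigma> j)) (\<lambda>e. e j) = gauss (\<sigma> j)"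
      by (rule distr_PiM_component) (use L assms(3) n(1) prob_space_gauss in auto)
    moreover have "integrable (gauss (\<sigma> j)) (\<lambda>x. x)"
      by (subst integrable_density) (use integrable_normal_moment_nz_1[OF n(1)] in auto)
    ultimately have "integrable (distr (Noise (set L) \<sigma>) (gauss (\<sigma> j)) (\<lambda>e. e j)) (\<lambda>x. x)" by simp
    then show ?thesis
      by (subst (asm) integrable_distr_eq) (use assms(3) L in \<open>auto intro: measurable_component_singleton\<close>)
  qed
  have s: "integrable (Noise (set L) \<sigma>) (\<lambda>e. f j i (sol D \<mu> f L e i))" if "i \<in> pa D j" for i
  proof -
    have ij: "(i, j) \<in> D" using that by (simp add: pa_def)
    then have "integrable P (\<lambda>x. f j i (x i))" using assms(1) by (auto simp: plsem_generates_def)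
    moreover have "i \<in> set L" using ij is_dag_finite(3)[OF dag] L(2) by auto
    ultimately show ?thesis unfolding P
      by (subst (asm) integrable_distr_eq[OF sm]) (use measurable_compose[OF cm n(4)] in auto)
  qed
  interpret N: prob_space "Noise (set L) \<sigma>" by (rule prob_space_PiM) (use n(1) prob_space_gauss in blast)
  have "integrable (Noise (set L) \<sigma>) (\<lambda>e. cmean D \<mu> f j (sol D \<mu> f L e) + e j)"
    unfolding cmean_def by (intro Bochner_Integration.integrable_add Bochner_Integration.integrable_sum g s) simp
  moreover have "sol D \<mu> f L e j = cmean D \<mu> f j (sol D \<mu> f L e) + e j" for e
    by (rule sol_eq) (use L assms(3) in auto)
  ultimately have "integrable (Noise (set L) \<sigma>) (\<lambda>e. sol D \<mu> f L e j)" by simp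
  then show ?thesis unfolding P by (subst integrable_distr_eq[OF sm cm]) (use L assms(3) in auto)
qed

text \<open>Exchanging the neighbours \<open>i\<close> and \<open>j\<close> preserves the sum of
  squares and thus the law, and faithfulness carries over because the d-separations agree. The rest
  of the work is to meet the conditions on edge functions: support on the new edges, smoothness,
  centring and nonvanishing.\<close>

lemma scrD_reverse_linear:
  assumes D: "D \<in> scrD p P" and cov: "covered D i j" and lin: "linear_edge p P D i j"
  shows "reverse_edge D i j \<in> scrD p P"
proof -
  let ?D = "reverse_edge D i j"
  have dag: "is_dag p D" and fa: "faithful p P D" using D by (auto simp: scrD_def)
  note Df = is_dag_finite[OF dag]
  interpret E: covered_edge D i j by unfold_locales (fact Df(2) cov)+
  have dag': "is_dag p ?D"
    using E.acyclic_reverse Df(3) E.ij(1) by (auto simp: is_dag_def reverse_edge_def)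
  have fa': "faithful p P ?D"
    using fa d_separated_reverse[OF Df(2) cov] unfolding faithful_def by simp
  obtain \<mu> f0 \<sigma>0 where p0: "plsem_generates p D \<mu> f0 \<sigma>0 P" "\<And>x. deriv (deriv (f0 j i)) x = 0"
    using lin by (auto simp: linear_edge_def)
  obtain f \<sigma> where g: "plsem_generates p D \<mu> f \<sigma> P" "normal_form D f \<sigma>" "f j i = f0 j i"
    using plsem_normal_form[OF p0(1)] E.ij(1) by metis
  note n = normal_formD[OF g(2)]
  have C2: "C2 (f l h)" and int: "integrable P (\<lambda>x. f l h (x h))" and mean: "(\<integral>x. f l h (x h) \<partial>P) = 0"
    if "(h, l) \<in> D" for h l using g(1) that by (auto simp: plsem_generates_def)
  have aff: "affine_fun (f j i)" by (rule affine_fun_C2[OF C2[OF E.ij(1)]]) (simp add: g(3) p0(2))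
  obtain xs ys where L: "topo D (xs @ j # i # ys)" "set (xs @ j # i # ys) = nodes p"
    using ex_topo_covered[OF dag cov] by blast
  let ?L = "xs @ j # i # ys" and ?L' = "xs @ i # j # ys"
  have tji: "topo D (j # i # ys)" using L(1) topo_appendD by blast
  have dis: "i \<notin> set ys" "j \<notin> set ys" "i \<notin> set xs" "j \<notin> set xs" using topo_distinct[OF L(1)] by auto
  have paj: "pa ?D j = pa D i" "pa ?D i = insert j (pa D i)"
    using cov E.ij E.loopfree by (auto simp: covered_def pa_def reverse_edge_def)
  have paq: "pa ?D q = pa D q" if "q \<noteq> i" "q \<noteq> j" for q using that by (auto simp: pa_def reverse_edge_def)
  have "pa ?D l \<subseteq> pa D l" if "l \<in> set ys" for l using paq[of l] that dis by (cases "l = i \<or> l = j") auto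
  then have "topo ?D ys" using tji topo_mono[of D ys ?D] by auto
  then have "topo ?D (i # j # ys)" using tji paj dis E.ij(2) by auto
  moreover have "pa ?D l = pa D l" if "l \<in> set xs" for l using paq[of l] that dis by (cases "l = i \<or> l = j") auto
  moreover have "set (j # i # ys) = set (i # j # ys)" by auto
  ultimately have L': "topo ?D ?L'" "set ?L' = nodes p"
    using topo_append_cong[OF L(1)] L(2) by auto
  have s2: "(\<sigma> q)\<^sup>2 > 0" for q using n(1)[of q] by simp
  obtain \<mu>1 f1 w1 a b where q: "\<And>x. quad (j # i # ys) \<mu> f (\<lambda>l. (\<sigma> l)\<^sup>2) x = quad (i # j # ys) \<mu>1 f1 w1 x"
    and w1: "\<And>q. w1 q > 0" and d1: "\<And>q h s. f1 q h differentiable (at s)"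
    and same: "\<And>q. q \<noteq> j \<and> q \<noteq> i \<Longrightarrow> \<mu>1 q = \<mu> q \<and> f1 q = f q \<and> w1 q = (\<sigma> q)\<^sup>2"
    and fij: "f1 i j = (\<lambda>s. b * s)" and fj: "\<And>h. f1 j h = (\<lambda>s. f j h s + a * f i h s)"
    and fi: "\<And>h. h \<noteq> j \<Longrightarrow> f1 i h = (\<lambda>s. f i h s - b * f1 j h s)"
    using quad_swap[of j i ys "\<lambda>l. (\<sigma> l)\<^sup>2" f \<mu>, OF E.ij(2)[symmetric] dis(2,1) s2 n(3) aff]
    by (auto simp del: quad.simps)
  have jn: "j \<in> nodes p" "i \<in> nodes p" using E.ij(1) Df(3) by auto
  have pP: "prob_space P"
    unfolding plsem_sem_law[OF g(1) L] by (rule prob_space_sem_law[OF n(4,1) L(1)])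
  interpret prob_space P by (rule pP)
  have ij: "integrable P (\<lambda>x. x j)" by (rule integrable_coordinate[OF g(1,2) jn(1)])
  text \<open>Reversal turns f i j into a linear function, which has to be centred.\<close>
  define c where "c = b * (\<integral>x. x j \<partial>P)"
  define f2 where "f2 l h = (if (h, l) \<in> ?D then (if h = j \<and> l = i then (\<lambda>s. b * s - c) else f1 l h) else (\<lambda>_. 0))" for l h
  \<comment> \<open>The constant subtracted from the edge function is returned to the mean of
    \<open>i\<close>.\<close>
  define \<mu>2 where "\<mu>2 = \<mu>1(i := \<mu>1 i + c)"
  define \<sigma>2 where "\<sigma>2 l = sqrt (w1 l)" for l
  have \<sigma>2: "\<sigma>2 l > 0" "(\<sigma>2 l)\<^sup>2 = w1 l" for l using w1[of l] by (simp_all add: \<sigma>2_def less_imp_le)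
  have nf2: "normal_form ?D f2 \<sigma>2"
    using \<sigma>2(1) d1 by (auto simp: normal_form_def f2_def intro!: derivative_intros)
  \<comment> \<open>The exceptions \<open>f1 j i\<close> and \<open>f1 i i\<close> are values that
    the formulas of \<open>quad_swap\<close> leave at places the new order never reads;
    \<open>f2\<close> sets them to zero.\<close>
  have z: "f1 l h = (\<lambda>_. 0)" if "(h, l) \<notin> ?D" "h \<noteq> i \<or> l \<noteq> i \<and> l \<noteq> j" for l h
  proof (cases "l = i \<or> l = j")
    case True
    then have "h \<notin> pa D i" using that paj by (auto simp: pa_def)
    moreover have "h \<noteq> i" using that True by auto
    ultimately have "f i h = (\<lambda>_. 0)" "f j h = (\<lambda>_. 0)" using n(2) E.parent_iff by (auto simp: pa_def)
    moreover have "l = i \<Longrightarrow> h \<noteq> j" using that E.ij by auto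
    ultimately show ?thesis using True fi[of h] fj[of h] by auto
  next
    case False
    then show ?thesis using same[of l] that n(2)[of h l] by (auto simp: reverse_edge_def)
  qed
  have f2: "f2 l h = f1 l h" if "h \<noteq> i \<or> l \<noteq> i \<and> l \<noteq> j" "h \<noteq> j \<or> l \<noteq> i" for l h
    using z[OF _ that(1)] that(2) by (auto simp: f2_def)
  have f2q: "f2 q = f1 q" if "q \<noteq> i" "q \<noteq> j" for q using f2 that by (intro ext) metis
  have q2: "quad ?L \<mu> f (\<lambda>l. (\<sigma> l)\<^sup>2) x = quad ?L' \<mu>2 f2 (\<lambda>l. (\<sigma>2 l)\<^sup>2) x" for x
  proof -
    have xs: "q \<noteq> i \<and> q \<noteq> j" if "q \<in> set xs" for q using dis that by auto
    have "quad ?L \<mu> f (\<lambda>l. (\<sigma> l)\<^sup>2) x = quad ?L' \<mu>1 f1 w1 x"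
      by (rule quad_append_cong) (use q same xs in \<open>auto simp del: quad.simps\<close>)
    also have "\<dots> = quad ?L' \<mu>2 f2 w1 x"
    proof (rule quad_append_cong)
      show "\<mu>1 q = \<mu>2 q \<and> f1 q = f2 q \<and> w1 q = w1 q" if "q \<in> set xs" for q
        using xs[OF that] f2q[of q] by (simp add: \<mu>2_def)
      fix x
      have "f2 l h = f1 l h" if "h \<in> set ys" for l h
      proof -
        have "h \<noteq> i" "h \<noteq> j" using that dis by auto
        then show ?thesis using f2 by simp
      qed
      then have "(\<Sum>h\<in>set ys. f2 i h (x h)) = (\<Sum>h\<in>set ys. f1 i h (x h))"
        "(\<Sum>h\<in>set ys. f2 j h (x h)) = (\<Sum>h\<in>set ys. f1 j h (x h))"
        by (auto intro!: sum.cong)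
      moreover have "f2 i j = (\<lambda>s. b * s - c)" using E.ij(4) by (simp add: f2_def)
      moreover have "quad ys \<mu>2 f2 w1 x = quad ys \<mu>1 f1 w1 x"
      proof (rule quad_param_cong)
        fix q assume "q \<in> set ys"
        then have "q \<noteq> i" "q \<noteq> j" using dis by auto
        then show "\<mu>2 q = \<mu>1 q \<and> f2 q = f1 q \<and> w1 q = w1 q" using f2q[of q] by (simp add: \<mu>2_def)
      qed
      ultimately show "quad (i # j # ys) \<mu>1 f1 w1 x = quad (i # j # ys) \<mu>2 f2 w1 x"
        using dis(2) E.ij(2) by (simp add: fij \<mu>2_def algebra_simps)
    qed simp
    finally show ?thesis by (simp add: \<sigma>2(2))
  qed
  have "P = sem_law ?D \<mu>2 f2 \<sigma>2 ?L'"
    unfolding plsem_sem_law[OF g(1) L]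
    by (rule sem_law_eqI_quad[OF n(3,1,2) L(1) normal_formD(3,1,2)[OF nf2] L'(1) _ q2]) auto
  then have P2: "P = distr (noise_law p \<sigma>2) (state_space p) (sem_sol p ?D \<mu>2 f2)"
    and fa2: "faithful p (sem_law ?D \<mu>2 f2 \<sigma>2 ?L') ?D"
    using distr_sem_sol_eq_sem_law[OF L'] fa' by auto
  have "C2 (f2 l h) \<and> f2 l h \<noteq> (\<lambda>_. 0) \<and> integrable P (\<lambda>x. f2 l h (x h)) \<and> (\<integral>x. f2 l h (x h) \<partial>P) = 0"
    if hl: "(h, l) \<in> ?D" for h l
  proof -
    have nz: "f2 l h \<noteq> (\<lambda>_. 0)"
      by (rule faithful_edge_nonzero[OF nf2 L' fa2 hl]) (use hl dag' in \<open>auto simp: is_dag_def\<close>)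
    have F: "C2 (\<lambda>s. g s + r * g' s) \<and> integrable P (\<lambda>x. g (x h) + r * g' (x h)) \<and> (\<integral>x. g (x h) + r * g' (x h) \<partial>P) = 0"
      if "C2 g \<and> integrable P (\<lambda>x. g (x h)) \<and> (\<integral>x. g (x h) \<partial>P) = 0"
        "C2 g' \<and> integrable P (\<lambda>x. g' (x h)) \<and> (\<integral>x. g' (x h) \<partial>P) = 0" for g g' :: "real \<Rightarrow> real" and r
      using that C2_add_scaled by simp
    consider (new) "h = j" "l = i" | (j) "l = j" "h \<in> pa D i" | (i) "l = i" "h \<noteq> j" "h \<in> pa D i" | (other) "l \<noteq> i" "l \<noteq> j"
      using hl paj by (auto simp: pa_def)
    then show ?thesis
    proof cases
      case new
      have "f2 l h = (\<lambda>s. b * s - c)" using new hl by (simp add: f2_def)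
      moreover have "integrable P (\<lambda>x. b * x j - c)" using ij by simp
      moreover have "(\<integral>x. b * x j - c \<partial>P) = 0" using ij by (simp add: c_def prob_space)
      ultimately show ?thesis using nz new C2_affine by simp
    next
      case j
      then have h: "(h, i) \<in> D" "(h, j) \<in> D" using E.parentD by (auto simp: pa_def)
      have "f2 l h = (\<lambda>s. f j h s + a * f i h s)" using j hl fj E.ij(2) by (simp add: f2_def)
      then show ?thesis using nz F[of "f j h" "f i h" a] h C2 int mean by simp
    next
      case i
      then have h: "(h, i) \<in> D" "(h, j) \<in> D" using E.parentD by (auto simp: pa_def)
      have j': "C2 (f1 j h) \<and> integrable P (\<lambda>x. f1 j h (x h)) \<and> (\<integral>x. f1 j h (x h) \<partial>P) = 0"
        using F[of "f j h" "f i h" a] h C2 int mean unfolding fj by simp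
      have "f2 l h = (\<lambda>s. f i h s + (- b) * f1 j h s)" using i hl fi by (simp add: f2_def)
      then show ?thesis using nz F[of "f i h" "f1 j h" "- b"] h C2 int mean j' by simp
    next
      case other
      then have "(h, l) \<in> D" "f2 l h = f l h" using hl same[of l] by (auto simp: f2_def reverse_edge_def)
      then show ?thesis using nz C2 int mean by simp
    qed
  qed
  then have "plsem_generates p ?D \<mu>2 f2 \<sigma>2 P"
    using dag' P2 \<sigma>2(1) unfolding plsem_generates_def by blast
  then show ?thesis using dag' fa' by (auto simp: scrD_def generated_by_plsem_def)
qed

lemma scrD_dsep_equiv: "D \<in> scrD p P \<Longrightarrow> E \<in> scrD p P \<Longrightarrow> dsep_equiv (nodes p) D E"
  unfolding dsep_equiv_def
proof (intro allI impI)
  fix A B C assume *: "A \<subseteq> nodes p \<and> B \<subseteq> nodes p \<and> C \<subseteq> nodes p \<and> A \<inter> B = {} \<and> A \<inter> C = {} \<and> B \<inter> C = {}"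
  assume "D \<in> scrD p P" "E \<in> scrD p P"
  then have "faithful p P D" "faithful p P E" by (simp_all add: scrD_def)
  from this[unfolded faithful_def, rule_format, OF *] show "d_separated D A B C \<longleftrightarrow> d_separated E A B C" by simp
qed

theorem mainTheorem2:
  fixes p :: nat and P :: "(nat \<Rightarrow> real) measure" and D0 :: "(nat \<times> nat) set"
  assumes "is_dag p D0" and "generated_by_plsem p D0 P" and "faithful p P D0"
  shows "(\<forall>D\<in>scrD p P. \<forall>i j. covered D i j \<longrightarrow>
            ((reverse_edge D i j \<in> scrD p P \<longleftrightarrow> linear_edge p P D i j) \<and>
             (\<not> linear_edge p P D i j \<longrightarrow> (\<forall>D'\<in>scrD p P. (i, j) \<in> D'))))
       \<and> (\<forall>D\<in>scrD p P. \<forall>D'\<in>scrD p P.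
            \<exists>Ds es. length Ds = Suc (length es) \<and> Ds ! 0 = D \<and> last Ds = D' \<and>
              set Ds \<subseteq> scrD p P \<and>
              (\<forall>r<length es. covered (Ds ! r) (fst (es ! r)) (snd (es ! r)) \<and>
                 linear_edge p P (Ds ! r) (fst (es ! r)) (snd (es ! r)) \<and>
                 Ds ! Suc r = reverse_edge (Ds ! r) (fst (es ! r)) (snd (es ! r))) \<and>
              distinct (map (\<lambda>e. {fst e, snd e}) es))"
proof -
  have dag: "acyclic D \<and> D \<subseteq> nodes p \<times> nodes p" if "D \<in> scrD p P" for D
    using that by (auto simp: scrD_def is_dag_def)
  have lin: "linear_edge p P D i j" if "D \<in> scrD p P" "E \<in> scrD p P" "covered D i j" "(j, i) \<in> E" for D E i j
    using that reversed_covered_edge_linear by (auto simp: scrD_def)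
  have "(reverse_edge D i j \<in> scrD p P \<longleftrightarrow> linear_edge p P D i j) \<and>
      (\<not> linear_edge p P D i j \<longrightarrow> (\<forall>D'\<in>scrD p P. (i, j) \<in> D'))" if D: "D \<in> scrD p P" and c: "covered D i j" for D i j
  proof (intro conjI iffI impI ballI)
    assume "reverse_edge D i j \<in> scrD p P"
    then show "linear_edge p P D i j" using lin[OF D _ c] by (auto simp: reverse_edge_def)
  next
    assume "linear_edge p P D i j"
    then show "reverse_edge D i j \<in> scrD p P" using scrD_reverse_linear D c by blast
  next
    \<comment> \<open>\<open>D'\<close> is Markov equivalent to \<open>D\<close>, so it also joins
      \<open>i\<close> and \<open>j\<close>, and the orientation j -> i would make the edge
      linear.\<close>
    fix D' assume nl: "\<not> linear_edge p P D i j" and D': "D' \<in> scrD p P"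
    have "adjacent D i j" using c by (auto simp: covered_def adjacent_def)
    then have "adjacent D' i j"
      using dsep_equiv_adjacent_imp[OF scrD_dsep_equiv[OF D D']] dag[OF D] dag[OF D'] by blast
    then show "(i, j) \<in> D'" using lin[OF D D' c] nl by (auto simp: adjacent_def)
  qed
  moreover have "\<exists>Ds es. length Ds = Suc (length es) \<and> Ds ! 0 = D \<and> last Ds = D' \<and>
              set Ds \<subseteq> scrD p P \<and>
              (\<forall>r<length es. covered (Ds ! r) (fst (es ! r)) (snd (es ! r)) \<and>
                 linear_edge p P (Ds ! r) (fst (es ! r)) (snd (es ! r)) \<and>
                 Ds ! Suc r = reverse_edge (Ds ! r) (fst (es ! r)) (snd (es ! r))) \<and>
              distinct (map (\<lambda>e. {fst e, snd e}) es)" if "D \<in> scrD p P" "D' \<in> scrD p P" for D D'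
  proof -
    have "\<exists>Ds es. length Ds = Suc (length es) \<and> Ds ! 0 = D \<and> last Ds = D' \<and> set Ds \<subseteq> scrD p P \<and>
      (\<forall>r<length es. covered (Ds ! r) (fst (es ! r)) (snd (es ! r)) \<and>
         linear_edge p P (Ds ! r) (fst (es ! r)) (snd (es ! r)) \<and>
         Ds ! Suc r = reverse_edge (Ds ! r) (fst (es ! r)) (snd (es ! r))) \<and>
      distinct (map (\<lambda>e. {fst e, snd e}) es) \<and> set es \<subseteq> reversed_edges D D'"
    proof (rule covered_reversal_sequence[where V = "nodes p"])
      show "finite (nodes p)" by (simp add: nodes_def)
      show "linear_edge p P D i j" if "D \<in> scrD p P" "E \<in> scrD p P" "covered D i j" "(j, i) \<in> E" for D E i j
        by (rule lin[OF that])
    qed (fact dag scrD_dsep_equiv scrD_reverse_linear that)+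
    then show ?thesis by blast
  qed
  ultimately show ?thesis by blast
qed

end
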